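(* Let $\mathcal{T}_h$ be a triangulation of a domain $\Omega\subset\mathbb{R}^2$ as described in the context, and let $(K,\mathcal{P}_K,\Sigma_K)$ be the affine Lagrange element (Courant's triangle), using as degrees of freedom the values at the vertices, leading to the space $V_h=C^0(\Omega)\cap\mathcal{P}_1(\mathcal{T}_h)$. For $K\in\mathcal{T}_h$ let $\omega_K$ be the collection of triangles that share a vertex with $K$, and let $h=\max_{K'\in\omega_K}h_{K'}$. (i) Let $u\in C^0(\Omega)\cap H^1(\mathcal{T}_h)$. There exists $\chi\in V_h$ such that for every $K\in\mathcal{T}_h$ $$\|u-\chi\|_K\le c\,h\,|u|_{1,\omega_K}.$$ (ii) Let $u\in C^0(\Omega)\cap H^2(\mathcal{T}_h)$. There exists $\chi\in V_h$ such that for every $K\in\mathcal{T}_h$ $$|u-\chi|_{l,K}\le c\,h^{2-l}\,|u|_{2,\omega_K},\qquad l=0,1.$$ The constants $c$ are independent of $u$ and of the mesh sizes.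
   Context: $\mathcal{T}_h$ is a two-dimensional partition of $\Omega$ into triangles, or more precisely tri-sided cells: the peripheral cells (those having a side on $\partial\Omega$) may have one curved side, are convex, and contain a regular (straight-sided) triangle which is used to define the nodes. All triangles are shape-regular (minimum angle condition) and the mesh is locally quasi-uniform, i.e. diameters of adjacent triangles are commensurate. The cells are Lipschitz and starlike, in the sense that the set $S$ of points $\mathbf p$ of $K$ with $[\mathbf p,\mathbf x]\subset K$ for all $\mathbf x\in K$ has positive measure, and for some $\mathbf p\in S$ and constant $c_0>0$, $(\mathbf x-\mathbf p)\cdot\boldsymbol\nu\ge c_0\,\mathrm{diam}(K)$ for almost all $\mathbf x\in\partial K$, $\boldsymbol\nu$ being the unit outward normal. $h_K=\mathrm{diam}(K)$. $\mathcal{P}_1(\mathcal{T}_h)$ is the space of functions that are polynomials of degree at most $1$ on each cell. $H^m(\mathcal{T}_h)$ is the broken Sobolev space of functions whose restriction to each $K\in\mathcal{T}_h$ is in $H^m(K)$. $\|\cdot\|_K$ is the $L^2(K)$ norm, $|v|_{l,K}^2=\sum_{|\alpha|=l}\|\partial^\alpha v\|_K^2$, and $|v|_{l,\omega_K}^2=\sum_{K'\in\omega_K}|v|_{l,K'}^2$ (with $K\in\omega_K$). *)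

theory Defs
  imports "HOL-Analysis.Analysis"
begin

type_synonym R2 = "real^2"

section \<open>Sobolev spaces on open subsets of the plane\<close>

definition partial :: "2 \<Rightarrow> (R2 \<Rightarrow> real) \<Rightarrow> R2 \<Rightarrow> real" where
  "partial i f x = frechet_derivative f (at x) (axis i 1)"

primrec C_k :: "nat \<Rightarrow> (R2 \<Rightarrow> real) \<Rightarrow> bool" where
  "C_k 0 f \<longleftrightarrow> continuous_on UNIV f"
| "C_k (Suc k) f \<longleftrightarrow> (\<forall>x. f differentiable (at x)) \<and> (\<forall>i. C_k k (partial i f))"

text \<open>Multi-indices are functions \<open>2 \<Rightarrow> nat\<close>. Note that \<open>1\<close> and \<open>2\<close> are the two elements
  of the type \<open>2\<close>.\<close>

definition mi_order :: "(2 \<Rightarrow> nat) \<Rightarrow> nat" where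
  "mi_order \<alpha> = (\<Sum>i\<in>UNIV. \<alpha> i)"

definition multi_partial :: "(2 \<Rightarrow> nat) \<Rightarrow> (R2 \<Rightarrow> real) \<Rightarrow> R2 \<Rightarrow> real" where
  "multi_partial \<alpha> f = (partial 1 ^^ \<alpha> 1) ((partial 2 ^^ \<alpha> 2) f)"

definition test_functions :: "R2 set \<Rightarrow> (R2 \<Rightarrow> real) set" where
  "test_functions S =
    {\<phi>. (\<forall>k. C_k k \<phi>) \<and> compact (closure {x. \<phi> x \<noteq> 0}) \<and> closure {x. \<phi> x \<noteq> 0} \<subseteq> S}"

definition L2_space :: "R2 set \<Rightarrow> (R2 \<Rightarrow> real) set" where
  "L2_space S = {v. v \<in> borel_measurable (lebesgue_on S) \<and>
                    integrable (lebesgue_on S) (\<lambda>x. (v x)\<^sup>2)}"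

definition L2_norm :: "R2 set \<Rightarrow> (R2 \<Rightarrow> real) \<Rightarrow> real" where
  "L2_norm S v = sqrt (LINT x|lebesgue_on S. (v x)\<^sup>2)"

text \<open>The integrals below are meaningful for locally integrable \<open>v\<close> and \<open>g\<close>; the predicate is
  used for members of \<open>L2_space S\<close> only.\<close>

definition is_weak_partial ::
    "R2 set \<Rightarrow> (2 \<Rightarrow> nat) \<Rightarrow> (R2 \<Rightarrow> real) \<Rightarrow> (R2 \<Rightarrow> real) \<Rightarrow> bool" where
  "is_weak_partial S \<alpha> v g \<longleftrightarrow>
    (\<forall>\<phi>\<in>test_functions S.
       (LINT x|lebesgue_on S. v x * multi_partial \<alpha> \<phi> x) =
       (- 1) ^ mi_order \<alpha> * (LINT x|lebesgue_on S. g x * \<phi> x))"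

definition sobolev_space :: "nat \<Rightarrow> R2 set \<Rightarrow> (R2 \<Rightarrow> real) set" where
  "sobolev_space m S =
    {v \<in> L2_space S. \<forall>\<alpha>. mi_order \<alpha> \<le> m \<longrightarrow> (\<exists>g\<in>L2_space S. is_weak_partial S \<alpha> v g)}"

text \<open>Weak derivatives are unique up to null sets, so the choice does not affect the seminorm.\<close>

definition weak_partial :: "R2 set \<Rightarrow> (2 \<Rightarrow> nat) \<Rightarrow> (R2 \<Rightarrow> real) \<Rightarrow> R2 \<Rightarrow> real" where
  "weak_partial S \<alpha> v = (SOME g. g \<in> L2_space S \<and> is_weak_partial S \<alpha> v g)"

definition sobolev_seminorm :: "nat \<Rightarrow> R2 set \<Rightarrow> (R2 \<Rightarrow> real) \<Rightarrow> real" where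
  "sobolev_seminorm l S v =
    sqrt (\<Sum>\<alpha> | mi_order \<alpha> = l. (L2_norm S (weak_partial S \<alpha> v))\<^sup>2)"

lemma finite_mi_order: "finite {\<alpha>. mi_order \<alpha> = l}"
proof (rule finite_subset)
  show "{\<alpha>. mi_order \<alpha> = l} \<subseteq> PiE UNIV (\<lambda>_. {..l})"
    by (auto simp: mi_order_def intro: member_le_sum)
  show "finite (PiE (UNIV :: 2 set) (\<lambda>_. {..l}))"
    by (intro finite_PiE) auto
qed

section \<open>Triangulations with curved peripheral cells\<close>

text \<open>A triangulation is a finite set \<open>T\<close> of closed cells with a map \<open>N\<close> giving the three nodes
  of each cell; \<open>convex hull (N K)\<close> is the straight-sided triangle contained in \<open>K\<close>, and it is
  \<open>K\<close> itself unless \<open>K\<close> has a curved side. The curved side is what remains of \<open>frontier K\<close>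
  after removing the two straight sides that meet at the node \<open>a\<close>. Cells are convex bodies,
  hence Lipschitz.\<close>

definition straight_cell :: "R2 set \<Rightarrow> R2 set \<Rightarrow> bool" where
  "straight_cell K V \<longleftrightarrow> card V = 3 \<and> \<not> collinear V \<and> K = convex hull V"

definition curved_cell :: "R2 set \<Rightarrow> R2 set \<Rightarrow> R2 set \<Rightarrow> bool" where
  "curved_cell \<Omega> K V \<longleftrightarrow>
    card V = 3 \<and> \<not> collinear V \<and> V \<subseteq> K \<and> compact K \<and> convex K \<and>
    (\<exists>a\<in>V. (\<forall>b\<in>V - {a}. closed_segment a b \<subseteq> frontier K) \<and>
            frontier K - (\<Union>b\<in>V - {a}. closed_segment a b) \<subseteq> frontier \<Omega>)"

text \<open>The condition on \<open>K \<inter> K'\<close> says that distinct cells meet in nothing, in a common vertex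
  or in a whole common side (no hanging nodes). By the last condition each straight side either
  lies on the boundary of the domain or is interior to it up to its end points; this is automatic
  unless the domain has slits.\<close>

definition conforming_mesh :: "R2 set \<Rightarrow> R2 set set \<Rightarrow> (R2 set \<Rightarrow> R2 set) \<Rightarrow> bool" where
  "conforming_mesh \<Omega> T N \<longleftrightarrow>
    finite T \<and> \<Union>T = closure \<Omega> \<and>
    (\<forall>K\<in>T. straight_cell K (N K) \<or> curved_cell \<Omega> K (N K)) \<and>
    (\<forall>K\<in>T. interior K \<subseteq> \<Omega>) \<and>
    (\<forall>K\<in>T. \<forall>K'\<in>T. K \<noteq> K' \<longrightarrow>
       interior K \<inter> interior K' = {} \<and> K \<inter> K' = convex hull (N K \<inter> N K')) \<and>
    (\<forall>K\<in>T. \<forall>a\<in>N K. \<forall>b\<in>N K. a \<noteq> b \<and> closed_segment a b \<subseteq> frontier K \<longrightarrow>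
       open_segment a b \<subseteq> \<Omega> \<or> closed_segment a b \<subseteq> frontier \<Omega>)"

definition angle_at :: "R2 \<Rightarrow> R2 \<Rightarrow> R2 \<Rightarrow> real" where
  "angle_at a b c = arccos (((b - a) \<bullet> (c - a)) / (norm (b - a) * norm (c - a)))"

definition min_angle_condition :: "real \<Rightarrow> R2 set set \<Rightarrow> (R2 set \<Rightarrow> R2 set) \<Rightarrow> bool" where
  "min_angle_condition \<theta> T N \<longleftrightarrow>
    (\<forall>K\<in>T. \<forall>a b c. N K = {a, b, c} \<longrightarrow> \<theta> \<le> angle_at a b c)"

text \<open>Cells are adjacent if they share a side. The diameter of a cell is compared with that of the
  straight-sided triangles of its neighbours and of its own (the case \<open>K = K'\<close>), so that a curved
  cell and the triangle defining its nodes are commensurate. For straight cells this is the usual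
  \<open>diameter K \<le> \<kappa> * diameter K'\<close>.\<close>

definition locally_quasi_uniform :: "real \<Rightarrow> R2 set set \<Rightarrow> (R2 set \<Rightarrow> R2 set) \<Rightarrow> bool" where
  "locally_quasi_uniform \<kappa> T N \<longleftrightarrow>
    (\<forall>K\<in>T. \<forall>K'\<in>T. card (N K \<inter> N K') \<ge> 2 \<longrightarrow>
       diameter K \<le> \<kappa> * diameter (convex hull (N K')))"

definition star_kernel :: "R2 set \<Rightarrow> R2 set" where
  "star_kernel K = {p \<in> K. \<forall>x\<in>K. closed_segment p x \<subseteq> K}"

text \<open>Null sets of the one-dimensional Hausdorff measure, i.e. of arc length on \<open>frontier K\<close>.\<close>

definition length_null :: "R2 set \<Rightarrow> bool" where
  "length_null A \<longleftrightarrow>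
    (\<forall>e>0. \<exists>C :: nat \<Rightarrow> R2 set. A \<subseteq> (\<Union>n. C n) \<and> (\<forall>n. bounded (C n)) \<and>
       summable (\<lambda>n. diameter (C n)) \<and> (\<Sum>n. diameter (C n)) < e)"

text \<open>Near \<open>x\<close> the set \<open>K\<close> agrees to first order with the half-plane below the tangent at \<open>x\<close>.
  On a Lipschitz boundary this determines the normal at each point where the boundary is
  differentiable.\<close>

definition outward_unit_normal :: "R2 set \<Rightarrow> R2 \<Rightarrow> R2 \<Rightarrow> bool" where
  "outward_unit_normal K x \<nu> \<longleftrightarrow> norm \<nu> = 1 \<and>
    (\<forall>e>0. \<exists>d>0. \<forall>y\<in>ball x d.
       (y \<in> K \<longrightarrow> (y - x) \<bullet> \<nu> \<le> e * norm (y - x)) \<and>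
       ((y - x) \<bullet> \<nu> < - e * norm (y - x) \<longrightarrow> y \<in> K))"

definition starlike_cell :: "real \<Rightarrow> R2 set \<Rightarrow> bool" where
  "starlike_cell c\<^sub>0 K \<longleftrightarrow>
    emeasure lebesgue (star_kernel K) > 0 \<and>
    (\<exists>p\<in>star_kernel K. \<exists>A. length_null A \<and>
       (\<forall>x\<in>frontier K - A. \<exists>\<nu>. outward_unit_normal K x \<nu> \<and> c\<^sub>0 * diameter K \<le> (x - p) \<bullet> \<nu>))"

definition regular_mesh ::
    "R2 set \<Rightarrow> real \<Rightarrow> real \<Rightarrow> real \<Rightarrow> R2 set set \<Rightarrow> (R2 set \<Rightarrow> R2 set) \<Rightarrow> bool" where
  "regular_mesh \<Omega> \<theta> \<kappa> c\<^sub>0 T N \<longleftrightarrow>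
    conforming_mesh \<Omega> T N \<and> min_angle_condition \<theta> T N \<and> locally_quasi_uniform \<kappa> T N \<and>
    (\<forall>K\<in>T. starlike_cell c\<^sub>0 K)"

section \<open>Broken spaces and the Courant space\<close>

text \<open>Cells are closed and \<open>\<Omega>\<close> is open: functions are regarded on the interiors of the cells, and
  values on the boundary of \<open>\<Omega>\<close> play no role.\<close>

definition C0_space :: "R2 set \<Rightarrow> (R2 \<Rightarrow> real) set" where
  "C0_space \<Omega> = {v. continuous_on \<Omega> v}"

definition broken_sobolev :: "nat \<Rightarrow> R2 set set \<Rightarrow> (R2 \<Rightarrow> real) set" where
  "broken_sobolev m T = {v. \<forall>K\<in>T. v \<in> sobolev_space m (interior K)}"

definition broken_P1 :: "R2 set set \<Rightarrow> (R2 \<Rightarrow> real) set" where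
  "broken_P1 T = {v. \<forall>K\<in>T. \<exists>a b. \<forall>x\<in>interior K. v x = a + b \<bullet> x}"

definition courant_space :: "R2 set \<Rightarrow> R2 set set \<Rightarrow> (R2 \<Rightarrow> real) set" where
  "courant_space \<Omega> T = C0_space \<Omega> \<inter> broken_P1 T"

definition patch :: "R2 set set \<Rightarrow> (R2 set \<Rightarrow> R2 set) \<Rightarrow> R2 set \<Rightarrow> R2 set set" where
  "patch T N K = {K' \<in> T. N K \<inter> N K' \<noteq> {}}"

definition patch_size :: "R2 set set \<Rightarrow> (R2 set \<Rightarrow> R2 set) \<Rightarrow> R2 set \<Rightarrow> real" where
  "patch_size T N K = Max (diameter ` patch T N K)"

definition patch_seminorm ::
    "nat \<Rightarrow> R2 set set \<Rightarrow> (R2 set \<Rightarrow> R2 set) \<Rightarrow> R2 set \<Rightarrow> (R2 \<Rightarrow> real) \<Rightarrow> real" where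
  "patch_seminorm l T N K v =
    sqrt (\<Sum>K'\<in>patch T N K. (sobolev_seminorm l (interior K') v)\<^sup>2)"

end

theory Submission
  imports Defs
begin

text \<open>The function \<open>w\<close> is a quasi-interpolant in the sense of Clement. On each cell \<open>K\<close> there is a polynomial of degree at
most one that is close to \<open>u\<close> in the norm of \<open>L2_space (interior K)\<close> together with its gradient: a constant for the
first part, an affine function for the second (\<open>affine_close\<close>, \<open>constant_approximation\<close>,
\<open>affine_approximation\<close>). These local polynomials do not fit together. The cells at a vertex \<open>a\<close> are therefore
grouped into fans, two cells being linked if they share a side at \<open>a\<close> that runs through the domain; one cell of each
fan is chosen, and \<open>w\<close> takes at \<open>a\<close>, on all cells of the fan, the value of the polynomial of the chosen cell. Around a
vertex inside \<open>\<Omega>\<close> there is one fan only, because a punctured disk is connected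
(\<open>interior_fan_connected\<close>); at a vertex on the boundary, for instance on a slit, different fans may
take different values, which does no harm to the continuity on \<open>\<Omega>\<close> (\<open>glued_continuous\<close>).

The error on \<open>K\<close> is the error of the local polynomial plus an affine function whose value at a node \<open>a\<close> is the
difference of the local polynomials of two cells of one fan. For two cells with a common side both polynomials are close
to \<open>u\<close> on this side, by a trace inequality on either cell and because \<open>u\<close> is continuous across the side; hence their
difference at \<open>a\<close> is small (\<open>jump_at_vertex\<close>). A chain of linked cells has bounded length, since the minimum
angle condition bounds the number of cells at a vertex (\<open>card_cells_at_vertex\<close>). An affine function that is
small at the nodes of a shape regular triangle is small, with its gradient, on the cell
(\<open>affine_small_on_cell\<close>). Both parts of the theorem are instances of the resulting estimate
\<open>quasi_interpolant\<close>.

The two inequalities on a single cell need constants that do not depend on the shape of a curved cell.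

\<^item> \<open>poincare\<close>, for every bounded convex open set: \<open>(v x - v y)\<^sup>2\<close> is bounded by the average of the squared
  gradient over the segment from \<open>x\<close> to \<open>y\<close>, times the squared length. Integrate over \<open>x\<close> and \<open>y\<close>; at a point \<open>(1 - t) y + t x\<close> of the segment one
  of the two coefficients is at least \<open>1/2\<close>, and the substitution in the corresponding variable costs at most a factor
  \<open>4\<close>.
\<^item> \<open>trace_inequality\<close>, on a parallelogram inside the straight triangle: the value at a point of the edge
  differs from the values on a line from this point into the parallelogram by at most an integral of the gradient along
  that line.

For weakly differentiable functions both are proved for mollified functions. These converge to \<open>v\<close> when integrated
against test functions, and pointwise where \<open>v\<close> is continuous. The first mode of convergence gives Poincare's
inequality in a form tested against two test functions, and \<open>L2_norm_by_duality\<close> turns it into a bound of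
norms; the second one, with Fatou's lemma, suffices for the trace inequality, as \<open>u\<close> is continuous.\<close>

section \<open>Smooth functions of two real variables\<close>

lemma partial_eqI:
  assumes "(f has_derivative f') (at x)"
  shows "partial i f x = f' (axis i 1)"
  using frechet_derivative_at[OF assms] by (simp add: partial_def)

lemma frechet_derivative_eq_partial:
  assumes "f differentiable (at x)"
  shows "frechet_derivative f (at x) d = d $ 1 * partial 1 f x + d $ 2 * partial 2 f x"
proof -
  have lin: "linear (frechet_derivative f (at x))"
    using assms by (rule linear_frechet_derivative)
  have d: "d = d $ 1 *\<^sub>R axis 1 1 + d $ 2 *\<^sub>R axis 2 1"
    by (simp add: vec_eq_iff forall_2 axis_def)
  show ?thesis
    by (subst d) (simp add: linear_add[OF lin] linear_scale[OF lin] partial_def)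
qed

lemma has_derivative_partial:
  assumes "f differentiable (at x)"
  shows "(f has_derivative (\<lambda>d. d $ 1 * partial 1 f x + d $ 2 * partial 2 f x)) (at x)"
  using frechet_derivative_works[THEN iffD1, OF assms]
  by (simp add: frechet_derivative_eq_partial[OF assms, abs_def])

lemma has_real_derivative_along_line:
  assumes "f differentiable (at (p + t *\<^sub>R d))"
  shows "((\<lambda>t. f (p + t *\<^sub>R d)) has_real_derivative
           d $ 1 * partial 1 f (p + t *\<^sub>R d) + d $ 2 * partial 2 f (p + t *\<^sub>R d)) (at t within S)"
proof -
  have "((\<lambda>t. f (p + t *\<^sub>R d)) has_derivative
      (\<lambda>s. (s *\<^sub>R d) $ 1 * partial 1 f (p + t *\<^sub>R d) + (s *\<^sub>R d) $ 2 * partial 2 f (p + t *\<^sub>R d)))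
      (at t within S)"
    by (rule has_derivative_compose[of "\<lambda>t. p + t *\<^sub>R d" "\<lambda>s. s *\<^sub>R d" t S f,
          OF _ has_derivative_partial[OF assms]])
       (auto intro!: derivative_eq_intros)
  then show ?thesis
    unfolding has_field_derivative_def
    by (rule has_derivative_eq_rhs) (auto simp: algebra_simps)
qed

lemma C_k_imp_continuous: "C_k k f \<Longrightarrow> continuous_on UNIV f"
  by (cases k) (auto simp: differentiable_imp_continuous_within continuous_on_eq_continuous_within)

lemma C_k_SucD: "C_k (Suc k) f \<Longrightarrow> C_k k f"
proof (induction k arbitrary: f)
  case 0
  then show ?case by (metis C_k_imp_continuous C_k.simps(1))
next
  case (Suc k)
  then show ?case by simp
qed

lemma partial_add:
  assumes "f differentiable (at x)" "g differentiable (at x)"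
  shows "partial i (\<lambda>x. f x + g x) x = partial i f x + partial i g x"
  using frechet_derivative_works[THEN iffD1, OF assms(1)]
    frechet_derivative_works[THEN iffD1, OF assms(2)]
  by (subst partial_eqI[OF has_derivative_add]) (auto simp: partial_def)

lemma partial_mult:
  assumes "f differentiable (at x)" "g differentiable (at x)"
  shows "partial i (\<lambda>x. f x * g x) x = f x * partial i g x + partial i f x * g x"
  using frechet_derivative_works[THEN iffD1, OF assms(1)]
    frechet_derivative_works[THEN iffD1, OF assms(2)]
  by (subst partial_eqI[OF has_derivative_mult]) (auto simp: partial_def)

lemma C_k_const [simp]: "C_k k (\<lambda>x. c)"
proof (induction k arbitrary: c)
  case (Suc k)
  have "partial i (\<lambda>x. c) = (\<lambda>x. 0)" for i
    by (auto simp: partial_eqI[OF has_derivative_const])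
  with Suc show ?case by simp
qed auto

lemma C_k_add: "C_k k f \<Longrightarrow> C_k k g \<Longrightarrow> C_k k (\<lambda>x. f x + g x)"
proof (induction k arbitrary: f g)
  case (Suc k)
  then have "partial i (\<lambda>x. f x + g x) = (\<lambda>x. partial i f x + partial i g x)" for i
    by (auto simp: partial_add)
  with Suc show ?case by (auto intro: differentiable_add)
qed (auto intro: continuous_on_add)

lemma C_k_mult: "C_k k f \<Longrightarrow> C_k k g \<Longrightarrow> C_k k (\<lambda>x. f x * g x)"
proof (induction k arbitrary: f g)
  case (Suc k)
  then have "partial i (\<lambda>x. f x * g x) = (\<lambda>x. f x * partial i g x + partial i f x * g x)" for i
    by (auto simp: partial_mult)
  with Suc C_k_SucD show ?case by (auto intro!: differentiable_mult C_k_add)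
qed (auto intro: continuous_on_mult)

lemma C_k_linear:
  assumes "bounded_linear f"
  shows "C_k k f"
proof (cases k)
  case 0
  then show ?thesis using assms by (simp add: linear_continuous_on)
next
  case (Suc m)
  have "partial i f = (\<lambda>x. f (axis i 1))" for i
    using partial_eqI[OF bounded_linear_imp_has_derivative[OF assms]] by auto
  then show ?thesis
    using Suc assms by (auto intro: bounded_linear_imp_differentiable)
qed

lemma C_k_polynomial: "real_polynomial_function p \<Longrightarrow> C_k k p"
  by (induction p rule: real_polynomial_function.induct) (auto intro: C_k_linear C_k_add C_k_mult)

text \<open>Two second difference quotients of the same four values, evaluated by the mean value theorem
  in the two possible orders.\<close>

lemma partial_commute:
  assumes "C_k 2 f"
  shows "partial 1 (partial 2 f) = partial 2 (partial 1 f)"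
proof
  fix x :: R2
  have diff: "f differentiable (at x)" "partial i f differentiable (at x)"
    and cont: "continuous_on UNIV (partial i (partial j f))" for i j :: 2 and x
    using assms C_k_imp_continuous[of 0] by (auto simp: numeral_2_eq_2)
  have mean_value: "\<exists>s\<in>{0..h}. \<exists>t\<in>{0..h}.
      f (x + h *\<^sub>R axis i 1 + h *\<^sub>R axis j 1) - f (x + h *\<^sub>R axis i 1)
        - f (x + h *\<^sub>R axis j 1) + f x
      = h * h * partial j (partial i f) (x + s *\<^sub>R axis i 1 + t *\<^sub>R axis j 1)"
    if h: "h > 0" for h and i j :: 2
  proof -
    have ax: "axis i (1::real) $ 1 * partial 1 g y + axis i 1 $ 2 * partial 2 g y = partial i g y" for g y i
      using exhaust_2[of i] by (auto simp: axis_def)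
    let ?F = "\<lambda>s. f (x + h *\<^sub>R axis j 1 + s *\<^sub>R axis i 1) - f (x + s *\<^sub>R axis i 1)"
    have "\<exists>s. 0 < s \<and> s < h \<and> ?F h - ?F 0 = (h - 0) *
        (partial i f (x + h *\<^sub>R axis j 1 + s *\<^sub>R axis i 1) - partial i f (x + s *\<^sub>R axis i 1))"
      by (rule MVT2[OF h])
        (intro DERIV_diff has_real_derivative_along_line[of f _ _ "axis i 1", unfolded ax] diff)
    then obtain s where s: "0 < s" "s < h" and sF: "?F h - ?F 0 = h *
        (partial i f (x + h *\<^sub>R axis j 1 + s *\<^sub>R axis i 1) - partial i f (x + s *\<^sub>R axis i 1))"
      by auto
    let ?G = "\<lambda>t. partial i f (x + s *\<^sub>R axis i 1 + t *\<^sub>R axis j 1)"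
    have "\<exists>t. 0 < t \<and> t < h \<and> ?G h - ?G 0 = (h - 0) *
        partial j (partial i f) (x + s *\<^sub>R axis i 1 + t *\<^sub>R axis j 1)"
      by (rule MVT2[OF h])
        (intro has_real_derivative_along_line[of "partial i f" _ _ "axis j 1", unfolded ax] diff)
    then obtain t where t: "0 < t" "t < h" and tG: "?G h - ?G 0 = h *
        partial j (partial i f) (x + s *\<^sub>R axis i 1 + t *\<^sub>R axis j 1)"
      by auto
    have "x + h *\<^sub>R axis j 1 + s *\<^sub>R axis i 1 = x + s *\<^sub>R axis i 1 + h *\<^sub>R axis j (1::real)"
      "x + h *\<^sub>R axis j 1 + h *\<^sub>R axis i 1 = x + h *\<^sub>R axis i 1 + h *\<^sub>R axis j (1::real)"
      by (simp_all add: add_ac)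
    with sF tG s t show ?thesis
      by (intro bexI[of _ s] bexI[of _ t]) auto
  qed
  define h where "h n = 1 / real (Suc n)" for n
  have h_pos: "h n > 0" for n by (simp add: h_def)
  have h_lim: "h \<longlonglongrightarrow> 0"
    unfolding h_def by (rule LIMSEQ_Suc[OF lim_inverse_n'])
  let ?D = "\<lambda>n. (f (x + h n *\<^sub>R axis 1 1 + h n *\<^sub>R axis 2 1) - f (x + h n *\<^sub>R axis 1 1)
        - f (x + h n *\<^sub>R axis 2 1) + f x) / (h n * h n)"
  have lim: "(\<lambda>n. (f (x + h n *\<^sub>R axis i 1 + h n *\<^sub>R axis j 1) - f (x + h n *\<^sub>R axis i 1)
        - f (x + h n *\<^sub>R axis j 1) + f x) / (h n * h n)) \<longlonglongrightarrow> partial j (partial i f) x" for i j :: 2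
  proof -
    obtain s t where st: "\<And>n. s n \<in> {0..h n}" "\<And>n. t n \<in> {0..h n}"
      and eq: "\<And>n. f (x + h n *\<^sub>R axis i 1 + h n *\<^sub>R axis j 1) - f (x + h n *\<^sub>R axis i 1)
        - f (x + h n *\<^sub>R axis j 1) + f x
       = h n * h n * partial j (partial i f) (x + s n *\<^sub>R axis i 1 + t n *\<^sub>R axis j 1)"
      using mean_value[OF h_pos, where i = i and j = j] by metis
    have "s \<longlonglongrightarrow> 0" "t \<longlonglongrightarrow> 0"
      using st by (auto intro!: tendsto_sandwich[OF _ _ tendsto_const h_lim])
    then have "(\<lambda>n. x + s n *\<^sub>R axis i 1 + t n *\<^sub>R axis j 1) \<longlonglongrightarrow> x + 0 *\<^sub>R axis i 1 + 0 *\<^sub>R axis j 1"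
      by (intro tendsto_intros)
    then have lim_x: "(\<lambda>n. x + s n *\<^sub>R axis i 1 + t n *\<^sub>R axis j 1) \<longlonglongrightarrow> x"
      by simp
    have "isCont (partial j (partial i f)) x"
      using cont[of j i] by (simp add: continuous_on_eq_continuous_at)
    then have "(\<lambda>n. partial j (partial i f) (x + s n *\<^sub>R axis i 1 + t n *\<^sub>R axis j 1))
        \<longlonglongrightarrow> partial j (partial i f) x"
      by (rule isCont_tendsto_compose) (rule lim_x)
    moreover have "h n * h n \<noteq> 0" for n using h_pos[of n] by simp
    ultimately show ?thesis by (simp add: eq)
  qed
  have "?D \<longlonglongrightarrow> partial 2 (partial 1 f) x" by (rule lim)
  moreover have "?D \<longlonglongrightarrow> partial 1 (partial 2 f) x"
    using lim[of 2 1] by (simp add: algebra_simps)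
  ultimately show "partial 1 (partial 2 f) x = partial 2 (partial 1 f) x"
    by (rule LIMSEQ_unique[symmetric])
qed

lemma partial_translate:
  assumes "f differentiable (at (x - p))"
  shows "partial i (\<lambda>x. f (x - p)) x = partial i f (x - p)"
proof -
  have "((\<lambda>x. f (x - p)) has_derivative (\<lambda>d. frechet_derivative f (at (x - p)) d)) (at x)"
    by (rule has_derivative_compose[of "\<lambda>x. x - p" "\<lambda>d. d" x UNIV f,
          OF _ frechet_derivative_works[THEN iffD1, OF assms]])
       (auto intro!: derivative_eq_intros)
  then show ?thesis
    by (subst partial_eqI) (auto simp: partial_def)
qed

lemma C_k_translate: "C_k k f \<Longrightarrow> C_k k (\<lambda>x. f (x - p))"
proof (induction k arbitrary: f)
  case 0
  then show ?case
    by (auto intro!: continuous_on_compose2[of UNIV f] continuous_intros)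
next
  case (Suc k)
  then have "partial i (\<lambda>x. f (x - p)) = (\<lambda>x. partial i f (x - p))" for i
    by (auto simp: partial_translate)
  moreover have "(\<lambda>x. f (x - p)) differentiable (at x)" for x
  proof -
    have "f differentiable (at (x - p))" using Suc.prems by auto
    then show ?thesis
      using differentiable_chain_at[of "\<lambda>x. x - p" x f] by (simp add: o_def differentiable_diff)
  qed
  ultimately show ?case using Suc by simp
qed

section \<open>A smooth bump on every box\<close>

text \<open>The functions \<open>exp (- 1 / x) / x ^ n\<close>, continued by zero, are the derivatives of the first of
  them up to linear combinations; this closes the induction over the order of smoothness.\<close>

definition flat :: "nat \<Rightarrow> real \<Rightarrow> real" where
  "flat n x = (if x > 0 then exp (- 1 / x) / x ^ n else 0)"

lemma flat_0_pos_iff: "flat 0 x > 0 \<longleftrightarrow> x > 0" and flat_0_nonneg: "flat 0 x \<ge> 0"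
  by (auto simp: flat_def)

lemma tendsto_flat_at_0: "(flat n \<longlongrightarrow> 0) (at 0)"
proof -
  have "((\<lambda>y. y ^ n / exp y) \<longlongrightarrow> (0::real)) at_top"
    by (rule tendsto_power_div_exp_0)
  then have "((\<lambda>x. (inverse x) ^ n / exp (inverse x)) \<longlongrightarrow> (0::real)) (at_right 0)"
    by (rule filterlim_compose) (rule filterlim_inverse_at_top_right)
  moreover have "\<forall>\<^sub>F x in at_right 0. (inverse x) ^ n / exp (inverse x) = flat n x"
    by (auto simp: eventually_at_filter flat_def exp_minus divide_simps)
  ultimately have "(flat n \<longlongrightarrow> 0) (at_right 0)"
    by (rule Lim_transform_eventually)
  moreover have "(flat n \<longlongrightarrow> 0) (at_left 0)"
    by (rule tendsto_eventually) (auto simp: eventually_at_filter flat_def)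
  ultimately show ?thesis
    by (simp add: filterlim_split_at)
qed

lemma has_real_derivative_flat:
  "(flat n has_real_derivative flat (n + 2) x - real n * flat (n + 1) x) (at x)"
proof -
  consider "x > 0" | "x < 0" | "x = 0" by linarith
  then show ?thesis
  proof cases
    case 1
    have exp: "((\<lambda>x. exp (- 1 / x)) has_real_derivative exp (- 1 / x) * inverse x ^ 2) (at x)"
      using 1 by (auto intro!: derivative_eq_intros simp: power2_eq_square divide_simps)
    have "((\<lambda>x. inverse x ^ n) has_real_derivative
        real n * (- (inverse x ^ Suc (Suc 0)) * inverse x ^ (n - Suc 0))) (at x)"
      using DERIV_power[OF DERIV_inverse, of x n] 1 by simp
    moreover have "real n * (- (inverse x ^ Suc (Suc 0)) * inverse x ^ (n - Suc 0)) = - real n * inverse x ^ (n + 1)"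
      by (cases n) (auto simp: algebra_simps)
    ultimately have "((\<lambda>x. inverse x ^ n) has_real_derivative - real n * inverse x ^ (n + 1)) (at x)"
      by (simp only:)
    from DERIV_mult[OF exp this]
    have "((\<lambda>x. exp (- 1 / x) / x ^ n) has_real_derivative flat (n + 2) x - real n * flat (n + 1) x) (at x)"
      using 1 by (simp add: flat_def divide_inverse power_add power_inverse[symmetric] algebra_simps power2_eq_square)
    then show ?thesis
      by (rule has_field_derivative_transform_within_open[of _ _ _ "{0<..}"]) (use 1 in \<open>auto simp: flat_def\<close>)
  next
    case 2
    have "((\<lambda>x. 0) has_real_derivative flat (n + 2) x - real n * flat (n + 1) x) (at x)"
      using 2 by (auto simp: flat_def)
    then show ?thesis
      by (rule has_field_derivative_transform_within_open[of _ _ _ "{..<0}"]) (use 2 in \<open>auto simp: flat_def\<close>)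
  next
    case 3
    have "(\<lambda>h. (flat n (0 + h) - flat n 0) / h) = flat (Suc n)"
      by (auto simp: flat_def field_simps)
    then have "DERIV (flat n) 0 :> 0"
      using tendsto_flat_at_0[of "Suc n"] by (simp add: DERIV_def)
    moreover have "flat m 0 = 0" for m by (simp add: flat_def)
    ultimately show ?thesis using 3 by simp
  qed
qed

lemma C_k_flat: "C_k k (\<lambda>x. flat n (c + s * x $ i))"
proof (induction k arbitrary: n)
  case 0
  have "continuous_on UNIV (flat n)"
    using has_real_derivative_flat DERIV_isCont by (blast intro: continuous_at_imp_continuous_on)
  then show ?case
    by (auto intro!: continuous_on_compose2[of UNIV "flat n"] continuous_intros)
next
  case (Suc k)
  have der: "((\<lambda>x. flat n (c + s * x $ i)) has_derivative
      (\<lambda>d. (flat (n + 2) (c + s * x $ i) - real n * flat (n + 1) (c + s * x $ i)) * (s * d $ i))) (at x)" for x :: R2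
    by (rule has_derivative_compose[OF _ has_real_derivative_flat[unfolded has_field_derivative_def]])
       (auto intro!: derivative_eq_intros bounded_linear_imp_has_derivative bounded_linear_vec_nth)
  have "partial j (\<lambda>x. flat n (c + s * x $ i)) =
      (\<lambda>x. s * axis j 1 $ i * flat (n + 2) (c + s * x $ i)
         + (- (real n * s * axis j 1 $ i)) * flat (n + 1) (c + s * x $ i))" for j
    by (auto simp: partial_eqI[OF der] algebra_simps)
  moreover have "C_k k (\<lambda>x. a * flat (n + 2) (c + s * x $ i) + b * flat (n + 1) (c + s * x $ i))" for a b
    by (rule C_k_add; rule C_k_mult[OF C_k_const Suc.IH])
  ultimately have "C_k k (partial j (\<lambda>x. flat n (c + s * x $ i)))" for j
    by presburger
  moreover have "(\<lambda>x. flat n (c + s * x $ i)) differentiable (at x)" for x :: R2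
    using der[of x] unfolding differentiable_def by blast
  ultimately show ?case
    by simp
qed

text \<open>The product of four factors in single coordinates vanishes exactly outside the box; smoothness needs only the
chain rule for affine functions of one coordinate.\<close>

definition bump :: "R2 \<Rightarrow> R2 \<Rightarrow> R2 \<Rightarrow> real" where
  "bump l u x = flat 0 (x $ 1 - l $ 1) * flat 0 (u $ 1 - x $ 1)
      * flat 0 (x $ 2 - l $ 2) * flat 0 (u $ 2 - x $ 2)"

lemma bump_nonneg: "bump l u x \<ge> 0"
  by (simp add: bump_def flat_0_nonneg)

lemma bump_eq_0_iff: "bump l u x = 0 \<longleftrightarrow> x \<notin> box l u"
proof -
  have "flat 0 t = 0 \<longleftrightarrow> \<not> t > 0" for t
    using flat_0_nonneg[of t] flat_0_pos_iff[of t] by linarith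
  then show ?thesis
    by (simp add: bump_def mem_box_cart forall_2) blast
qed

lemma bump_pos_iff: "bump l u x > 0 \<longleftrightarrow> x \<in> box l u"
  using bump_eq_0_iff[of l u x] bump_nonneg[of l u x] by linarith

lemma C_k_bump: "C_k k (bump l u)"
proof -
  have "C_k k (\<lambda>x. flat 0 (- l $ i + 1 * x $ i))" "C_k k (\<lambda>x. flat 0 (u $ i + (- 1) * x $ i))" for i
    by (rule C_k_flat)+
  then show ?thesis
    unfolding bump_def by (auto intro!: C_k_mult)
qed

section \<open>Test functions\<close>

lemma test_functionsD:
  assumes "\<phi> \<in> test_functions S"
  shows "C_k k \<phi>" "compact (closure {x. \<phi> x \<noteq> 0})" "closure {x. \<phi> x \<noteq> 0} \<subseteq> S"
  using assms by (auto simp: test_functions_def)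

lemma not_in_closure_support: "x \<notin> closure {x. \<phi> x \<noteq> 0} \<Longrightarrow> \<phi> x = (0::real)"
  using closure_subset[of "{x. \<phi> x \<noteq> 0}"] by blast

lemma test_functions_eq_0: "\<phi> \<in> test_functions S \<Longrightarrow> x \<notin> S \<Longrightarrow> \<phi> x = 0"
  using test_functionsD(3)[of \<phi> S] not_in_closure_support[of x \<phi>] by blast

lemma test_functionsI:
  assumes "\<And>k. C_k k \<phi>" "compact C" "C \<subseteq> S" "\<And>x. x \<notin> C \<Longrightarrow> \<phi> x = 0"
  shows "\<phi> \<in> test_functions S"
proof -
  have "closure {x. \<phi> x \<noteq> 0} \<subseteq> C"
    using assms by (intro closure_minimal) (auto simp: compact_imp_closed)
  then show ?thesis
    using assms by (auto simp: test_functions_def compact_eq_bounded_closed intro: bounded_subset)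
qed

lemma test_functions_mono: "S \<subseteq> S' \<Longrightarrow> test_functions S \<subseteq> test_functions S'"
  by (auto simp: test_functions_def)

lemma partial_in_test_functions:
  assumes "\<phi> \<in> test_functions S"
  shows "partial i \<phi> \<in> test_functions S"
proof (rule test_functionsI[of _ "closure {x. \<phi> x \<noteq> 0}"])
  show "C_k k (partial i \<phi>)" for k
    using test_functionsD(1)[OF assms, of "Suc k"] by simp
  fix x assume x: "x \<notin> closure {x. \<phi> x \<noteq> 0}"
  have "((\<lambda>x. 0) has_derivative (\<lambda>x. 0)) (at x)" by simp
  then have "(\<phi> has_derivative (\<lambda>x. 0)) (at x)"
  proof (rule has_derivative_transform_within_open)
    show "open (- closure {x. \<phi> x \<noteq> 0})" by (intro open_Compl closed_closure)
    show "0 = \<phi> y" if "y \<in> - closure {x. \<phi> x \<noteq> 0}" for y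
      using not_in_closure_support[of y \<phi>] that by simp
  qed (use x in simp)
  then show "partial i \<phi> x = 0" by (rule partial_eqI)
qed (fact test_functionsD[OF assms])+

lemma mult_in_test_functions:
  assumes "\<And>k. C_k k f" "\<phi> \<in> test_functions S"
  shows "(\<lambda>x. f x * \<phi> x) \<in> test_functions S"
proof (rule test_functionsI[of _ "closure {x. \<phi> x \<noteq> 0}"])
  show "f x * \<phi> x = 0" if "x \<notin> closure {x. \<phi> x \<noteq> 0}" for x
    using not_in_closure_support[of x \<phi>] that by simp
qed (fact C_k_mult[OF assms(1) test_functionsD(1)[OF assms(2)]] test_functionsD[OF assms(2)])+

lemma bump_in_test_functions: "cbox l u \<subseteq> S \<Longrightarrow> bump l u \<in> test_functions S"
  using box_subset_cbox by (intro test_functionsI[of _ "cbox l u"] C_k_bump) (auto simp: bump_eq_0_iff)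

lemma zero_in_test_functions: "(\<lambda>x. 0) \<in> test_functions S"
  by (rule test_functionsI[of _ "{}"]) auto

lemma add_in_test_functions:
  assumes "\<phi> \<in> test_functions S" "\<psi> \<in> test_functions S"
  shows "(\<lambda>x. \<phi> x + \<psi> x) \<in> test_functions S"
proof (rule test_functionsI[of _ "closure {x. \<phi> x \<noteq> 0} \<union> closure {x. \<psi> x \<noteq> 0}"])
  show "\<phi> x + \<psi> x = 0" if "x \<notin> closure {x. \<phi> x \<noteq> 0} \<union> closure {x. \<psi> x \<noteq> 0}" for x
    using not_in_closure_support[of x \<phi>] not_in_closure_support[of x \<psi>] that by simp
qed (intro C_k_add compact_Un Un_least test_functionsD[OF assms(1)] test_functionsD[OF assms(2)])+

lemma test_functions_differentiable: "\<phi> \<in> test_functions S \<Longrightarrow> \<phi> differentiable (at x)"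
  using test_functionsD(1)[of \<phi> S "Suc 0"] by simp

lemma test_functions_continuous: "\<phi> \<in> test_functions S \<Longrightarrow> continuous_on A \<phi>"
  using test_functionsD(1)[of \<phi> S 0] continuous_on_subset by fastforce

lemma test_functions_measurable [measurable_dest]:
  "\<phi> \<in> test_functions S \<Longrightarrow> \<phi> \<in> borel_measurable borel"
  using test_functions_continuous by (blast intro: borel_measurable_continuous_onI)

lemma test_functions_bounded:
  assumes "\<phi> \<in> test_functions S"
  obtains B where "B \<ge> 0" "\<And>x. \<bar>\<phi> x\<bar> \<le> B"
proof -
  have "bounded (\<phi> ` closure {x. \<phi> x \<noteq> 0})"
    using test_functionsD(2)[OF assms] test_functions_continuous[OF assms]
    by (intro compact_imp_bounded compact_continuous_image)
  then obtain B where "B > 0" "\<And>x. x \<in> closure {x. \<phi> x \<noteq> 0} \<Longrightarrow> \<bar>\<phi> x\<bar> \<le> B"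
    by (auto simp: bounded_pos)
  moreover have "\<bar>\<phi> x\<bar> \<le> B" for x
    using not_in_closure_support[of x \<phi>] calculation
    by (cases "x \<in> closure {x. \<phi> x \<noteq> 0}") auto
  ultimately show ?thesis
    using that[of B] by simp
qed

lemma test_functions_translate:
  assumes "\<phi> \<in> test_functions UNIV" "\<And>z. z \<in> closure {x. \<phi> x \<noteq> 0} \<Longrightarrow> p + z \<in> S"
  shows "(\<lambda>x. \<phi> (x - p)) \<in> test_functions S"
proof (rule test_functionsI[of _ "(+) p ` closure {x. \<phi> x \<noteq> 0}"])
  show "C_k k (\<lambda>x. \<phi> (x - p))" for k
    using test_functionsD(1)[OF assms(1)] by (rule C_k_translate)
  show "compact ((+) p ` closure {x. \<phi> x \<noteq> 0})"
    using test_functionsD(2)[OF assms(1)] by (rule compact_translation)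
  fix x assume "x \<notin> (+) p ` closure {x. \<phi> x \<noteq> 0}"
  then have "x - p \<notin> closure {x. \<phi> x \<noteq> 0}"
    using image_eqI[of x "(+) p" "x - p"] by auto
  then show "\<phi> (x - p) = 0"
    by (rule not_in_closure_support)
qed (use assms in auto)

section \<open>Square integrable functions and their Borel versions\<close>

lemma integrable_mult_square_integrable:
  fixes f g :: "'a \<Rightarrow> real"
  assumes "f \<in> borel_measurable M" "g \<in> borel_measurable M"
    and "integrable M (\<lambda>x. (f x)\<^sup>2)" "integrable M (\<lambda>x. (g x)\<^sup>2)"
  shows "integrable M (\<lambda>x. f x * g x)"
proof (rule Bochner_Integration.integrable_bound)
  show "integrable M (\<lambda>x. (f x)\<^sup>2 + (g x)\<^sup>2)"
    using assms by simp
  show "(\<lambda>x. f x * g x) \<in> borel_measurable M"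
    using assms by measurable
  have "\<bar>f x * g x\<bar> \<le> (f x)\<^sup>2 + (g x)\<^sup>2" for x
  proof -
    have "2 * \<bar>f x * g x\<bar> \<le> (f x)\<^sup>2 + (g x)\<^sup>2"
      using sum_squares_bound[of "\<bar>f x\<bar>" "\<bar>g x\<bar>"] by (simp add: abs_mult)
    then show ?thesis using abs_ge_zero[of "f x * g x"] by linarith
  qed
  then show "AE x in M. norm (f x * g x) \<le> norm ((f x)\<^sup>2 + (g x)\<^sup>2)"
    by simp
qed

lemma integrable_square_add:
  fixes f g :: "'a \<Rightarrow> real"
  assumes "f \<in> borel_measurable M" "g \<in> borel_measurable M"
    and "integrable M (\<lambda>x. (f x)\<^sup>2)" "integrable M (\<lambda>x. (g x)\<^sup>2)"
  shows "integrable M (\<lambda>x. (f x + g x)\<^sup>2)"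
  using integrable_mult_square_integrable[OF assms] assms
  by (simp add: power2_sum mult.assoc)

text \<open>The integral of \<open>(f - t g)\<^sup>2\<close> is nonnegative for every \<open>t\<close>.\<close>

lemma integral_mult_le_sqrt:
  fixes f g :: "'a \<Rightarrow> real"
  assumes "f \<in> borel_measurable M" "g \<in> borel_measurable M"
    and "integrable M (\<lambda>x. (f x)\<^sup>2)" "integrable M (\<lambda>x. (g x)\<^sup>2)"
  shows "\<bar>\<integral>x. f x * g x \<partial>M\<bar> \<le> sqrt (\<integral>x. (f x)\<^sup>2 \<partial>M) * sqrt (\<integral>x. (g x)\<^sup>2 \<partial>M)"
proof -
  define a b c where "a = (\<integral>x. (f x)\<^sup>2 \<partial>M)" and "b = (\<integral>x. f x * g x \<partial>M)" and "c = (\<integral>x. (g x)\<^sup>2 \<partial>M)"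
  have fg: "integrable M (\<lambda>x. f x * g x)"
    using assms by (rule integrable_mult_square_integrable)
  have quad: "a - 2 * t * b + t\<^sup>2 * c \<ge> 0" for t
  proof -
    have "0 \<le> (\<integral>x. (f x - t * g x)\<^sup>2 \<partial>M)" by simp
    also have "\<dots> = (\<integral>x. (f x)\<^sup>2 - 2 * t * (f x * g x) + t\<^sup>2 * (g x)\<^sup>2 \<partial>M)"
      by (simp add: power2_eq_square algebra_simps)
    also have "\<dots> = a - 2 * t * b + t\<^sup>2 * c"
      using fg assms by (simp add: a_def b_def c_def)
    finally show ?thesis .
  qed
  have "a \<ge> 0" "c \<ge> 0" by (simp_all add: a_def c_def)
  have "b\<^sup>2 \<le> a * c"
  proof (cases "c = 0")
    case True
    have "b = 0"
    proof (rule ccontr)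
      assume "b \<noteq> 0"
      then show False using quad[of "(a + 1) / (2 * b)"] True by simp
    qed
    then show ?thesis using True by simp
  next
    case False
    with quad[of "b / c"] \<open>c \<ge> 0\<close> show ?thesis
      by (simp add: field_simps power2_eq_square)
  qed
  then have "sqrt (b\<^sup>2) \<le> sqrt (a * c)" by (rule real_sqrt_le_mono)
  then show ?thesis by (simp add: a_def b_def c_def real_sqrt_mult)
qed

text \<open>Product measures and substitutions are available for Borel functions on the whole plane, so
  the analysis is done for Borel functions that vanish outside the domain and agree with the given
  function almost everywhere inside.\<close>

definition borel_version :: "R2 set \<Rightarrow> (R2 \<Rightarrow> real) \<Rightarrow> (R2 \<Rightarrow> real) \<Rightarrow> bool" where
  "borel_version S v v' \<longleftrightarrow>
     v \<in> borel_measurable (lebesgue_on S) \<and> v' \<in> borel_measurable borel \<and>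
     (\<forall>x. x \<notin> S \<longrightarrow> v' x = 0) \<and> integrable lborel (\<lambda>x. (v' x)\<^sup>2) \<and>
     (AE x in lebesgue_on S. v x = v' x)"

lemma borel_versionD:
  assumes "borel_version S v v'"
  shows "v' \<in> borel_measurable borel" "x \<notin> S \<Longrightarrow> v' x = 0" "integrable lborel (\<lambda>x. (v' x)\<^sup>2)"
    "v \<in> borel_measurable (lebesgue_on S)" "AE x in lebesgue_on S. v x = v' x"
  using assms by (auto simp: borel_version_def)

lemma integral_lebesgue_on_vanishing_outside:
  fixes f :: "R2 \<Rightarrow> real"
  assumes "open S" "f \<in> borel_measurable borel" "\<And>x. x \<notin> S \<Longrightarrow> f x = 0"
  shows "integral\<^sup>L (lebesgue_on S) f = integral\<^sup>L lborel f"
    and "integrable (lebesgue_on S) f \<longleftrightarrow> integrable lborel f"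
proof -
  have ind: "(\<lambda>x. indicator S x *\<^sub>R f x) = f"
    using assms(3) by (auto simp: indicator_def fun_eq_iff)
  have S: "S \<inter> space lebesgue \<in> sets lebesgue" using assms(1) by auto
  have f: "f \<in> borel_measurable lborel" using assms(2) by simp
  show "integral\<^sup>L (lebesgue_on S) f = integral\<^sup>L lborel f"
    using integral_restrict_space[OF S, of f] integral_completion[OF f] by (simp only: ind)
  show "integrable (lebesgue_on S) f \<longleftrightarrow> integrable lborel f"
    using integrable_restrict_space[OF S, of f] integrable_completion[OF f] by (simp only: ind)
qed

lemma measurable_lebesgue_on_borel: "f \<in> borel_measurable borel \<Longrightarrow> f \<in> borel_measurable (lebesgue_on S)"
  by (intro measurable_restrict_space1 measurable_completion) simp

lemma borel_version_exists:
  assumes "open S" "v \<in> L2_space S"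
  obtains v' where "borel_version S v v'"
proof -
  have v: "v \<in> borel_measurable (lebesgue_on S)" and v2: "integrable (lebesgue_on S) (\<lambda>x. (v x)\<^sup>2)"
    using assms by (auto simp: L2_space_def)
  have "(\<lambda>x. if x \<in> S then v x else 0) \<in> borel_measurable lebesgue"
    using v assms(1) by (intro borel_measurable_if_I) auto
  from completion_ex_borel_measurable_real[OF this]
  obtain w where w [measurable]: "w \<in> borel_measurable borel" and w_eq:
      "AE x in lborel. (if x \<in> S then v x else 0) = w x" by auto
  define v' where "v' x = indicator S x * w x" for x
  have v': "v' \<in> borel_measurable borel"
    unfolding v'_def using borel_open[OF assms(1)] by measurable
  have "AE x in lebesgue. x \<in> S \<longrightarrow> v x = v' x"
    using w_eq by (intro AE_completion) (auto simp: v'_def elim!: eventually_mono)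
  then have ae: "AE x in lebesgue_on S. v x = v' x"
    using assms(1) by (subst AE_restrict_space_iff) auto
  have "integrable (lebesgue_on S) (\<lambda>x. (v' x)\<^sup>2)"
    using v2
  proof (rule integrable_cong_AE_imp)
    show "AE x in lebesgue_on S. (v x)\<^sup>2 = (v' x)\<^sup>2"
      using ae by eventually_elim simp
  qed (auto intro!: borel_measurable_power measurable_lebesgue_on_borel v')
  then have "integrable lborel (\<lambda>x. (v' x)\<^sup>2)"
    by (subst (asm) integral_lebesgue_on_vanishing_outside[OF assms(1)])
       (use borel_measurable_power[OF v', of 2] in \<open>simp_all add: v'_def\<close>)
  with v v' ae show ?thesis
    by (intro that[of v']) (auto simp: borel_version_def v'_def)
qed

lemma borel_version_integral:
  assumes "open S" "borel_version S v v'" "f \<in> borel_measurable borel"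
  shows "(LINT x|lebesgue_on S. v x * f x) = (LINT x|lborel. v' x * f x)"
proof -
  have [measurable]: "v' \<in> borel_measurable borel" using borel_versionD[OF assms(2)] by auto
  have "(LINT x|lebesgue_on S. v x * f x) = (LINT x|lebesgue_on S. v' x * f x)"
  proof (rule integral_cong_AE)
    show "AE x in lebesgue_on S. v x * f x = v' x * f x"
      using borel_versionD(5)[OF assms(2)] by eventually_elim simp
  qed (intro borel_measurable_times borel_versionD[OF assms(2)]
        measurable_lebesgue_on_borel[OF borel_versionD(1)[OF assms(2)]]
        measurable_lebesgue_on_borel[OF assms(3)])+
  also have "\<dots> = (LINT x|lborel. v' x * f x)"
    using assms borel_versionD[OF assms(2)]
    by (intro integral_lebesgue_on_vanishing_outside) auto
  finally show ?thesis .
qed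

lemma borel_version_L2_norm:
  assumes "open S" "borel_version S v v'"
  shows "(L2_norm S v)\<^sup>2 = (LINT x|lborel. (v' x)\<^sup>2)"
proof -
  have [measurable]: "v' \<in> borel_measurable borel" using borel_versionD[OF assms(2)] by auto
  have "(LINT x|lebesgue_on S. (v x)\<^sup>2) = (LINT x|lebesgue_on S. (v' x)\<^sup>2)"
  proof (rule integral_cong_AE)
    show "AE x in lebesgue_on S. (v x)\<^sup>2 = (v' x)\<^sup>2"
      using borel_versionD(5)[OF assms(2)] by eventually_elim simp
  qed (intro borel_measurable_power borel_versionD[OF assms(2)]
        measurable_lebesgue_on_borel[OF borel_versionD(1)[OF assms(2)]])+
  also have "\<dots> = (LINT x|lborel. (v' x)\<^sup>2)"
    using assms borel_versionD[OF assms(2)]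
    by (intro integral_lebesgue_on_vanishing_outside) auto
  finally show ?thesis by (simp add: L2_norm_def)
qed

lemma borel_version_in_L2:
  assumes "open S" "borel_version S v v'"
  shows "v \<in> L2_space S"
proof -
  have [measurable]: "v' \<in> borel_measurable borel" using borel_versionD[OF assms(2)] by auto
  have "integrable (lebesgue_on S) (\<lambda>x. (v' x)\<^sup>2)"
    using assms borel_versionD[OF assms(2)]
    by (subst integral_lebesgue_on_vanishing_outside) auto
  then have "integrable (lebesgue_on S) (\<lambda>x. (v x)\<^sup>2)"
  proof (rule integrable_cong_AE_imp)
    show "AE x in lebesgue_on S. (v' x)\<^sup>2 = (v x)\<^sup>2"
      using borel_versionD(5)[OF assms(2)] by eventually_elim simp
  qed (use borel_versionD(4)[OF assms(2)] in \<open>auto intro!: borel_measurable_power\<close>)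
  then show ?thesis
    using assms(2) by (auto simp: L2_space_def borel_version_def)
qed

lemma borel_version_diff:
  assumes "borel_version S v v'" "borel_version S w w'"
  shows "borel_version S (\<lambda>x. v x - w x) (\<lambda>x. v' x - w' x)"
proof -
  have "integrable lborel (\<lambda>x. (v' x - w' x)\<^sup>2)"
    using integrable_square_add[of v' lborel "\<lambda>x. - w' x"] borel_versionD[OF assms(1)] borel_versionD[OF assms(2)]
    by simp
  moreover have "AE x in lebesgue_on S. v x - w x = v' x - w' x"
    using borel_versionD(5)[OF assms(1)] borel_versionD(5)[OF assms(2)] by eventually_elim simp
  ultimately show ?thesis
    using assms by (auto simp: borel_version_def)
qed

lemma borel_version_continuous:
  assumes "open S" "bounded S" "continuous_on UNIV f"
  shows "borel_version S f (\<lambda>x. indicator S x * f x)"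
proof -
  have f [measurable]: "f \<in> borel_measurable borel"
    using assms(3) by (rule borel_measurable_continuous_onI)
  have [measurable]: "S \<in> sets borel" using assms(1) by simp
  obtain C where C: "compact C" "S \<subseteq> C"
    using assms(2) by (meson closure_subset compact_closure)
  have "integrable lborel (\<lambda>x. indicator C x *\<^sub>R (f x)\<^sup>2)"
    using C(1) continuous_on_subset[OF assms(3)]
    by (intro borel_integrable_compact continuous_on_power) auto
  then have "integrable lborel (\<lambda>x. (indicator S x * f x)\<^sup>2)"
    by (rule Bochner_Integration.integrable_bound) (use C(2) in \<open>auto simp: indicator_def\<close>)
  moreover have "AE x in lebesgue_on S. f x = indicator S x * f x"
    by (rule AE_I2) (auto simp: space_restrict_space)
  ultimately show ?thesis
    using measurable_lebesgue_on_borel[OF f, of S] by (auto simp: borel_version_def)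
qed

text \<open>For a function that is continuous on the open set itself no modification is needed.\<close>

lemma borel_version_continuous_on_open:
  assumes "open S" "continuous_on S v" "v \<in> L2_space S"
  shows "borel_version S v (\<lambda>x. indicator S x * v x)"
proof -
  have S: "S \<in> sets borel" using assms(1) by simp
  have m: "(\<lambda>x. indicator S x *\<^sub>R v x) \<in> borel_measurable borel"
    using borel_measurable_continuous_on_indicator[OF S assms(2)] .
  have ae: "AE x in lebesgue_on S. v x = indicator S x * v x"
    by (rule AE_I2) (auto simp: space_restrict_space)
  have v: "v \<in> borel_measurable (lebesgue_on S)" and v2: "integrable (lebesgue_on S) (\<lambda>x. (v x)\<^sup>2)"
    using assms by (auto simp: L2_space_def)
  have "integrable (lebesgue_on S) (\<lambda>x. (indicator S x * v x)\<^sup>2)"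
    using v2
  proof (rule integrable_cong_AE_imp)
    show "AE x in lebesgue_on S. (v x)\<^sup>2 = (indicator S x * v x)\<^sup>2"
      using ae by eventually_elim (erule arg_cong)
  qed (use measurable_lebesgue_on_borel[OF m, of S] in simp)
  then have "integrable lborel (\<lambda>x. (indicator S x * v x)\<^sup>2)"
    using m by (subst (asm) integral_lebesgue_on_vanishing_outside[OF assms(1)]) auto
  with v m ae show ?thesis by (auto simp: borel_version_def)
qed

section \<open>Test functions detect the norm of a square integrable function\<close>

lemma test_functions_integrable:
  assumes "\<phi> \<in> test_functions S"
  shows "integrable lborel \<phi>"
proof -
  have "integrable lborel (\<lambda>x. indicator (closure {x. \<phi> x \<noteq> 0}) x *\<^sub>R \<phi> x)"
    using test_functionsD(2)[OF assms] test_functions_continuous[OF assms] by (rule borel_integrable_compact)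
  moreover have "(\<lambda>x. indicator (closure {x. \<phi> x \<noteq> 0}) x *\<^sub>R \<phi> x) = \<phi>"
  proof
    show "indicator (closure {x. \<phi> x \<noteq> 0}) x *\<^sub>R \<phi> x = \<phi> x" for x
      using not_in_closure_support[of x \<phi>] by (cases "x \<in> closure {x. \<phi> x \<noteq> 0}") auto
  qed
  ultimately show ?thesis by (simp only:)
qed

lemma test_functions_square_integrable:
  assumes "\<phi> \<in> test_functions S"
  shows "integrable lborel (\<lambda>x. (\<phi> x)\<^sup>2)"
  using test_functions_integrable[OF mult_in_test_functions[OF test_functionsD(1)[OF assms] assms]]
  by (simp add: power2_eq_square)

text \<open>The first of three steps that enlarge the class of functions for which a bound by duality is known: from test
  functions \<open>\<psi>\<close> to products \<open>f * \<psi>\<close>, where the factors \<open>f\<close> are closed under bounded pointwise limits.\<close>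

lemma duality_bound_limit:
  fixes g \<psi> :: "R2 \<Rightarrow> real"
  assumes g [measurable]: "g \<in> borel_measurable borel" and g2: "integrable lborel (\<lambda>x. (g x)\<^sup>2)"
    and \<psi>: "\<psi> \<in> test_functions S"
    and f [measurable]: "\<And>n. f n \<in> borel_measurable borel" "f' \<in> borel_measurable borel"
    and bound: "\<And>n x. \<psi> x \<noteq> 0 \<Longrightarrow> \<bar>f n x\<bar> \<le> M"
    and lim: "AE x in lborel. \<psi> x \<noteq> 0 \<longrightarrow> (\<lambda>n. f n x) \<longlonglongrightarrow> f' x"
    and P: "\<And>n. \<bar>\<integral>x. g x * (f n x * \<psi> x) \<partial>lborel\<bar> \<le> C * sqrt (\<integral>x. (f n x * \<psi> x)\<^sup>2 \<partial>lborel)"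
  shows "\<bar>\<integral>x. g x * (f' x * \<psi> x) \<partial>lborel\<bar> \<le> C * sqrt (\<integral>x. (f' x * \<psi> x)\<^sup>2 \<partial>lborel)"
proof -
  have [measurable]: "\<psi> \<in> borel_measurable borel" using \<psi> by (rule test_functions_measurable)
  have \<psi>2: "integrable lborel (\<lambda>x. (\<psi> x)\<^sup>2)" using \<psi> by (rule test_functions_square_integrable)
  have g\<psi>: "integrable lborel (\<lambda>x. g x * \<psi> x)"
    by (rule integrable_mult_square_integrable) (use g2 \<psi>2 in auto)
  have "(\<lambda>n. \<integral>x. g x * (f n x * \<psi> x) \<partial>lborel) \<longlonglongrightarrow> (\<integral>x. g x * (f' x * \<psi> x) \<partial>lborel)"
  proof (rule integral_dominated_convergence[where w = "\<lambda>x. M * \<bar>g x * \<psi> x\<bar>"])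
    show "AE x in lborel. (\<lambda>n. g x * (f n x * \<psi> x)) \<longlonglongrightarrow> g x * (f' x * \<psi> x)"
      using lim
    proof eventually_elim
      case (elim x)
      then show ?case
        by (cases "\<psi> x = 0") (auto intro!: tendsto_intros)
    qed
    show "AE x in lborel. norm (g x * (f n x * \<psi> x)) \<le> M * \<bar>g x * \<psi> x\<bar>" for n
    proof (rule AE_I2)
      fix x show "norm (g x * (f n x * \<psi> x)) \<le> M * \<bar>g x * \<psi> x\<bar>"
        using mult_right_mono[OF bound[of x n], of "\<bar>g x * \<psi> x\<bar>"]
        by (cases "\<psi> x = 0") (auto simp: abs_mult mult_ac)
    qed
  qed (use g\<psi> in auto)
  then have 1: "(\<lambda>n. \<bar>\<integral>x. g x * (f n x * \<psi> x) \<partial>lborel\<bar>) \<longlonglongrightarrow> \<bar>\<integral>x. g x * (f' x * \<psi> x) \<partial>lborel\<bar>"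
    by (rule tendsto_rabs)
  have "(\<lambda>n. \<integral>x. (f n x * \<psi> x)\<^sup>2 \<partial>lborel) \<longlonglongrightarrow> (\<integral>x. (f' x * \<psi> x)\<^sup>2 \<partial>lborel)"
  proof (rule integral_dominated_convergence[where w = "\<lambda>x. M\<^sup>2 * (\<psi> x)\<^sup>2"])
    show "AE x in lborel. (\<lambda>n. (f n x * \<psi> x)\<^sup>2) \<longlonglongrightarrow> (f' x * \<psi> x)\<^sup>2"
      using lim
    proof eventually_elim
      case (elim x)
      then show ?case
        by (cases "\<psi> x = 0") (auto intro!: tendsto_intros)
    qed
    show "AE x in lborel. norm ((f n x * \<psi> x)\<^sup>2) \<le> M\<^sup>2 * (\<psi> x)\<^sup>2" for n
    proof (rule AE_I2)
      fix x show "norm ((f n x * \<psi> x)\<^sup>2) \<le> M\<^sup>2 * (\<psi> x)\<^sup>2"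
        using mult_right_mono[OF power_mono[OF bound[of x n] abs_ge_zero, of 2], of "(\<psi> x)\<^sup>2"]
        by (cases "\<psi> x = 0") (auto simp: power_mult_distrib)
    qed
  qed (use \<psi>2 in auto)
  then have 2: "(\<lambda>n. C * sqrt (\<integral>x. (f n x * \<psi> x)\<^sup>2 \<partial>lborel)) \<longlonglongrightarrow> C * sqrt (\<integral>x. (f' x * \<psi> x)\<^sup>2 \<partial>lborel)"
    by (intro tendsto_intros)
  show ?thesis
    by (rule LIMSEQ_le[OF 1 2]) (use P in auto)
qed

text \<open>Polynomial multiples of a test function are test functions. By the theorem of Weierstrass, on the compact
  support of \<open>\<psi>\<close>, the bound passes to continuous factors, and every bounded Borel function is a limit
  of continuous functions almost everywhere.\<close>

lemma duality_bound_borel: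
  fixes g \<psi> :: "R2 \<Rightarrow> real"
  assumes g: "g \<in> borel_measurable borel" and g2: "integrable lborel (\<lambda>x. (g x)\<^sup>2)"
    and dual: "\<And>\<phi>. \<phi> \<in> test_functions S \<Longrightarrow> \<bar>\<integral>x. g x * \<phi> x \<partial>lborel\<bar> \<le> C * sqrt (\<integral>x. (\<phi> x)\<^sup>2 \<partial>lborel)"
    and \<psi>: "\<psi> \<in> test_functions S"
    and f: "f \<in> borel_measurable borel" "\<And>x. \<bar>f x\<bar> \<le> M"
  shows "\<bar>\<integral>x. g x * (f x * \<psi> x) \<partial>lborel\<bar> \<le> C * sqrt (\<integral>x. (f x * \<psi> x)\<^sup>2 \<partial>lborel)"
proof -
  define Z where "Z = closure {x. \<psi> x \<noteq> 0}"
  have Z_compact: "compact Z"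
    using test_functionsD(2)[OF \<psi>] by (simp add: Z_def)
  have Z: "x \<in> Z" if "\<psi> x \<noteq> 0" for x
    using not_in_closure_support[of x \<psi>] that by (auto simp: Z_def)
  have continuous: "\<bar>\<integral>x. g x * (f x * \<psi> x) \<partial>lborel\<bar> \<le> C * sqrt (\<integral>x. (f x * \<psi> x)\<^sup>2 \<partial>lborel)"
    if f: "continuous_on UNIV f" for f
  proof -
    have fZ: "continuous_on Z f" using f by (rule continuous_on_subset) simp
    have "\<exists>p. real_polynomial_function p \<and> (\<forall>x\<in>Z. \<bar>f x - p x\<bar> < 1 / real (Suc n))" for n
      by (rule Stone_Weierstrass_real_polynomial_function[OF Z_compact fZ, of "1 / real (Suc n)"]) auto
    then obtain p where p: "\<And>n. real_polynomial_function (p n)"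
        and pf: "\<And>n x. x \<in> Z \<Longrightarrow> \<bar>f x - p n x\<bar> < 1 / real (Suc n)"
      by metis
    have pm: "p n \<in> borel_measurable borel" for n
      using C_k_polynomial[OF p, of 0 n] by (simp add: borel_measurable_continuous_onI)
    have "bounded (f ` Z)"
      using fZ Z_compact by (intro compact_imp_bounded compact_continuous_image)
    then obtain B where B: "\<And>x. x \<in> Z \<Longrightarrow> \<bar>f x\<bar> \<le> B"
      unfolding bounded_iff by fastforce
    show ?thesis
    proof (rule duality_bound_limit[OF g g2 \<psi>, where f = p and M = "B + 1"])
      show "\<bar>p n x\<bar> \<le> B + 1" if "\<psi> x \<noteq> 0" for n x
      proof -
        have "1 / real (Suc n) \<le> 1" by simp
        then show ?thesis using pf[of x n] B[of x] Z[OF that] by linarith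
      qed
      have "(\<lambda>n. p n x) \<longlonglongrightarrow> f x" if "x \<in> Z" for x
      proof (rule LIM_zero_cancel, rule Lim_null_comparison)
        show "\<forall>\<^sub>F n in sequentially. norm (p n x - f x) \<le> 1 / real (Suc n)"
          using pf[OF that] by (auto simp: abs_minus_commute less_imp_le)
      qed (rule LIMSEQ_Suc[OF lim_inverse_n'])
      then show "AE x in lborel. \<psi> x \<noteq> 0 \<longrightarrow> (\<lambda>n. p n x) \<longlonglongrightarrow> f x"
        using Z by auto
      show "\<bar>\<integral>x. g x * (p n x * \<psi> x) \<partial>lborel\<bar> \<le> C * sqrt (\<integral>x. (p n x * \<psi> x)\<^sup>2 \<partial>lborel)" for n
        using C_k_polynomial[OF p] by (intro dual mult_in_test_functions \<psi>) auto
    qed (fact pm borel_measurable_continuous_onI[OF f])+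
  qed
  have "f \<in> borel_measurable lebesgue"
    using f(1) by (intro measurable_completion) simp
  then have "f measurable_on UNIV"
    by (rule lebesgue_measurable_imp_measurable_on_real) simp
  then obtain N q where N: "negligible N" and q: "\<And>n. continuous_on UNIV (q n)"
    and qf: "\<And>x. x \<notin> N \<Longrightarrow> (\<lambda>n. q n x) \<longlonglongrightarrow> f x"
    unfolding measurable_on_def by auto
  define r where "r n x = max (- M) (min M (q n x))" for n x
  have rc: "continuous_on UNIV (r n)" for n
    unfolding r_def using q by (intro continuous_intros)
  have "M \<ge> 0" using f(2)[of 0] by linarith
  show ?thesis
  proof (rule duality_bound_limit[OF g g2 \<psi>, where f = r and M = M])
    show "\<bar>r n x\<bar> \<le> M" for n x using \<open>M \<ge> 0\<close> by (auto simp: r_def)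
    have "AE x in lborel. x \<notin> N"
      using AE_not_in[of N lebesgue] N AE_completion_iff[of "\<lambda>x. x \<notin> N" lborel]
      by (simp only: negligible_iff_null_sets)
    then show "AE x in lborel. \<psi> x \<noteq> 0 \<longrightarrow> (\<lambda>n. r n x) \<longlonglongrightarrow> f x"
    proof eventually_elim
      case (elim x)
      have "(\<lambda>n. r n x) \<longlonglongrightarrow> max (- M) (min M (f x))"
        unfolding r_def by (intro tendsto_intros qf elim)
      also have "max (- M) (min M (f x)) = f x" using f(2)[of x] by auto
      finally show ?case by simp
    qed
    show "\<bar>\<integral>x. g x * (r n x * \<psi> x) \<partial>lborel\<bar> \<le> C * sqrt (\<integral>x. (r n x * \<psi> x)\<^sup>2 \<partial>lborel)" for n
      by (rule continuous[OF rc])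
  qed (fact f borel_measurable_continuous_onI[OF rc])+
qed

text \<open>The bound is applied to \<open>g\<close> itself, truncated to where \<open>\<psi>\<close> is not small and \<open>g\<close> is not large: this is
  \<open>f * \<psi>\<close> with a bounded Borel factor \<open>f\<close>, and \<open>\<integral> g * (f * \<psi>) \<ge> \<integral> (f * \<psi>)\<^sup>2\<close>.\<close>

lemma duality_bound_on_support:
  fixes g \<psi> :: "R2 \<Rightarrow> real"
  assumes g [measurable]: "g \<in> borel_measurable borel" and g2: "integrable lborel (\<lambda>x. (g x)\<^sup>2)" and "C \<ge> 0"
    and dual: "\<And>\<phi>. \<phi> \<in> test_functions S \<Longrightarrow> \<bar>\<integral>x. g x * \<phi> x \<partial>lborel\<bar> \<le> C * sqrt (\<integral>x. (\<phi> x)\<^sup>2 \<partial>lborel)"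
    and \<psi>: "\<psi> \<in> test_functions S" "\<And>x. \<psi> x \<ge> 0"
  shows "(\<integral>x. indicator {x. \<psi> x > 0} x * (g x)\<^sup>2 \<partial>lborel) \<le> C\<^sup>2"
proof -
  have [measurable]: "\<psi> \<in> borel_measurable borel" using \<psi>(1) by (rule test_functions_measurable)
  define A where "A n = {x. \<psi> x > 1 / real (Suc n)}" for n
  have [measurable]: "A n \<in> sets borel" for n unfolding A_def by measurable
  define t where "t n x = indicator (A n) x * max (- real n) (min (real n) (g x))" for n x
  have [measurable]: "t n \<in> borel_measurable borel" for n unfolding t_def by measurable
  have t_g: "(t n x)\<^sup>2 \<le> g x * t n x" "(t n x)\<^sup>2 \<le> (g x)\<^sup>2" for n x
  proof -
    have "t n x = 0 \<or> 0 \<le> t n x \<and> t n x \<le> g x \<or> t n x \<le> 0 \<and> g x \<le> t n x"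
      by (cases "x \<in> A n") (auto simp: t_def min_def max_def)
    then have "(t n x)\<^sup>2 \<le> g x * t n x \<and> \<bar>t n x\<bar> \<le> \<bar>g x\<bar>"
      by (auto simp: power2_eq_square mult_right_mono mult_right_mono_neg)
    then show "(t n x)\<^sup>2 \<le> g x * t n x" "(t n x)\<^sup>2 \<le> (g x)\<^sup>2"
      by (auto simp: abs_le_square_iff)
  qed
  have t2: "integrable lborel (\<lambda>x. (t n x)\<^sup>2)" for n
    by (rule Bochner_Integration.integrable_bound[OF g2]) (use t_g(2) in auto)
  have bound: "(\<integral>x. (t n x)\<^sup>2 \<partial>lborel) \<le> C\<^sup>2" for n
  proof -
    define f where "f x = t n x / \<psi> x" for x
    have [measurable]: "f \<in> borel_measurable borel" unfolding f_def by measurable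
    have f\<psi>: "f x * \<psi> x = t n x" for x
    proof (cases "x \<in> A n")
      case True
      then have "\<psi> x > 0" by (auto simp: A_def intro: less_trans[rotated])
      then show ?thesis by (simp add: f_def)
    qed (simp add: f_def t_def)
    have fb: "\<bar>f x\<bar> \<le> real n * real (Suc n)" for x
    proof (cases "x \<in> A n")
      case True
      then have \<psi>_gt: "\<psi> x > 1 / real (Suc n)" by (auto simp: A_def)
      have "\<bar>t n x\<bar> \<le> real n" by (auto simp: t_def indicator_def)
      moreover have "\<psi> x > 0" using \<psi>_gt by (rule less_trans[rotated]) simp
      moreover have "1 / \<psi> x \<le> real (Suc n)" using \<psi>_gt \<open>\<psi> x > 0\<close> by (simp add: field_simps)
      ultimately have "\<bar>t n x\<bar> * (1 / \<psi> x) \<le> real n * real (Suc n)" by (intro mult_mono) auto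
      then show ?thesis using \<open>\<psi> x > 0\<close> by (simp add: f_def abs_div)
    qed (simp add: f_def t_def)
    define s where "s = sqrt (\<integral>x. (t n x)\<^sup>2 \<partial>lborel)"
    have "s\<^sup>2 = (\<integral>x. (t n x)\<^sup>2 \<partial>lborel)" by (simp add: s_def)
    also have "\<dots> \<le> (\<integral>x. g x * t n x \<partial>lborel)"
      using t2 t_g(1) by (intro integral_mono integrable_mult_square_integrable g2) auto
    also have "\<dots> \<le> C * s"
      using duality_bound_borel[OF g g2 dual \<psi>(1), where f = f, OF _ _ fb] by (simp add: f\<psi> s_def)
    finally have "s * s \<le> C * s" by (simp add: power2_eq_square)
    moreover have "s \<ge> 0" by (simp add: s_def)
    ultimately have "s \<le> C" using \<open>C \<ge> 0\<close> by (cases "s = 0") auto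
    then have "s\<^sup>2 \<le> C\<^sup>2" using \<open>s \<ge> 0\<close> by (intro power_mono)
    then show ?thesis by (simp add: s_def)
  qed
  have "(\<lambda>n. \<integral>x. (t n x)\<^sup>2 \<partial>lborel) \<longlonglongrightarrow> (\<integral>x. indicator {x. \<psi> x > 0} x * (g x)\<^sup>2 \<partial>lborel)"
  proof (rule integral_dominated_convergence[where w = "\<lambda>x. (g x)\<^sup>2"])
    show "AE x in lborel. (\<lambda>n. (t n x)\<^sup>2) \<longlonglongrightarrow> indicator {x. \<psi> x > 0} x * (g x)\<^sup>2"
    proof (rule AE_I2, rule tendsto_eventually)
      fix x
      obtain m where m: "\<bar>g x\<bar> \<le> real m" using real_arch_simple by blast
      show "\<forall>\<^sub>F n in sequentially. (t n x)\<^sup>2 = indicator {x. \<psi> x > 0} x * (g x)\<^sup>2"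
      proof (cases "\<psi> x > 0")
        case True
        then obtain k where k: "1 / real (Suc k) < \<psi> x" using nat_approx_posE by blast
        show ?thesis
        proof (rule eventually_sequentiallyI)
          fix n assume n: "n \<ge> max m k"
          have "1 / real (Suc n) \<le> 1 / real (Suc k)" using n by (intro divide_left_mono) auto
          then have "x \<in> A n" using k by (simp add: A_def)
          moreover have "\<bar>g x\<bar> \<le> real n" using m n by simp
          ultimately show "(t n x)\<^sup>2 = indicator {x. \<psi> x > 0} x * (g x)\<^sup>2"
            using True by (auto simp: t_def)
        qed
      next
        case False
        then have "x \<notin> A n" for n by (auto simp: A_def not_less intro: order_trans)
        then show ?thesis using False by (simp add: t_def)
      qed
    qed
  qed (use g2 t_g(2) in auto)
  then show ?thesis
    by (rule LIMSEQ_le_const2) (use bound in auto)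
qed

text \<open>Countably many boxes with closure in \<open>S\<close> cover \<open>S\<close>; the functions are the partial sums of their bumps.\<close>

lemma open_exhausted_by_test_functions:
  assumes "open S"
  obtains \<psi> where "\<And>k. \<psi> k \<in> test_functions S" "\<And>k x. \<psi> k x \<ge> 0"
    "\<And>x. x \<in> S \<Longrightarrow> \<forall>\<^sub>F k in sequentially. \<psi> k x > 0"
proof -
  let ?F = "{box l u | l u :: R2. cbox l u \<subseteq> S}"
  obtain F where F: "F \<subseteq> ?F" "countable F" "\<Union>F = \<Union>?F"
    by (rule Lindelof[of ?F]) (auto simp: open_box)
  have cover: "\<exists>B\<in>F. x \<in> B" if "x \<in> S" for x
  proof -
    obtain l u where "cbox l u \<subseteq> S" "x \<in> box l u"
      by (rule open_contains_cbox[OF assms \<open>x \<in> S\<close>])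
    then have "x \<in> \<Union>?F" by blast
    then show ?thesis unfolding F(3)[symmetric] by (rule UnionE) blast
  qed
  have "\<exists>lu. B = box (fst lu) (snd lu) \<and> cbox (fst lu) (snd lu) \<subseteq> S" if "B \<in> F" for B
    using F(1) that by fastforce
  then obtain c where c: "\<And>B. B \<in> F \<Longrightarrow> B = box (fst (c B)) (snd (c B)) \<and> cbox (fst (c B)) (snd (c B)) \<subseteq> S"
    by metis
  define b where "b n = (if F = {} then (\<lambda>x. 0) else bump (fst (c (from_nat_into F n))) (snd (c (from_nat_into F n))))" for n
  have b: "b n \<in> test_functions S" for n
    using c[of "from_nat_into F n"] from_nat_into[of F n]
    by (auto simp: b_def intro: bump_in_test_functions zero_in_test_functions)
  have b0: "b n x \<ge> 0" for n x by (simp add: b_def bump_nonneg)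
  show ?thesis
  proof (rule that[of "\<lambda>k x. \<Sum>n<k. b n x"])
    show "(\<lambda>x. \<Sum>n<k. b n x) \<in> test_functions S" for k
      by (induction k) (auto intro: zero_in_test_functions add_in_test_functions b)
    show "(\<Sum>n<k. b n x) \<ge> 0" for k x by (intro sum_nonneg b0)
    fix x assume "x \<in> S"
    then obtain B where B: "B \<in> F" "x \<in> B" using cover by blast
    then obtain m where m: "from_nat_into F m = B" using from_nat_into_surj[OF F(2)] by blast
    have "b m x > 0"
      using B c[OF B(1)] m by (auto simp: b_def bump_pos_iff)
    then have "(\<Sum>n<k. b n x) > 0" if "k \<ge> Suc m" for k
      using that b0 by (intro sum_pos2[of _ m]) auto
    then show "\<forall>\<^sub>F k in sequentially. (\<Sum>n<k. b n x) > 0"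
      by (rule eventually_sequentiallyI)
  qed
qed

text \<open>Weak derivatives and limits of mollified functions are known through integrals against test functions only. This
  is the way back to norms.\<close>

lemma L2_norm_by_duality:
  fixes g :: "R2 \<Rightarrow> real"
  assumes "open S" and g: "g \<in> borel_measurable borel" and g2: "integrable lborel (\<lambda>x. (g x)\<^sup>2)"
    and g0: "\<And>x. x \<notin> S \<Longrightarrow> g x = 0" and "C \<ge> 0"
    and dual: "\<And>\<phi>. \<phi> \<in> test_functions S \<Longrightarrow> \<bar>\<integral>x. g x * \<phi> x \<partial>lborel\<bar> \<le> C * sqrt (\<integral>x. (\<phi> x)\<^sup>2 \<partial>lborel)"
  shows "(\<integral>x. (g x)\<^sup>2 \<partial>lborel) \<le> C\<^sup>2"
proof -
  obtain \<psi> where \<psi>: "\<And>k. \<psi> k \<in> test_functions S" "\<And>k x. \<psi> k x \<ge> 0"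
    "\<And>x. x \<in> S \<Longrightarrow> \<forall>\<^sub>F k in sequentially. \<psi> k x > 0"
    using open_exhausted_by_test_functions[OF assms(1)] by metis
  have [measurable]: "\<psi> k \<in> borel_measurable borel" for k using \<psi>(1) by (rule test_functions_measurable)
  note g [measurable]
  have "(\<lambda>k. \<integral>x. indicator {x. \<psi> k x > 0} x * (g x)\<^sup>2 \<partial>lborel) \<longlonglongrightarrow> (\<integral>x. (g x)\<^sup>2 \<partial>lborel)"
  proof (rule integral_dominated_convergence[where w = "\<lambda>x. (g x)\<^sup>2"])
    show "AE x in lborel. (\<lambda>k. indicator {x. \<psi> k x > 0} x * (g x)\<^sup>2) \<longlonglongrightarrow> (g x)\<^sup>2"
    proof (rule AE_I2, rule tendsto_eventually)
      fix x
      show "\<forall>\<^sub>F k in sequentially. indicator {x. \<psi> k x > 0} x * (g x)\<^sup>2 = (g x)\<^sup>2"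
      proof (cases "x \<in> S")
        case True
        from \<psi>(3)[OF this] show ?thesis by eventually_elim simp
      qed (simp add: g0)
    qed
    show "AE x in lborel. norm (indicator {x. \<psi> k x > 0} x * (g x)\<^sup>2) \<le> (g x)\<^sup>2" for k
      by (rule AE_I2) (auto simp: indicator_def)
  qed (use g2 in auto)
  then show ?thesis
    by (rule LIMSEQ_le_const2)
       (use duality_bound_on_support[OF g g2 \<open>C \<ge> 0\<close> dual \<psi>(1) \<psi>(2)] in auto)
qed

section \<open>Integration tools\<close>

lemma nn_integral_swap:
  fixes f :: "'a::euclidean_space \<Rightarrow> 'b::euclidean_space \<Rightarrow> ennreal"
  assumes "(\<lambda>(x, y). f x y) \<in> borel_measurable (lborel \<Otimes>\<^sub>M lborel)"
  shows "(\<integral>\<^sup>+x. (\<integral>\<^sup>+y. f x y \<partial>lborel) \<partial>lborel) = (\<integral>\<^sup>+y. (\<integral>\<^sup>+x. f x y \<partial>lborel) \<partial>lborel)"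
  using lborel_pair.Fubini'[OF assms] by simp

lemma nn_integral_translate:
  fixes f :: "'a::euclidean_space \<Rightarrow> ennreal"
  assumes [measurable]: "f \<in> borel_measurable borel"
  shows "(\<integral>\<^sup>+x. f (c + x) \<partial>lborel) = (\<integral>\<^sup>+x. f x \<partial>lborel)"
  by (subst (2) lborel_distr_plus[of c, symmetric]) (simp add: nn_integral_distr)

text \<open>The substitution has the Jacobian \<open>c\<^sup>2 \<ge> 1/4\<close>.\<close>

lemma nn_integral_dilate:
  fixes f :: "R2 \<Rightarrow> ennreal"
  assumes [measurable]: "f \<in> borel_measurable borel" and "1 / 2 \<le> c"
  shows "(\<integral>\<^sup>+x. f (t + c *\<^sub>R x) \<partial>lborel) \<le> 4 * (\<integral>\<^sup>+x. f x \<partial>lborel)"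
proof -
  have c: "c \<noteq> 0" and c2: "c\<^sup>2 \<ge> 1 / 4"
    using assms(2) power_mono[of "1 / 2" c 2] by (auto simp: power2_eq_square)
  have "(\<integral>\<^sup>+x. f x \<partial>lborel) = (\<integral>\<^sup>+x. ennreal (c\<^sup>2) * f (t + c *\<^sub>R x) \<partial>lborel)"
    by (subst lborel_affine[OF c, of t]) (simp add: nn_integral_density nn_integral_distr)
  also have "\<dots> = ennreal (c\<^sup>2) * (\<integral>\<^sup>+x. f (t + c *\<^sub>R x) \<partial>lborel)"
    by (simp add: nn_integral_cmult)
  finally have eq: "(\<integral>\<^sup>+x. f x \<partial>lborel) = ennreal (c\<^sup>2) * (\<integral>\<^sup>+x. f (t + c *\<^sub>R x) \<partial>lborel)" .
  have "1 \<le> ennreal (4 * c\<^sup>2)"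
    using c2 by simp
  then have "(\<integral>\<^sup>+x. f (t + c *\<^sub>R x) \<partial>lborel) \<le> ennreal (4 * c\<^sup>2) * (\<integral>\<^sup>+x. f (t + c *\<^sub>R x) \<partial>lborel)"
    using mult_right_mono[of 1 "ennreal (4 * c\<^sup>2)"] by simp
  also have "\<dots> = 4 * (\<integral>\<^sup>+x. f x \<partial>lborel)"
    by (simp add: eq ennreal_mult mult.assoc)
  finally show ?thesis .
qed

text \<open>The inequality of Cauchy and Schwarz for the factors \<open>f * sqrt w\<close> and \<open>sqrt w\<close>.\<close>

lemma nn_integral_weighted_square_le:
  fixes f :: "'a \<Rightarrow> ennreal" and w :: "'a \<Rightarrow> real"
  assumes [measurable]: "f \<in> borel_measurable M" "w \<in> borel_measurable M"
    and w: "\<And>x. w x \<ge> 0" "(\<integral>\<^sup>+x. ennreal (w x) \<partial>M) = 1"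
  shows "(\<integral>\<^sup>+x. f x * ennreal (w x) \<partial>M)\<^sup>2 \<le> (\<integral>\<^sup>+x. (f x)\<^sup>2 * ennreal (w x) \<partial>M)"
proof -
  have sq: "ennreal (sqrt (w x)) * ennreal (sqrt (w x)) = ennreal (w x)" for x
    using w(1) by (simp add: ennreal_mult[symmetric])
  have "(\<integral>\<^sup>+x. f x * ennreal (w x) \<partial>M)\<^sup>2
      = (\<integral>\<^sup>+x. (f x * ennreal (sqrt (w x))) * ennreal (sqrt (w x)) \<partial>M)\<^sup>2"
    by (simp add: mult.assoc sq)
  also have "\<dots> \<le> (\<integral>\<^sup>+x. (f x * ennreal (sqrt (w x)))\<^sup>2 \<partial>M) * (\<integral>\<^sup>+x. (ennreal (sqrt (w x)))\<^sup>2 \<partial>M)"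
    by (rule Cauchy_Schwarz_nn_integral) measurable
  also have "\<dots> = (\<integral>\<^sup>+x. (f x)\<^sup>2 * ennreal (w x) \<partial>M)"
    by (simp add: power2_eq_square sq w(2) ac_simps)
  finally show ?thesis .
qed

lemma ennreal_abs_integral_le:
  fixes f :: "'a \<Rightarrow> real"
  shows "ennreal \<bar>\<integral>x. f x \<partial>M\<bar> \<le> (\<integral>\<^sup>+x. ennreal \<bar>f x\<bar> \<partial>M)"
proof (cases "integrable M f")
  case True
  from integral_norm_bound_ennreal[OF this] show ?thesis by simp
qed (simp add: not_integrable_integral_eq)

lemma nn_integral_square_eq_integral:
  fixes f :: "'a \<Rightarrow> real"
  assumes "integrable M (\<lambda>x. (f x)\<^sup>2)"
  shows "(\<integral>\<^sup>+x. ennreal ((f x)\<^sup>2) \<partial>M) = ennreal (\<integral>x. (f x)\<^sup>2 \<partial>M)"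
  using assms by (intro nn_integral_eq_integral) auto

lemma fatou_iterated:
  fixes f :: "nat \<Rightarrow> 'a::euclidean_space \<Rightarrow> 'b::euclidean_space \<Rightarrow> ennreal"
  assumes f [measurable]: "\<And>n. (\<lambda>p. f n (fst p) (snd p)) \<in> borel_measurable (lborel \<Otimes>\<^sub>M lborel)"
    and lim: "\<And>x y. (\<lambda>n. f n x y) \<longlonglongrightarrow> g x y"
    and bound: "\<And>n. (\<integral>\<^sup>+x. (\<integral>\<^sup>+y. f n x y \<partial>lborel) \<partial>lborel) \<le> C"
  shows "(\<integral>\<^sup>+x. (\<integral>\<^sup>+y. g x y \<partial>lborel) \<partial>lborel) \<le> C"
proof -
  have [measurable]: "(\<lambda>y. f n x y) \<in> borel_measurable lborel" for n x
    using measurable_compose[OF measurable_Pair1'[of x lborel lborel] f[of n]] by simp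
  have "(\<integral>\<^sup>+x. (\<integral>\<^sup>+y. g x y \<partial>lborel) \<partial>lborel)
      = (\<integral>\<^sup>+x. (\<integral>\<^sup>+y. liminf (\<lambda>n. f n x y) \<partial>lborel) \<partial>lborel)"
    using lim_imp_Liminf[OF sequentially_bot lim] by simp
  also have "\<dots> \<le> (\<integral>\<^sup>+x. liminf (\<lambda>n. \<integral>\<^sup>+y. f n x y \<partial>lborel) \<partial>lborel)"
    by (intro nn_integral_mono nn_integral_liminf) measurable
  also have "\<dots> \<le> liminf (\<lambda>n. \<integral>\<^sup>+x. (\<integral>\<^sup>+y. f n x y \<partial>lborel) \<partial>lborel)"
    by (intro nn_integral_liminf) measurable
  also have "\<dots> \<le> liminf (\<lambda>n::nat. C)"
    by (intro Liminf_mono always_eventually allI bound)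
  also have "\<dots> = C"
    by (simp add: Liminf_const)
  finally show ?thesis .
qed

lemma borel_measurable_vector_2 [measurable]:
  assumes [measurable]: "g \<in> borel_measurable M" "h \<in> borel_measurable M"
  shows "(\<lambda>p. vector [g p, h p] :: R2) \<in> borel_measurable M"
proof -
  have "(\<lambda>p. vector [g p, h p] :: R2) = (\<lambda>p. g p *\<^sub>R axis 1 1 + h p *\<^sub>R axis 2 1)"
    by (auto simp: vec_eq_iff forall_2 axis_def)
  then show ?thesis by (simp only:) measurable
qed

text \<open>The determinant of \<open>b\<close> and \<open>c\<close>, that is, the signed area of the parallelogram that they span.\<close>

definition cross :: "R2 \<Rightarrow> R2 \<Rightarrow> real" where
  "cross b c = b $ 1 * c $ 2 - b $ 2 * c $ 1"

text \<open>The Lebesgue measure of the plane is the image of the product measure, since both agree on boxes.\<close>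

lemma nn_integral_R2_iterated:
  fixes f :: "R2 \<Rightarrow> ennreal"
  assumes [measurable]: "f \<in> borel_measurable borel"
  shows "(\<integral>\<^sup>+x. f x \<partial>lborel) = (\<integral>\<^sup>+u. (\<integral>\<^sup>+w. f (vector [u, w]) \<partial>lborel) \<partial>lborel)"
proof -
  let ?T = "\<lambda>p::real \<times> real. vector [fst p, snd p] :: R2"
  have T [measurable]: "?T \<in> borel_measurable (lborel \<Otimes>\<^sub>M lborel)"
    by measurable
  have lborel_eq: "lborel = distr (lborel \<Otimes>\<^sub>M lborel) borel ?T"
  proof (rule lborel_eqI)
    fix l u :: R2
    assume lu: "\<And>b. b \<in> Basis \<Longrightarrow> l \<bullet> b \<le> u \<bullet> b"
    have le: "l $ i \<le> u $ i" for i
      using lu[of "axis i 1"] by (simp add: inner_axis)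
    have pre: "?T -` box l u \<inter> space (lborel \<Otimes>\<^sub>M lborel) = {l $ 1<..<u $ 1} \<times> {l $ 2<..<u $ 2}"
      by (auto simp: space_pair_measure mem_box_cart forall_2)
    have "emeasure (distr (lborel \<Otimes>\<^sub>M lborel) borel ?T) (box l u)
        = emeasure lborel {l $ 1<..<u $ 1} * emeasure lborel {l $ 2<..<u $ 2}"
      by (simp add: emeasure_distr pre lborel.emeasure_pair_measure_Times)
    also have "\<dots> = ennreal ((u $ 1 - l $ 1) * (u $ 2 - l $ 2))"
      using le by (simp add: ennreal_mult)
    also have "(u $ 1 - l $ 1) * (u $ 2 - l $ 2) = measure lborel (cbox l u)"
      using le by (subst content_cbox_cart) (auto simp: interval_eq_empty_cart UNIV_2 not_less[symmetric] forall_2)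
    also have "\<dots> = (\<Prod>b\<in>Basis. (u - l) \<bullet> b)"
      using lu by (subst content_cbox) (auto simp: inner_diff_left)
    finally show "emeasure (distr (lborel \<Otimes>\<^sub>M lborel) borel ?T) (box l u) = (\<Prod>b\<in>Basis. (u - l) \<bullet> b)" .
  qed simp
  have "(\<integral>\<^sup>+x. f x \<partial>lborel) = (\<integral>\<^sup>+x. f x \<partial>distr (lborel \<Otimes>\<^sub>M lborel) borel ?T)"
    by (rule arg_cong[OF lborel_eq, of "\<lambda>M. nn_integral M f"])
  also have "\<dots> = (\<integral>\<^sup>+p. f (?T p) \<partial>(lborel \<Otimes>\<^sub>M lborel))"
    by (rule nn_integral_distr) measurable
  also have "\<dots> = (\<integral>\<^sup>+u. (\<integral>\<^sup>+w. f (?T (u, w)) \<partial>lborel) \<partial>lborel)"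
    by (rule lborel.nn_integral_fst[symmetric]) measurable
  finally show ?thesis by simp
qed

text \<open>Substituting one coordinate after the other: the first substitution has the factor \<open>b $ 1\<close>, the
  second \<open>cross b c / b $ 1\<close>.\<close>

lemma nn_integral_parallelogram:
  fixes f :: "R2 \<Rightarrow> ennreal"
  assumes f [measurable]: "f \<in> borel_measurable borel" and "cross b c \<noteq> 0"
  shows "ennreal \<bar>cross b c\<bar> * (\<integral>\<^sup>+y. (\<integral>\<^sup>+s. f (a + y *\<^sub>R b + s *\<^sub>R c) \<partial>lborel) \<partial>lborel) = (\<integral>\<^sup>+x. f x \<partial>lborel)"
proof -
  have special: "ennreal \<bar>cross b c\<bar> * (\<integral>\<^sup>+y. (\<integral>\<^sup>+s. f (a + y *\<^sub>R b + s *\<^sub>R c) \<partial>lborel) \<partial>lborel)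
      = (\<integral>\<^sup>+x. f x \<partial>lborel)" if D: "cross b c \<noteq> 0" and b: "b $ 1 \<noteq> 0" for b c
  proof -
    let ?E = "cross b c / b $ 1"
    have E: "?E \<noteq> 0" using D b by simp
    have "(\<integral>\<^sup>+x. f x \<partial>lborel) = (\<integral>\<^sup>+u. (\<integral>\<^sup>+w. f (vector [u, w]) \<partial>lborel) \<partial>lborel)"
      by (rule nn_integral_R2_iterated[OF f])
    also have "\<dots> = (\<integral>\<^sup>+u. ennreal \<bar>?E\<bar> * (\<integral>\<^sup>+s. f (vector [u, (a $ 2 + (u - a $ 1) * b $ 2 / b $ 1) + ?E * s]) \<partial>lborel) \<partial>lborel)"
      by (intro nn_integral_cong nn_integral_real_affine E) measurable
    also have "\<dots> = ennreal \<bar>?E\<bar> * (\<integral>\<^sup>+u. (\<integral>\<^sup>+s. f (vector [u, (a $ 2 + (u - a $ 1) * b $ 2 / b $ 1) + ?E * s]) \<partial>lborel) \<partial>lborel)"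
      by (intro nn_integral_cmult) measurable
    also have "(\<integral>\<^sup>+u. (\<integral>\<^sup>+s. f (vector [u, (a $ 2 + (u - a $ 1) * b $ 2 / b $ 1) + ?E * s]) \<partial>lborel) \<partial>lborel)
        = (\<integral>\<^sup>+s. (\<integral>\<^sup>+u. f (vector [u, (a $ 2 + (u - a $ 1) * b $ 2 / b $ 1) + ?E * s]) \<partial>lborel) \<partial>lborel)"
      by (rule nn_integral_swap) measurable
    also have "\<dots> = (\<integral>\<^sup>+s. ennreal \<bar>b $ 1\<bar> * (\<integral>\<^sup>+y. f (vector [(a $ 1 + s * c $ 1) + b $ 1 * y,
        (a $ 2 + ((a $ 1 + s * c $ 1) + b $ 1 * y - a $ 1) * b $ 2 / b $ 1) + ?E * s]) \<partial>lborel) \<partial>lborel)"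
      by (intro nn_integral_cong nn_integral_real_affine b) measurable
    also have "\<dots> = (\<integral>\<^sup>+s. ennreal \<bar>b $ 1\<bar> * (\<integral>\<^sup>+y. f (a + y *\<^sub>R b + s *\<^sub>R c) \<partial>lborel) \<partial>lborel)"
    proof -
      have "vector [(a $ 1 + s * c $ 1) + b $ 1 * y,
          (a $ 2 + ((a $ 1 + s * c $ 1) + b $ 1 * y - a $ 1) * b $ 2 / b $ 1) + ?E * s]
        = a + y *\<^sub>R b + s *\<^sub>R c" for y s
        using b unfolding vec_eq_iff forall_2 by (simp add: cross_def field_simps)
      then show ?thesis by (simp only:)
    qed
    also have "\<dots> = ennreal \<bar>b $ 1\<bar> * (\<integral>\<^sup>+s. (\<integral>\<^sup>+y. f (a + y *\<^sub>R b + s *\<^sub>R c) \<partial>lborel) \<partial>lborel)"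
      by (intro nn_integral_cmult) measurable
    also have "(\<integral>\<^sup>+s. (\<integral>\<^sup>+y. f (a + y *\<^sub>R b + s *\<^sub>R c) \<partial>lborel) \<partial>lborel)
        = (\<integral>\<^sup>+y. (\<integral>\<^sup>+s. f (a + y *\<^sub>R b + s *\<^sub>R c) \<partial>lborel) \<partial>lborel)"
      by (rule nn_integral_swap) measurable
    also have "ennreal \<bar>?E\<bar> * (ennreal \<bar>b $ 1\<bar> * I) = ennreal \<bar>cross b c\<bar> * I" for I
      using b by (simp add: mult.assoc[symmetric] ennreal_mult[symmetric] abs_div)
    finally show ?thesis ..
  qed
  show ?thesis
  proof (cases "b $ 1 = 0")
    case False
    then show ?thesis by (intro special assms)
  next
    case True
    have swap: "cross c b = - cross b c" by (simp add: cross_def)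
    have "c $ 1 \<noteq> 0" using True assms(2) by (auto simp: cross_def)
    then have "ennreal \<bar>cross b c\<bar> * (\<integral>\<^sup>+y. (\<integral>\<^sup>+s. f (a + y *\<^sub>R c + s *\<^sub>R b) \<partial>lborel) \<partial>lborel) = (\<integral>\<^sup>+x. f x \<partial>lborel)"
      using special[of c b] assms(2) by (simp add: swap)
    also have "(\<integral>\<^sup>+y. (\<integral>\<^sup>+s. f (a + y *\<^sub>R c + s *\<^sub>R b) \<partial>lborel) \<partial>lborel)
        = (\<integral>\<^sup>+s. (\<integral>\<^sup>+y. f (a + y *\<^sub>R c + s *\<^sub>R b) \<partial>lborel) \<partial>lborel)"
      by (rule nn_integral_swap) measurable
    finally show ?thesis by (simp add: add_ac)
  qed
qed

section \<open>Mollifiers\<close>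

text \<open>Symmetry is required so that, by Fubini's theorem, a mollifier can be moved from one factor of an integral to the
  other.\<close>

definition mollifier :: "real \<Rightarrow> (R2 \<Rightarrow> real) \<Rightarrow> bool" where
  "mollifier r \<rho> \<longleftrightarrow> \<rho> \<in> test_functions UNIV \<and> (\<forall>x. \<rho> x \<ge> 0) \<and> (\<integral>x. \<rho> x \<partial>lborel) = 1 \<and>
     (\<forall>x. \<rho> (- x) = \<rho> x) \<and> closure {x. \<rho> x \<noteq> 0} \<subseteq> cball 0 r"

lemma mollifier_exists:
  assumes "r > 0"
  obtains \<rho> where "mollifier r \<rho>"
proof -
  define u :: R2 where "u = (\<chi> i. r / 2)"
  let ?b = "bump (- u) u"
  have b: "?b \<in> test_functions (cbox (- u) u)"
    by (rule bump_in_test_functions) simp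
  have int: "integrable lborel ?b"
    using b by (rule test_functions_integrable)
  have "(\<integral>x. ?b x \<partial>lborel) \<noteq> 0"
  proof
    assume "(\<integral>x. ?b x \<partial>lborel) = 0"
    then have "AE x in lborel. ?b x = 0"
      using integral_nonneg_eq_0_iff_AE[OF int] by (simp add: bump_nonneg)
    then have "AE x in lborel. x \<notin> box (- u) u"
      by (simp add: bump_eq_0_iff)
    then have "box (- u) u \<in> null_sets lborel"
      using AE_iff_null_sets[of "box (- u) u" lborel] by simp
    then have "negligible (box (- u) u)"
      unfolding negligible_iff_null_sets by (rule null_sets_completionI)
    moreover have "box (- u) u \<noteq> {}"
      using assms by (simp add: interval_ne_empty_cart u_def)
    ultimately show False
      using open_not_negligible[OF open_box] by blast
  qed
  moreover have "(\<integral>x. ?b x \<partial>lborel) \<ge> 0"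
    by (intro integral_nonneg_AE) (simp add: bump_nonneg)
  ultimately have pos: "(\<integral>x. ?b x \<partial>lborel) > 0" by simp
  define \<rho> where "\<rho> x = 1 / (\<integral>x. ?b x \<partial>lborel) * ?b x" for x
  have "\<rho> \<in> test_functions (cbox (- u) u)"
    unfolding \<rho>_def by (intro mult_in_test_functions b C_k_const)
  moreover have "cbox (- u) u \<subseteq> cball 0 r"
  proof
    fix x assume x: "x \<in> cbox (- u) u"
    have "norm x \<le> \<bar>x $ 1\<bar> + \<bar>x $ 2\<bar>"
      using norm_le_l1_cart[of x] by (simp add: UNIV_2)
    moreover have "\<bar>x $ i\<bar> \<le> r / 2" for i
    proof -
      have "- (u $ i) \<le> x $ i" "x $ i \<le> u $ i" using x by (auto simp: mem_box_cart)
      then show ?thesis by (simp add: u_def abs_le_iff)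
    qed
    from this[of 1] this[of 2] have "\<bar>x $ 1\<bar> + \<bar>x $ 2\<bar> \<le> r" by linarith
    ultimately show "x \<in> cball 0 r" by simp
  qed
  ultimately have "\<rho> \<in> test_functions UNIV" "closure {x. \<rho> x \<noteq> 0} \<subseteq> cball 0 r"
    using test_functionsD(3)[of \<rho>] test_functions_mono[of "cbox (- u) u" UNIV] by auto
  moreover have "\<rho> (- x) = \<rho> x" for x
    by (simp add: \<rho>_def bump_def mult_ac add.commute)
  moreover have "(\<integral>x. \<rho> x \<partial>lborel) = 1"
    unfolding \<rho>_def using int pos by simp
  moreover have "\<rho> x \<ge> 0" for x
    using pos by (simp add: \<rho>_def bump_nonneg)
  ultimately show ?thesis
    by (intro that[of \<rho>]) (auto simp: mollifier_def)
qed

lemma mollifierD: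
  assumes "mollifier r \<rho>"
  shows "\<rho> \<in> test_functions UNIV" "\<rho> x \<ge> 0" "(\<integral>x. \<rho> x \<partial>lborel) = 1" "\<rho> (- x) = \<rho> x"
    "z \<in> closure {x. \<rho> x \<noteq> 0} \<Longrightarrow> norm z \<le> r" "norm x > r \<Longrightarrow> \<rho> x = 0"
    "\<rho> \<in> borel_measurable borel" "integrable lborel \<rho>"
    "(\<integral>\<^sup>+x. ennreal (\<rho> x) \<partial>lborel) = 1"
proof -
  show 1: "\<rho> \<in> test_functions UNIV" "\<And>x. \<rho> x \<ge> 0" "(\<integral>x. \<rho> x \<partial>lborel) = 1" "\<rho> (- x) = \<rho> x"
    using assms by (auto simp: mollifier_def)
  show 2: "z \<in> closure {x. \<rho> x \<noteq> 0} \<Longrightarrow> norm z \<le> r" for z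
    using assms by (auto simp: mollifier_def)
  show "norm x > r \<Longrightarrow> \<rho> x = 0"
    using 2[of x] not_in_closure_support[of x \<rho>] by (meson not_less)
  show "\<rho> \<in> borel_measurable borel" using 1(1) by (rule test_functions_measurable)
  show int: "integrable lborel \<rho>" using 1(1) by (rule test_functions_integrable)
  show "(\<integral>\<^sup>+x. ennreal (\<rho> x) \<partial>lborel) = 1"
    using nn_integral_eq_integral[OF int] 1 by simp
qed

lemma integral_translate:
  fixes f :: "R2 \<Rightarrow> real"
  shows "(\<integral>x. f (x - p) \<partial>lborel) = (\<integral>x. f x \<partial>lborel)"
    and "integrable lborel f \<Longrightarrow> integrable lborel (\<lambda>x. f (x - p))"
proof -
  have eq: "f (x - p) = f (- p + x)" for x by simp
  show "(\<integral>x. f (x - p) \<partial>lborel) = (\<integral>x. f x \<partial>lborel)"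
  proof (cases "f \<in> borel_measurable borel")
    case True
    then show ?thesis
      unfolding eq by (subst (2) lborel_distr_plus[of "- p", symmetric]) (simp add: integral_distr)
  next
    case False
    have "(\<lambda>x. f (x - p)) \<notin> borel_measurable borel"
    proof
      assume [measurable]: "(\<lambda>x. f (x - p)) \<in> borel_measurable borel"
      have "(\<lambda>x. f ((x + p) - p)) \<in> borel_measurable borel" by measurable
      with False show False by simp
    qed
    with False have "\<not> integrable lborel (\<lambda>x. f (x - p))" "\<not> integrable lborel f" by auto
    then show ?thesis by (simp add: not_integrable_integral_eq)
  qed
  show "integrable lborel (\<lambda>x. f (x - p))" if "integrable lborel f"
  proof -
    have "integrable (distr lborel borel ((+) (- p))) f"
      using that by (simp only: lborel_distr_plus)
    then show ?thesis
      unfolding eq by (rule integrable_distr[rotated]) simp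
  qed
qed

lemma mollified_value_close:
  assumes \<rho>: "mollifier r \<rho>" and f [measurable]: "f \<in> borel_measurable borel"
    and close: "\<And>y. norm (y - x) \<le> r \<Longrightarrow> \<bar>f y - f x\<bar> \<le> e"
  shows "\<bar>(\<integral>y. f y * \<rho> (y - x) \<partial>lborel) - f x\<bar> \<le> e"
proof -
  note [measurable] = mollifierD(7)[OF \<rho>]
  have int: "integrable lborel (\<lambda>y. \<rho> (y - x))"
    by (intro integral_translate mollifierD[OF \<rho>])
  have one: "(\<integral>y. \<rho> (y - x) \<partial>lborel) = 1"
    using mollifierD(3)[OF \<rho>] by (simp add: integral_translate)
  have pointwise: "\<bar>(f y - f x) * \<rho> (y - x)\<bar> \<le> e * \<rho> (y - x)" for y
    using close[of y] mollifierD(2)[OF \<rho>, of "y - x"] mollifierD(6)[OF \<rho>, of "y - x"]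
    by (cases "norm (y - x) \<le> r") (auto simp: abs_mult intro!: mult_right_mono)
  have int_diff: "integrable lborel (\<lambda>y. (f y - f x) * \<rho> (y - x))"
    by (rule Bochner_Integration.integrable_bound[OF integrable_mult_right[OF int, of e]])
       (use pointwise in \<open>auto intro!: AE_I2 intro: order_trans[OF _ abs_ge_self]\<close>)
  have "integrable lborel (\<lambda>y. (f y - f x) * \<rho> (y - x) + f x * \<rho> (y - x))"
    using int_diff int by simp
  then have int_f: "integrable lborel (\<lambda>y. f y * \<rho> (y - x))"
    by (simp add: algebra_simps)
  have "(\<integral>y. f y * \<rho> (y - x) \<partial>lborel) - f x = (\<integral>y. (f y - f x) * \<rho> (y - x) \<partial>lborel)"
    using int_f int one by (simp add: left_diff_distrib)
  also have "\<bar>\<dots>\<bar> \<le> (\<integral>y. e * \<rho> (y - x) \<partial>lborel)"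
    using int int_diff pointwise by (intro integral_abs_bound[THEN order_trans] integral_mono) auto
  also have "\<dots> = e" using one by simp
  finally show ?thesis .
qed

lemma mollified_tendsto:
  assumes \<rho>: "\<And>n. mollifier (r n) (\<rho> n)" and r: "r \<longlonglongrightarrow> 0"
    and f: "f \<in> borel_measurable borel" and cont: "isCont f x"
  shows "(\<lambda>n. \<integral>y. f y * \<rho> n (y - x) \<partial>lborel) \<longlonglongrightarrow> f x"
proof (rule tendstoI)
  fix e :: real assume "e > 0"
  then obtain d where d: "d > 0" "\<And>y. dist y x < d \<Longrightarrow> dist (f y) (f x) < e / 2"
    using cont[unfolded continuous_at_eps_delta] by (meson half_gt_zero)
  have "\<forall>\<^sub>F n in sequentially. r n < d"
    using order_tendstoD(2)[OF r \<open>d > 0\<close>] .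
  then show "\<forall>\<^sub>F n in sequentially. dist (\<integral>y. f y * \<rho> n (y - x) \<partial>lborel) (f x) < e"
  proof eventually_elim
    case (elim n)
    have "\<bar>(\<integral>y. f y * \<rho> n (y - x) \<partial>lborel) - f x\<bar> \<le> e / 2"
    proof (rule mollified_value_close[OF \<rho> f])
      fix y assume "norm (y - x) \<le> r n"
      then have "dist y x < d" using elim by (simp add: dist_norm)
      from d(2)[OF this] show "\<bar>f y - f x\<bar> \<le> e / 2" by (simp add: dist_real_def)
    qed
    then show ?case using \<open>e > 0\<close> by (simp add: dist_real_def)
  qed
qed

section \<open>Weakly differentiable functions along segments\<close>

text \<open>A function with its weak gradient, all extended by zero to Borel functions on the plane: translations and Fubini's
  theorem then apply to them without regard to the domain.\<close>

locale weak_gradient =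
  fixes U :: "R2 set" and v g1 g2 :: "R2 \<Rightarrow> real"
  assumes open_U: "open U" and bounded_U: "bounded U"
    and measurable_v [measurable]: "v \<in> borel_measurable borel"
    and measurable_g [measurable]: "g1 \<in> borel_measurable borel" "g2 \<in> borel_measurable borel"
    and v_outside: "\<And>x. x \<notin> U \<Longrightarrow> v x = 0"
    and square_integrable_v: "integrable lborel (\<lambda>x. (v x)\<^sup>2)"
    and square_integrable_g: "integrable lborel (\<lambda>x. (g1 x)\<^sup>2)" "integrable lborel (\<lambda>x. (g2 x)\<^sup>2)"
    and weak_partials:
      "\<And>\<phi>. \<phi> \<in> test_functions U \<Longrightarrow> (\<integral>x. v x * partial 1 \<phi> x \<partial>lborel) = - (\<integral>x. g1 x * \<phi> x \<partial>lborel)"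
      "\<And>\<phi>. \<phi> \<in> test_functions U \<Longrightarrow> (\<integral>x. v x * partial 2 \<phi> x \<partial>lborel) = - (\<integral>x. g2 x * \<phi> x \<partial>lborel)"
begin

definition G :: "R2 \<Rightarrow> real" where "G x = (g1 x)\<^sup>2 + (g2 x)\<^sup>2"

definition energy :: real where "energy = (\<integral>x. (g1 x)\<^sup>2 \<partial>lborel) + (\<integral>x. (g2 x)\<^sup>2 \<partial>lborel)"

definition mollified :: "(R2 \<Rightarrow> real) \<Rightarrow> R2 \<Rightarrow> real" where
  "mollified \<rho> p = (\<integral>x. v x * \<rho> (x - p) \<partial>lborel)"

lemma measurable_G [measurable]: "G \<in> borel_measurable borel"
  unfolding G_def by measurable

lemma G_nonneg: "G x \<ge> 0"
  by (simp add: G_def)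

lemma energy_nonneg: "energy \<ge> 0"
  by (simp add: energy_def)

lemma nn_integral_G: "(\<integral>\<^sup>+x. ennreal (G x) \<partial>lborel) = ennreal energy"
  using square_integrable_g
  by (subst nn_integral_eq_integral) (auto simp: G_def[abs_def] energy_def)

lemma measurable_U [measurable]: "U \<in> sets borel"
  using open_U by simp

lemma finite_measure_U: "emeasure lborel U < \<infinity>"
  using bounded_U by (rule emeasure_bounded_finite)

lemma integrable_if_vanishes_outside:
  fixes f :: "R2 \<Rightarrow> real"
  assumes [measurable]: "f \<in> borel_measurable borel" and "\<And>x. x \<notin> U \<Longrightarrow> f x = 0"
    and "integrable lborel (\<lambda>x. (f x)\<^sup>2)"
  shows "integrable lborel f"
proof -
  have "(\<lambda>x. (indicator U x :: real)\<^sup>2) = indicator U"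
    by (auto simp: indicator_def)
  then have "integrable lborel (\<lambda>x. (indicator U x :: real)\<^sup>2)"
    using finite_measure_U by (simp add: integrable_real_indicator)
  then have "integrable lborel (\<lambda>x. f x * indicator U x)"
    by (intro integrable_mult_square_integrable assms) measurable
  moreover have "f x * indicator U x = f x" for x
    using assms(2)[of x] by (cases "x \<in> U") auto
  ultimately show ?thesis by (simp only:)
qed

lemma integrable_v: "integrable lborel v"
  by (rule integrable_if_vanishes_outside[OF measurable_v v_outside square_integrable_v])

lemma integrable_v_mult_test: "\<phi> \<in> test_functions S \<Longrightarrow> integrable lborel (\<lambda>x. v x * \<phi> x)"
  and integrable_g1_mult_test: "\<phi> \<in> test_functions S \<Longrightarrow> integrable lborel (\<lambda>x. g1 x * \<phi> x)"
  and integrable_g2_mult_test: "\<phi> \<in> test_functions S \<Longrightarrow> integrable lborel (\<lambda>x. g2 x * \<phi> x)"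
  using test_functions_measurable[of \<phi> S] test_functions_square_integrable[of \<phi> S]
  by (auto intro!: integrable_mult_square_integrable square_integrable_v square_integrable_g)

lemma measurable_mollified [measurable]:
  assumes [measurable]: "\<rho> \<in> borel_measurable borel"
  shows "mollified \<rho> \<in> borel_measurable borel"
  unfolding mollified_def by measurable

text \<open>The translated mollifiers along the segment are test functions in \<open>U\<close>, because the segment stays away from the
  boundary. The definition of a weak derivative therefore moves the derivative along the segment from \<open>\<rho>\<close> to \<open>v\<close>, and
  Fubini's theorem exchanges the integrals over the segment and over the plane.\<close>

lemma mollified_difference:
  assumes \<rho>: "mollifier r \<rho>"
    and inside: "\<And>t z. 0 \<le> t \<Longrightarrow> t \<le> 1 \<Longrightarrow> norm z \<le> r \<Longrightarrow> p + t *\<^sub>R d + z \<in> U"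
  shows "mollified \<rho> (p + d) - mollified \<rho> p =
    (\<integral>t. (\<integral>x. (d $ 1 * g1 x + d $ 2 * g2 x) * \<rho> (x - (p + t *\<^sub>R d)) \<partial>lborel) * indicator {0..1} t \<partial>lborel)"
proof -
  note [measurable] = mollifierD(7)[OF \<rho>]
  have \<rho>i: "partial i \<rho> \<in> test_functions UNIV" for i
    using mollifierD(1)[OF \<rho>] by (rule partial_in_test_functions)
  have [measurable]: "partial i \<rho> \<in> borel_measurable borel" for i
    using \<rho>i by (rule test_functions_measurable)
  define D where "D x t = d $ 1 * partial 1 \<rho> (x - (p + t *\<^sub>R d)) + d $ 2 * partial 2 \<rho> (x - (p + t *\<^sub>R d))" for x t
  have D_measurable [measurable]: "(\<lambda>p. D (fst p) (snd p)) \<in> borel_measurable (lborel \<Otimes>\<^sub>M lborel)"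
    unfolding D_def by measurable
  obtain B1 B2 where B: "\<And>x. \<bar>partial 1 \<rho> x\<bar> \<le> B1" "\<And>x. \<bar>partial 2 \<rho> x\<bar> \<le> B2"
    using test_functions_bounded[OF \<rho>i[of 1]] test_functions_bounded[OF \<rho>i[of 2]] by metis
  define B where "B = \<bar>d $ 1\<bar> * B1 + \<bar>d $ 2\<bar> * B2"
  have D_bound: "\<bar>D x t\<bar> \<le> B" for x t
  proof -
    have "\<bar>D x t\<bar> \<le> \<bar>d $ 1\<bar> * \<bar>partial 1 \<rho> (x - (p + t *\<^sub>R d))\<bar> + \<bar>d $ 2\<bar> * \<bar>partial 2 \<rho> (x - (p + t *\<^sub>R d))\<bar>"
      unfolding D_def by (rule order_trans[OF abs_triangle_ineq]) (simp add: abs_mult)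
    also have "\<dots> \<le> B"
      unfolding B_def by (intro add_mono mult_left_mono B) auto
    finally show ?thesis .
  qed
  have line: "(\<integral>t. - D x t * indicator {0..1} t \<partial>lborel) = \<rho> (x - (p + d)) - \<rho> (x - p)" for x
  proof -
    have arg: "x - (p + t *\<^sub>R d) = (x - p) + t *\<^sub>R (- d)" for t by simp
    have "(\<integral>t. - D x t * indicator {0..1} t \<partial>lborel) = \<rho> (x - (p + 1 *\<^sub>R d)) - \<rho> (x - (p + 0 *\<^sub>R d))"
    proof (rule integral_FTC_Icc_real)
      show "DERIV (\<lambda>t. \<rho> (x - (p + t *\<^sub>R d))) t :> - D x t" for t
        using has_real_derivative_along_line[of \<rho> "x - p" t "- d" UNIV]
          test_functions_differentiable[OF mollifierD(1)[OF \<rho>]]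
        unfolding D_def arg by (simp add: algebra_simps)
      have "continuous_on UNIV (\<lambda>t. - D x t)"
      proof -
        have "continuous_on UNIV (\<lambda>t. partial i \<rho> (x - (p + t *\<^sub>R d)))" for i
          by (rule continuous_on_compose2[OF test_functions_continuous[OF \<rho>i, of UNIV]])
             (auto intro!: continuous_intros)
        then show ?thesis
          unfolding D_def by (intro continuous_intros)
      qed
      then show "isCont (\<lambda>t. - D x t) t" for t
        by (simp add: continuous_on_eq_continuous_at)
    qed simp
    then show ?thesis by simp
  qed
  have test: "(\<lambda>x. \<rho> (x - (p + t *\<^sub>R d))) \<in> test_functions U" if "t \<in> {0..1}" for t
    using mollifierD(1)[OF \<rho>] that inside mollifierD(5)[OF \<rho>]
    by (intro test_functions_translate) auto
  have inner: "(\<integral>x. v x * - D x t \<partial>lborel)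
      = (\<integral>x. (d $ 1 * g1 x + d $ 2 * g2 x) * \<rho> (x - (p + t *\<^sub>R d)) \<partial>lborel)" if t: "t \<in> {0..1}" for t
  proof -
    let ?\<phi> = "\<lambda>x. \<rho> (x - (p + t *\<^sub>R d))"
    have part: "partial i ?\<phi> = (\<lambda>x. partial i \<rho> (x - (p + t *\<^sub>R d)))" for i
      using test_functions_differentiable[OF mollifierD(1)[OF \<rho>]] by (auto simp: partial_translate)
    have vi: "integrable lborel (\<lambda>x. v x * partial i ?\<phi> x)" for i
      using partial_in_test_functions[OF test[OF t]] by (rule integrable_v_mult_test)
    have "(\<integral>x. v x * - D x t \<partial>lborel)
        = (\<integral>x. - (d $ 1) * (v x * partial 1 ?\<phi> x) + - (d $ 2) * (v x * partial 2 ?\<phi> x) \<partial>lborel)"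
      unfolding part D_def by (simp add: algebra_simps)
    also have "\<dots> = d $ 1 * (\<integral>x. g1 x * ?\<phi> x \<partial>lborel) + d $ 2 * (\<integral>x. g2 x * ?\<phi> x \<partial>lborel)"
      using vi weak_partials[OF test[OF t]] by simp
    also have "\<dots> = (\<integral>x. d $ 1 * (g1 x * ?\<phi> x) + d $ 2 * (g2 x * ?\<phi> x) \<partial>lborel)"
      using integrable_g1_mult_test[OF test[OF t]] integrable_g2_mult_test[OF test[OF t]] by simp
    finally show ?thesis by (simp add: algebra_simps)
  qed
  have int_prod: "integrable (lborel \<Otimes>\<^sub>M lborel) (\<lambda>(x, t). v x * (- D x t * indicator {0..1} t))"
  proof (rule Bochner_Integration.integrable_bound)
    show "integrable (lborel \<Otimes>\<^sub>M lborel) (\<lambda>(x, t). B * (v x * indicator {0..1::real} t))"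
    proof (rule lborel_pair.Fubini_integrable)
      have "(\<integral>t. norm (B * (v x * indicator {0..1::real} t)) \<partial>lborel) = \<bar>B\<bar> * \<bar>v x\<bar>" for x
        by (simp add: abs_mult)
      then show "integrable lborel (\<lambda>x. \<integral>t. norm (case (x, t) of (x, t) \<Rightarrow> B * (v x * indicator {0..1::real} t)) \<partial>lborel)"
        using integrable_v by simp
    qed (auto simp: integrable_real_indicator)
    have "\<bar>v x\<bar> * \<bar>D x t\<bar> \<le> \<bar>B\<bar> * \<bar>v x\<bar>" for x t
      using mult_right_mono[OF order_trans[OF D_bound[of x t] abs_ge_self] abs_ge_zero[of "v x"]]
      by (simp add: mult.commute)
    then show "AE x in lborel \<Otimes>\<^sub>M lborel. norm (case x of (x, t) \<Rightarrow> v x * (- D x t * indicator {0..1} t))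
        \<le> norm (case x of (x, t) \<Rightarrow> B * (v x * indicator {0..1::real} t))"
      by (intro AE_I2) (auto simp: abs_mult indicator_def)
  qed measurable
  have v\<rho>: "integrable lborel (\<lambda>x. v x * \<rho> (x - p))" for p
    using test_functions_translate[OF mollifierD(1)[OF \<rho>], of p UNIV] by (intro integrable_v_mult_test) auto
  have "mollified \<rho> (p + d) - mollified \<rho> p = (\<integral>x. v x * (\<rho> (x - (p + d)) - \<rho> (x - p)) \<partial>lborel)"
    using v\<rho> by (simp add: mollified_def right_diff_distrib)
  also have "\<dots> = (\<integral>x. (\<integral>t. v x * (- D x t * indicator {0..1} t) \<partial>lborel) \<partial>lborel)"
    by (simp only: line[symmetric]) simp
  also have "\<dots> = (\<integral>t. (\<integral>x. v x * (- D x t * indicator {0..1} t) \<partial>lborel) \<partial>lborel)"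
    by (rule lborel_pair.Fubini_integral[symmetric, OF int_prod])
  also have "\<dots> = (\<integral>t. (\<integral>x. v x * - D x t \<partial>lborel) * indicator {0..1} t \<partial>lborel)"
    by (simp add: mult.assoc[symmetric])
  also have "\<dots> = (\<integral>t. (\<integral>x. (d $ 1 * g1 x + d $ 2 * g2 x) * \<rho> (x - (p + t *\<^sub>R d)) \<partial>lborel) * indicator {0..1} t \<partial>lborel)"
    using inner by (intro Bochner_Integration.integral_cong) (auto simp: indicator_def)
  finally show ?thesis .
qed

text \<open>Both integrals of the preceding formula are averages, one with the density \<open>\<rho>\<close> and one over the unit interval,
  and the square of an average is at most the average of the squares.\<close>

lemma mollified_difference_square_le:
  assumes \<rho>: "mollifier r \<rho>"
    and inside: "\<And>t z. 0 \<le> t \<Longrightarrow> t \<le> 1 \<Longrightarrow> norm z \<le> r \<Longrightarrow> p + t *\<^sub>R d + z \<in> U"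
  shows "ennreal ((mollified \<rho> (p + d) - mollified \<rho> p)\<^sup>2) \<le> ennreal ((norm d)\<^sup>2) *
    (\<integral>\<^sup>+t. (\<integral>\<^sup>+z. ennreal (G (p + t *\<^sub>R d + z)) * ennreal (\<rho> z) \<partial>lborel) * indicator {0..1} t \<partial>lborel)"
proof -
  note [measurable] = mollifierD(7)[OF \<rho>]
  define f where "f x = d $ 1 * g1 x + d $ 2 * g2 x" for x
  have [measurable]: "f \<in> borel_measurable borel" unfolding f_def by measurable
  define I where "I t = (\<integral>\<^sup>+z. ennreal \<bar>f (p + t *\<^sub>R d + z)\<bar> * ennreal (\<rho> z) \<partial>lborel)" for t
  have [measurable]: "I \<in> borel_measurable borel" unfolding I_def by measurable
  have inner: "ennreal \<bar>(\<integral>x. f x * \<rho> (x - (p + t *\<^sub>R d)) \<partial>lborel)\<bar> \<le> I t" for t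
  proof -
    have "ennreal \<bar>(\<integral>x. f x * \<rho> (x - (p + t *\<^sub>R d)) \<partial>lborel)\<bar>
        \<le> (\<integral>\<^sup>+x. ennreal \<bar>f x * \<rho> (x - (p + t *\<^sub>R d))\<bar> \<partial>lborel)"
      by (rule ennreal_abs_integral_le)
    also have "\<dots> = (\<integral>\<^sup>+z. ennreal \<bar>f (p + t *\<^sub>R d + z) * \<rho> z\<bar> \<partial>lborel)"
      by (subst nn_integral_translate[of _ "p + t *\<^sub>R d", symmetric]) auto
    also have "\<dots> = I t"
      using mollifierD(2)[OF \<rho>] by (simp add: I_def abs_mult ennreal_mult)
    finally show ?thesis .
  qed
  have f2: "(ennreal \<bar>f x\<bar>)\<^sup>2 \<le> ennreal ((norm d)\<^sup>2) * ennreal (G x)" for x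
  proof -
    have "(norm d)\<^sup>2 = (d $ 1)\<^sup>2 + (d $ 2)\<^sup>2"
      unfolding power2_norm_eq_inner by (simp add: inner_vec_def sum_2 power2_eq_square)
    moreover have "(f x)\<^sup>2 + (d $ 1 * g2 x - d $ 2 * g1 x)\<^sup>2 = ((d $ 1)\<^sup>2 + (d $ 2)\<^sup>2) * G x"
      by (simp add: f_def G_def power2_eq_square algebra_simps)
    ultimately have "(f x)\<^sup>2 \<le> (norm d)\<^sup>2 * G x"
      by (metis le_add_same_cancel1 zero_le_power2)
    then have "ennreal ((f x)\<^sup>2) \<le> ennreal ((norm d)\<^sup>2 * G x)" by (rule ennreal_leI)
    then show ?thesis by (simp add: ennreal_power ennreal_mult G_nonneg)
  qed
  have I2: "(I t)\<^sup>2 \<le> ennreal ((norm d)\<^sup>2) * (\<integral>\<^sup>+z. ennreal (G (p + t *\<^sub>R d + z)) * ennreal (\<rho> z) \<partial>lborel)" for t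
  proof -
    have "(I t)\<^sup>2 \<le> (\<integral>\<^sup>+z. (ennreal \<bar>f (p + t *\<^sub>R d + z)\<bar>)\<^sup>2 * ennreal (\<rho> z) \<partial>lborel)"
      unfolding I_def using mollifierD[OF \<rho>] by (intro nn_integral_weighted_square_le) auto
    also have "\<dots> \<le> (\<integral>\<^sup>+z. ennreal ((norm d)\<^sup>2) * (ennreal (G (p + t *\<^sub>R d + z)) * ennreal (\<rho> z)) \<partial>lborel)"
      using f2 by (intro nn_integral_mono) (simp add: mult.assoc[symmetric] mult_right_mono)
    also have "\<dots> = ennreal ((norm d)\<^sup>2) * (\<integral>\<^sup>+z. ennreal (G (p + t *\<^sub>R d + z)) * ennreal (\<rho> z) \<partial>lborel)"
      by (intro nn_integral_cmult) measurable
    finally show ?thesis .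
  qed
  have diff: "mollified \<rho> (p + d) - mollified \<rho> p
      = (\<integral>t. (\<integral>x. f x * \<rho> (x - (p + t *\<^sub>R d)) \<partial>lborel) * indicator {0..1} t \<partial>lborel)"
    unfolding f_def by (rule mollified_difference[OF \<rho> inside])
  have "ennreal \<bar>mollified \<rho> (p + d) - mollified \<rho> p\<bar>
      \<le> (\<integral>\<^sup>+t. ennreal \<bar>(\<integral>x. f x * \<rho> (x - (p + t *\<^sub>R d)) \<partial>lborel) * indicator {0..1} t\<bar> \<partial>lborel)"
    unfolding diff by (rule ennreal_abs_integral_le)
  also have "\<dots> \<le> (\<integral>\<^sup>+t. I t * ennreal (indicator {0..1} t) \<partial>lborel)"
    using inner by (intro nn_integral_mono) (auto simp: indicator_def)
  finally have "(ennreal \<bar>mollified \<rho> (p + d) - mollified \<rho> p\<bar>)\<^sup>2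
      \<le> (\<integral>\<^sup>+t. I t * ennreal (indicator {0..1} t) \<partial>lborel)\<^sup>2"
    by (intro power_mono) auto
  also have "\<dots> \<le> (\<integral>\<^sup>+t. (I t)\<^sup>2 * ennreal (indicator {0..1::real} t) \<partial>lborel)"
    by (intro nn_integral_weighted_square_le) (auto simp: ennreal_indicator)
  also have "\<dots> \<le> (\<integral>\<^sup>+t. ennreal ((norm d)\<^sup>2) *
      ((\<integral>\<^sup>+z. ennreal (G (p + t *\<^sub>R d + z)) * ennreal (\<rho> z) \<partial>lborel) * indicator {0..1} t) \<partial>lborel)"
    using I2 by (intro nn_integral_mono) (auto simp: indicator_def)
  also have "\<dots> = ennreal ((norm d)\<^sup>2) *
    (\<integral>\<^sup>+t. (\<integral>\<^sup>+z. ennreal (G (p + t *\<^sub>R d + z)) * ennreal (\<rho> z) \<partial>lborel) * indicator {0..1} t \<partial>lborel)"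
    by (intro nn_integral_cmult) measurable
  finally show ?thesis by (simp add: ennreal_power)
qed

end

section \<open>The Poincare inequality on convex domains\<close>

lemma Cauchy_Schwarz_iterated:
  fixes F H :: "'a::euclidean_space \<Rightarrow> 'b::euclidean_space \<Rightarrow> ennreal"
  assumes [measurable]: "(\<lambda>(x, y). F x y) \<in> borel_measurable (lborel \<Otimes>\<^sub>M lborel)"
    "(\<lambda>(x, y). H x y) \<in> borel_measurable (lborel \<Otimes>\<^sub>M lborel)"
  shows "(\<integral>\<^sup>+x. (\<integral>\<^sup>+y. F x y * H x y \<partial>lborel) \<partial>lborel)\<^sup>2
    \<le> (\<integral>\<^sup>+x. (\<integral>\<^sup>+y. (F x y)\<^sup>2 \<partial>lborel) \<partial>lborel) * (\<integral>\<^sup>+x. (\<integral>\<^sup>+y. (H x y)\<^sup>2 \<partial>lborel) \<partial>lborel)"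
proof -
  have pair: "(\<integral>\<^sup>+x. (\<integral>\<^sup>+y. E x y \<partial>lborel) \<partial>lborel) = (\<integral>\<^sup>+p. (case p of (x, y) \<Rightarrow> E x y) \<partial>(lborel \<Otimes>\<^sub>M lborel))"
    if "(\<lambda>(x, y). E x y) \<in> borel_measurable (lborel \<Otimes>\<^sub>M lborel)" for E :: "'a \<Rightarrow> 'b \<Rightarrow> ennreal"
    using lborel.nn_integral_fst[OF that] by simp
  have "(\<integral>\<^sup>+p. (case p of (x, y) \<Rightarrow> F x y * H x y) \<partial>(lborel \<Otimes>\<^sub>M lborel))\<^sup>2
      = (\<integral>\<^sup>+p. (case p of (x, y) \<Rightarrow> F x y) * (case p of (x, y) \<Rightarrow> H x y) \<partial>(lborel \<Otimes>\<^sub>M lborel))\<^sup>2"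
    by (simp add: case_prod_unfold)
  also have "\<dots> \<le> (\<integral>\<^sup>+p. (case p of (x, y) \<Rightarrow> F x y)\<^sup>2 \<partial>(lborel \<Otimes>\<^sub>M lborel))
      * (\<integral>\<^sup>+p. (case p of (x, y) \<Rightarrow> H x y)\<^sup>2 \<partial>(lborel \<Otimes>\<^sub>M lborel))"
    by (rule Cauchy_Schwarz_nn_integral) measurable
  also have "\<dots> = (\<integral>\<^sup>+p. (case p of (x, y) \<Rightarrow> (F x y)\<^sup>2) \<partial>(lborel \<Otimes>\<^sub>M lborel))
      * (\<integral>\<^sup>+p. (case p of (x, y) \<Rightarrow> (H x y)\<^sup>2) \<partial>(lborel \<Otimes>\<^sub>M lborel))"
    by (simp add: case_prod_unfold)
  finally show ?thesis
    by (subst (1 2 3) pair) measurable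
qed

context weak_gradient
begin

text \<open>The bound of the squared difference by an average over the segment is integrated over all pairs of end points. The
  points \<open>y + t (x - y) + z\<close> depend on \<open>x\<close> with the factor \<open>t\<close> and on \<open>y\<close> with the factor \<open>1 - t\<close>; for fixed \<open>t\<close> and \<open>z\<close>
  the variable with the larger factor is substituted, and the other one contributes the measure of \<open>A\<close>.\<close>

lemma mollified_oscillation:
  assumes \<rho>: "mollifier r \<rho>" and A [measurable]: "A \<in> sets borel" and "convex A"
    and diam: "\<And>x y. x \<in> A \<Longrightarrow> y \<in> A \<Longrightarrow> norm (x - y) \<le> h"
    and inside: "\<And>x z. x \<in> A \<Longrightarrow> norm z \<le> r \<Longrightarrow> x + z \<in> U"
  shows "(\<integral>\<^sup>+x. (\<integral>\<^sup>+y. indicator A x * indicator A y * ennreal ((mollified \<rho> x - mollified \<rho> y)\<^sup>2) \<partial>lborel) \<partial>lborel)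
    \<le> ennreal (h\<^sup>2) * (4 * ennreal energy * emeasure lborel A)"
proof -
  note [measurable] = mollifierD(7)[OF \<rho>]
  define W where "W x y t z = indicator A x * indicator A y * ennreal (G (y + t *\<^sub>R (x - y) + z)) * ennreal (\<rho> z)
      * indicator {0..1} t" for x y t z
  have pointwise: "indicator A x * indicator A y * ennreal ((mollified \<rho> x - mollified \<rho> y)\<^sup>2)
      \<le> ennreal (h\<^sup>2) * (\<integral>\<^sup>+t. (\<integral>\<^sup>+z. W x y t z \<partial>lborel) \<partial>lborel)" for x y
  proof (cases "x \<in> A \<and> y \<in> A")
    case True
    have "y + t *\<^sub>R (x - y) + z \<in> U" if "0 \<le> t" "t \<le> 1" "norm z \<le> r" for t z
    proof (rule inside[OF _ that(3)])
      have "y + t *\<^sub>R (x - y) = (1 - t) *\<^sub>R y + t *\<^sub>R x" by (simp add: algebra_simps)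
      also have "\<dots> \<in> A" using True that by (intro convexD[OF \<open>convex A\<close>]) auto
      finally show "y + t *\<^sub>R (x - y) \<in> A" .
    qed
    from mollified_difference_square_le[OF \<rho>, of y "x - y", OF this]
    have "ennreal ((mollified \<rho> x - mollified \<rho> y)\<^sup>2) \<le> ennreal ((norm (x - y))\<^sup>2) *
        (\<integral>\<^sup>+t. (\<integral>\<^sup>+z. ennreal (G (y + t *\<^sub>R (x - y) + z)) * ennreal (\<rho> z) \<partial>lborel) * indicator {0..1} t \<partial>lborel)"
      by simp
    also have "\<dots> \<le> ennreal (h\<^sup>2) *
        (\<integral>\<^sup>+t. (\<integral>\<^sup>+z. ennreal (G (y + t *\<^sub>R (x - y) + z)) * ennreal (\<rho> z) \<partial>lborel) * indicator {0..1} t \<partial>lborel)"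
      using diam True by (intro mult_right_mono ennreal_leI power_mono) auto
    also have "\<dots> = ennreal (h\<^sup>2) * (\<integral>\<^sup>+t. (\<integral>\<^sup>+z. W x y t z \<partial>lborel) \<partial>lborel)"
      using True by (simp add: W_def nn_integral_multc)
    finally show ?thesis using True by simp
  qed auto
  have slice: "(\<integral>\<^sup>+x. (\<integral>\<^sup>+y. W x y t z \<partial>lborel) \<partial>lborel)
      \<le> 4 * ennreal energy * emeasure lborel A * (ennreal (\<rho> z) * indicator {0..1} t)" for t z
  proof -
    \<comment> \<open>the variable \<open>y\<close>, which has the factor \<open>1 - s \<ge> 1/2\<close>, is substituted\<close>
    have half: "(\<integral>\<^sup>+x. (\<integral>\<^sup>+y. indicator A x * ennreal (G ((s *\<^sub>R x + z) + (1 - s) *\<^sub>R y)) \<partial>lborel) \<partial>lborel)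
        \<le> 4 * ennreal energy * emeasure lborel A" if "s \<le> 1 / 2" for s
    proof -
      have "(\<integral>\<^sup>+y. ennreal (G ((s *\<^sub>R x + z) + (1 - s) *\<^sub>R y)) \<partial>lborel) \<le> 4 * ennreal energy" for x
        using nn_integral_dilate[of "\<lambda>x. ennreal (G x)" "1 - s" "s *\<^sub>R x + z"] that by (simp add: nn_integral_G)
      then have "(\<integral>\<^sup>+x. indicator A x * (\<integral>\<^sup>+y. ennreal (G ((s *\<^sub>R x + z) + (1 - s) *\<^sub>R y)) \<partial>lborel) \<partial>lborel)
          \<le> (\<integral>\<^sup>+x. indicator A x * (4 * ennreal energy) \<partial>lborel)"
        by (intro nn_integral_mono mult_left_mono) auto
      also have "\<dots> = 4 * ennreal energy * emeasure lborel A"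
        by (simp add: nn_integral_multc mult.commute)
      finally show ?thesis by (simp add: nn_integral_cmult)
    qed
    consider "t \<notin> {0..1}" | "t \<in> {0..1}" "t \<le> 1 / 2" | "t \<in> {0..1}" "1 - t \<le> 1 / 2" by fastforce
    then show ?thesis
    proof cases
      case 1
      then show ?thesis by (simp add: W_def)
    next
      case 2
      have "W x y t z \<le> indicator A x * ennreal (G ((t *\<^sub>R x + z) + (1 - t) *\<^sub>R y)) * ennreal (\<rho> z)" for x y
      proof -
        have eq: "y + t *\<^sub>R (x - y) + z = (t *\<^sub>R x + z) + (1 - t) *\<^sub>R y" by (simp add: algebra_simps)
        show ?thesis unfolding W_def eq using 2 by (auto simp: indicator_def)
      qed
      then have "(\<integral>\<^sup>+x. (\<integral>\<^sup>+y. W x y t z \<partial>lborel) \<partial>lborel) \<le> (\<integral>\<^sup>+x. (\<integral>\<^sup>+y.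
          indicator A x * ennreal (G ((t *\<^sub>R x + z) + (1 - t) *\<^sub>R y)) * ennreal (\<rho> z) \<partial>lborel) \<partial>lborel)"
        by (intro nn_integral_mono)
      also have "\<dots> = (\<integral>\<^sup>+x. (\<integral>\<^sup>+y. indicator A x * ennreal (G ((t *\<^sub>R x + z) + (1 - t) *\<^sub>R y)) \<partial>lborel) \<partial>lborel) * ennreal (\<rho> z)"
        by (simp add: nn_integral_multc)
      also have "\<dots> \<le> 4 * ennreal energy * emeasure lborel A * ennreal (\<rho> z)"
        by (intro mult_right_mono half 2) simp
      finally show ?thesis using 2 by simp
    next
      case 3
      have "W x y t z \<le> indicator A y * ennreal (G (((1 - t) *\<^sub>R y + z) + (1 - (1 - t)) *\<^sub>R x)) * ennreal (\<rho> z)" for x y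
      proof -
        have eq: "y + t *\<^sub>R (x - y) + z = ((1 - t) *\<^sub>R y + z) + (1 - (1 - t)) *\<^sub>R x" by (simp add: algebra_simps)
        show ?thesis unfolding W_def eq using 3 by (auto simp: indicator_def)
      qed
      then have "(\<integral>\<^sup>+x. (\<integral>\<^sup>+y. W x y t z \<partial>lborel) \<partial>lborel) \<le> (\<integral>\<^sup>+x. (\<integral>\<^sup>+y.
          indicator A y * ennreal (G (((1 - t) *\<^sub>R y + z) + (1 - (1 - t)) *\<^sub>R x)) * ennreal (\<rho> z) \<partial>lborel) \<partial>lborel)"
        by (intro nn_integral_mono)
      also have "\<dots> = (\<integral>\<^sup>+y. (\<integral>\<^sup>+x.
          indicator A y * ennreal (G (((1 - t) *\<^sub>R y + z) + (1 - (1 - t)) *\<^sub>R x)) * ennreal (\<rho> z) \<partial>lborel) \<partial>lborel)"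
        by (rule nn_integral_swap) measurable
      also have "\<dots> = (\<integral>\<^sup>+y. (\<integral>\<^sup>+x. indicator A y * ennreal (G (((1 - t) *\<^sub>R y + z) + (1 - (1 - t)) *\<^sub>R x)) \<partial>lborel) \<partial>lborel) * ennreal (\<rho> z)"
        by (simp add: nn_integral_multc del: diff_diff_eq2)
      also have "\<dots> \<le> 4 * ennreal energy * emeasure lborel A * ennreal (\<rho> z)"
        by (intro mult_right_mono half 3) simp
      finally show ?thesis using 3 by simp
    qed
  qed
  have [measurable]: "(\<lambda>p. W (fst p) (fst (snd p)) (fst (snd (snd p))) (snd (snd (snd p))))
      \<in> borel_measurable (lborel \<Otimes>\<^sub>M (lborel \<Otimes>\<^sub>M (lborel \<Otimes>\<^sub>M lborel)))"
    unfolding W_def by measurable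
  have "(\<integral>\<^sup>+x. (\<integral>\<^sup>+y. indicator A x * indicator A y * ennreal ((mollified \<rho> x - mollified \<rho> y)\<^sup>2) \<partial>lborel) \<partial>lborel)
      \<le> (\<integral>\<^sup>+x. (\<integral>\<^sup>+y. ennreal (h\<^sup>2) * (\<integral>\<^sup>+t. (\<integral>\<^sup>+z. W x y t z \<partial>lborel) \<partial>lborel) \<partial>lborel) \<partial>lborel)"
    by (intro nn_integral_mono pointwise)
  also have "\<dots> = ennreal (h\<^sup>2) * (\<integral>\<^sup>+x. (\<integral>\<^sup>+y. (\<integral>\<^sup>+t. (\<integral>\<^sup>+z. W x y t z \<partial>lborel) \<partial>lborel) \<partial>lborel) \<partial>lborel)"
    unfolding W_def by (simp add: nn_integral_cmult)
  also have "(\<integral>\<^sup>+x. (\<integral>\<^sup>+y. (\<integral>\<^sup>+t. (\<integral>\<^sup>+z. W x y t z \<partial>lborel) \<partial>lborel) \<partial>lborel) \<partial>lborel)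
      = (\<integral>\<^sup>+x. (\<integral>\<^sup>+t. (\<integral>\<^sup>+y. (\<integral>\<^sup>+z. W x y t z \<partial>lborel) \<partial>lborel) \<partial>lborel) \<partial>lborel)"
    unfolding W_def by (intro nn_integral_cong nn_integral_swap) measurable
  also have "\<dots> = (\<integral>\<^sup>+t. (\<integral>\<^sup>+x. (\<integral>\<^sup>+y. (\<integral>\<^sup>+z. W x y t z \<partial>lborel) \<partial>lborel) \<partial>lborel) \<partial>lborel)"
    unfolding W_def by (intro nn_integral_swap) measurable
  also have "\<dots> = (\<integral>\<^sup>+t. (\<integral>\<^sup>+x. (\<integral>\<^sup>+z. (\<integral>\<^sup>+y. W x y t z \<partial>lborel) \<partial>lborel) \<partial>lborel) \<partial>lborel)"
    unfolding W_def by (intro nn_integral_cong nn_integral_swap) measurable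
  also have "\<dots> = (\<integral>\<^sup>+t. (\<integral>\<^sup>+z. (\<integral>\<^sup>+x. (\<integral>\<^sup>+y. W x y t z \<partial>lborel) \<partial>lborel) \<partial>lborel) \<partial>lborel)"
    unfolding W_def by (intro nn_integral_cong nn_integral_swap) measurable
  also have "\<dots> \<le> (\<integral>\<^sup>+t. (\<integral>\<^sup>+z. 4 * ennreal energy * emeasure lborel A * (ennreal (\<rho> z) * indicator {0..1::real} t) \<partial>lborel) \<partial>lborel)"
    by (intro nn_integral_mono slice)
  also have "\<dots> = 4 * ennreal energy * emeasure lborel A"
    using mollifierD(9)[OF \<rho>] by (simp add: nn_integral_cmult nn_integral_multc)
  finally show ?thesis by (simp add: mult_left_mono)
qed

lemma mollified_bounded:
  assumes \<rho>: "mollifier r \<rho>"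
  obtains B where "\<And>p. \<bar>mollified \<rho> p\<bar> \<le> B"
proof -
  note [measurable] = mollifierD(7)[OF \<rho>]
  obtain C where C: "\<And>x. \<bar>\<rho> x\<bar> \<le> C"
    using test_functions_bounded[OF mollifierD(1)[OF \<rho>]] by metis
  have int: "integrable lborel (\<lambda>x. v x * \<rho> (x - p))" for p
    using test_functions_translate[OF mollifierD(1)[OF \<rho>], of p UNIV] by (intro integrable_v_mult_test) auto
  show ?thesis
  proof (rule that)
    fix p
    have "\<bar>mollified \<rho> p\<bar> \<le> (\<integral>x. \<bar>v x * \<rho> (x - p)\<bar> \<partial>lborel)"
      unfolding mollified_def by (rule integral_abs_bound)
    also have "\<dots> \<le> (\<integral>x. C * \<bar>v x\<bar> \<partial>lborel)"
    proof (rule integral_mono)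
      show "\<bar>v x * \<rho> (x - p)\<bar> \<le> C * \<bar>v x\<bar>" for x
        using mult_left_mono[OF C[of "x - p"] abs_ge_zero[of "v x"]] by (simp add: abs_mult mult.commute)
    qed (use int integrable_v in auto)
    finally show "\<bar>mollified \<rho> p\<bar> \<le> (\<integral>x. C * \<bar>v x\<bar> \<partial>lborel)" .
  qed
qed

lemma integrable_mollified_mult_test:
  assumes \<rho>: "mollifier r \<rho>" and \<phi>: "\<phi> \<in> test_functions S"
  shows "integrable lborel (\<lambda>p. mollified \<rho> p * \<phi> p)"
proof -
  note [measurable] = mollifierD(7)[OF \<rho>] test_functions_measurable[OF \<phi>]
  obtain B where B: "\<And>p. \<bar>mollified \<rho> p\<bar> \<le> B" using mollified_bounded[OF \<rho>] by metis
  show ?thesis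
  proof (rule Bochner_Integration.integrable_bound)
    show "integrable lborel (\<lambda>p. B * \<phi> p)"
      using test_functions_integrable[OF \<phi>] by simp
    have "\<bar>mollified \<rho> p\<bar> * \<bar>\<phi> p\<bar> \<le> \<bar>B\<bar> * \<bar>\<phi> p\<bar>" for p
      by (intro mult_right_mono order_trans[OF B abs_ge_self]) simp
    then show "AE p in lborel. norm (mollified \<rho> p * \<phi> p) \<le> norm (B * \<phi> p)"
      by (simp add: abs_mult)
  qed measurable
qed

text \<open>By symmetry the mollifiers act on the continuous function \<open>\<phi>\<close> instead of \<open>v\<close>, so that dominated convergence
  applies.\<close>

lemma mollified_tested_tendsto:
  assumes \<rho>: "\<And>n. mollifier (r n) (\<rho> n)" and r: "r \<longlonglongrightarrow> 0" and \<phi>: "\<phi> \<in> test_functions S"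
  shows "(\<lambda>n. \<integral>p. mollified (\<rho> n) p * \<phi> p \<partial>lborel) \<longlonglongrightarrow> (\<integral>x. v x * \<phi> x \<partial>lborel)"
proof -
  note [measurable] = mollifierD(7)[OF \<rho>] test_functions_measurable[OF \<phi>]
  obtain B where B: "\<And>x. \<bar>\<phi> x\<bar> \<le> B" using test_functions_bounded[OF \<phi>] by metis
  define \<Phi> where "\<Phi> n x = (\<integral>p. \<phi> p * \<rho> n (p - x) \<partial>lborel)" for n x
  have [measurable]: "\<Phi> n \<in> borel_measurable borel" for n unfolding \<Phi>_def by measurable
  have \<Phi>_bound: "\<bar>\<Phi> n x\<bar> \<le> B" for n x
  proof -
    have int: "integrable lborel (\<lambda>p. \<rho> n (p - x))"
      by (intro integral_translate mollifierD[OF \<rho>])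
    have pointwise: "\<bar>\<phi> p * \<rho> n (p - x)\<bar> \<le> B * \<rho> n (p - x)" for p
      using mult_right_mono[OF B[of p] mollifierD(2)[OF \<rho>, of n "p - x"]] mollifierD(2)[OF \<rho>, of n "p - x"]
      by (simp add: abs_mult)
    have "\<bar>\<Phi> n x\<bar> \<le> (\<integral>p. \<bar>\<phi> p * \<rho> n (p - x)\<bar> \<partial>lborel)"
      unfolding \<Phi>_def by (rule integral_abs_bound)
    also have "\<dots> \<le> (\<integral>p. B * \<rho> n (p - x) \<partial>lborel)"
    proof (rule integral_mono)
      show "integrable lborel (\<lambda>p. \<bar>\<phi> p * \<rho> n (p - x)\<bar>)"
        by (rule Bochner_Integration.integrable_bound[OF integrable_mult_right[OF int, of B]])
           (use pointwise in \<open>auto intro!: AE_I2 intro: order_trans[OF _ abs_ge_self]\<close>)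
    qed (use int pointwise in auto)
    also have "\<dots> = B" using mollifierD(3)[OF \<rho>] by (simp add: integral_translate)
    finally show ?thesis .
  qed
  have "(\<integral>p. mollified (\<rho> n) p * \<phi> p \<partial>lborel) = (\<integral>x. v x * \<Phi> n x \<partial>lborel)" for n
  proof -
    obtain C where C: "\<And>x. \<bar>\<rho> n x\<bar> \<le> C"
      using test_functions_bounded[OF mollifierD(1)[OF \<rho>]] by metis
    have int: "integrable (lborel \<Otimes>\<^sub>M lborel) (\<lambda>(x, p). v x * (\<phi> p * \<rho> n (x - p)))"
    proof (rule Bochner_Integration.integrable_bound)
      show "integrable (lborel \<Otimes>\<^sub>M lborel) (\<lambda>(x, p). C * (v x * \<phi> p))"
      proof (rule lborel_pair.Fubini_integrable)
        have "(\<integral>p. norm (C * (v x * \<phi> p)) \<partial>lborel) = \<bar>C\<bar> * \<bar>v x\<bar> * (\<integral>p. \<bar>\<phi> p\<bar> \<partial>lborel)" for x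
          by (simp add: abs_mult mult.assoc)
        then show "integrable lborel (\<lambda>x. \<integral>p. norm (case (x, p) of (x, p) \<Rightarrow> C * (v x * \<phi> p)) \<partial>lborel)"
          using integrable_v by simp
      qed (use test_functions_integrable[OF \<phi>] in auto)
      have "\<bar>v x\<bar> * (\<bar>\<phi> p\<bar> * \<bar>\<rho> n (x - p)\<bar>) \<le> \<bar>C\<bar> * (\<bar>v x\<bar> * \<bar>\<phi> p\<bar>)" for x p
        using mult_right_mono[OF order_trans[OF C[of "x - p"] abs_ge_self], of "\<bar>v x\<bar> * \<bar>\<phi> p\<bar>"]
        by (simp add: ac_simps)
      then show "AE x in lborel \<Otimes>\<^sub>M lborel. norm (case x of (x, p) \<Rightarrow> v x * (\<phi> p * \<rho> n (x - p)))
          \<le> norm (case x of (x, p) \<Rightarrow> C * (v x * \<phi> p))"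
        by (intro AE_I2) (auto simp: abs_mult)
    qed measurable
    have "(\<integral>p. mollified (\<rho> n) p * \<phi> p \<partial>lborel) = (\<integral>p. (\<integral>x. v x * (\<phi> p * \<rho> n (x - p)) \<partial>lborel) \<partial>lborel)"
      by (simp add: mollified_def integral_mult_left_zero[symmetric] ac_simps del: integral_mult_left_zero)
    also have "\<dots> = (\<integral>x. (\<integral>p. v x * (\<phi> p * \<rho> n (x - p)) \<partial>lborel) \<partial>lborel)"
      by (rule lborel_pair.Fubini_integral[OF int])
    also have "\<dots> = (\<integral>x. v x * \<Phi> n x \<partial>lborel)"
      using mollifierD(4)[OF \<rho>, of n "p - x" for p x] by (simp add: \<Phi>_def)
    finally show ?thesis .
  qed
  moreover have "(\<lambda>n. \<integral>x. v x * \<Phi> n x \<partial>lborel) \<longlonglongrightarrow> (\<integral>x. v x * \<phi> x \<partial>lborel)"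
  proof (rule integral_dominated_convergence[where w = "\<lambda>x. B * \<bar>v x\<bar>"])
    have "isCont \<phi> x" for x
      using test_functions_continuous[OF \<phi>, of UNIV] by (simp add: continuous_on_eq_continuous_at)
    then have "(\<lambda>n. \<Phi> n x) \<longlonglongrightarrow> \<phi> x" for x
      unfolding \<Phi>_def by (intro mollified_tendsto[OF \<rho> r]) auto
    then show "AE x in lborel. (\<lambda>n. v x * \<Phi> n x) \<longlonglongrightarrow> v x * \<phi> x"
      by (intro AE_I2 tendsto_mult tendsto_const)
    have "\<bar>v x\<bar> * \<bar>\<Phi> n x\<bar> \<le> B * \<bar>v x\<bar>" for n x
      using mult_right_mono[OF \<Phi>_bound abs_ge_zero[of "v x"]] by (simp add: mult.commute)
    then show "AE x in lborel. norm (v x * \<Phi> n x) \<le> B * \<bar>v x\<bar>" for n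
      by (simp add: abs_mult)
  qed (use integrable_v in auto)
  ultimately show ?thesis by simp
qed

text \<open>The expression that is squared is the double integral of \<open>(v x - v y) * \<phi> x * \<psi> y\<close>. The supports of the two test
  functions have a convex hull at a positive distance from the boundary, and on this hull the oscillation of the mollified
  functions is under control.\<close>

lemma oscillation_tested:
  assumes "convex U" and diam: "\<And>x y. x \<in> U \<Longrightarrow> y \<in> U \<Longrightarrow> norm (x - y) \<le> h"
    and \<phi>: "\<phi> \<in> test_functions U" and \<psi>: "\<psi> \<in> test_functions U"
  shows "((\<integral>x. v x * \<phi> x \<partial>lborel) * (\<integral>x. \<psi> x \<partial>lborel) - (\<integral>x. \<phi> x \<partial>lborel) * (\<integral>x. v x * \<psi> x \<partial>lborel))\<^sup>2
    \<le> 4 * h\<^sup>2 * energy * measure lborel U * (\<integral>x. (\<phi> x)\<^sup>2 \<partial>lborel) * (\<integral>x. (\<psi> x)\<^sup>2 \<partial>lborel)"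
proof -
  note [measurable] = test_functions_measurable[OF \<phi>] test_functions_measurable[OF \<psi>]
  define A where "A = convex hull (closure {x. \<phi> x \<noteq> 0} \<union> closure {x. \<psi> x \<noteq> 0})"
  have A: "compact A" "convex A" "A \<subseteq> U"
    unfolding A_def
    by (intro compact_convex_hull compact_Un convex_convex_hull hull_minimal Un_least \<open>convex U\<close>
        test_functionsD[OF \<phi>] test_functionsD[OF \<psi>])+
  have [measurable]: "A \<in> sets borel" using A(1) by (intro borel_closed compact_imp_closed)
  have "closure {x. \<phi> x \<noteq> 0} \<subseteq> A" "closure {x. \<psi> x \<noteq> 0} \<subseteq> A"
    unfolding A_def by (rule hull_subset[THEN subset_trans[rotated]]; simp)+
  then have outside: "\<phi> x = 0" "\<psi> x = 0" if "x \<notin> A" for x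
    using that not_in_closure_support[of x \<phi>] not_in_closure_support[of x \<psi>] by (auto dest: subsetD)
  obtain e where e: "e > 0" "(\<Union>x\<in>A. ball x e) \<subseteq> U"
    using compact_subset_open_imp_ball_epsilon_subset[OF A(1) open_U A(3)] by metis
  define r where "r n = e / 2 / real (Suc n)" for n
  have r_pos: "r n > 0" and r_less: "r n < e" for n
  proof -
    show "r n > 0" using e(1) by (simp add: r_def)
    have "r n \<le> e / 2 / 1" unfolding r_def using e(1) by (intro divide_left_mono) auto
    then show "r n < e" using e(1) by simp
  qed
  have r_lim: "r \<longlonglongrightarrow> 0"
    unfolding r_def by (rule LIMSEQ_Suc[of "\<lambda>n. e / 2 / real n"]) (rule lim_const_over_n)
  have "\<exists>\<rho>. mollifier (r n) \<rho>" for n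
    by (rule mollifier_exists[OF r_pos[of n]]) blast
  then obtain \<rho> where \<rho>: "\<And>n. mollifier (r n) (\<rho> n)"
    by metis
  define M where "M n = mollified (\<rho> n)" for n
  have [measurable]: "M n \<in> borel_measurable borel" for n
    unfolding M_def by (intro measurable_mollified mollifierD[OF \<rho>])
  define D where "D n = (\<integral>x. M n x * \<phi> x \<partial>lborel) * (\<integral>x. \<psi> x \<partial>lborel)
      - (\<integral>x. \<phi> x \<partial>lborel) * (\<integral>x. M n x * \<psi> x \<partial>lborel)" for n
  let ?C = "4 * h\<^sup>2 * energy * measure lborel U * (\<integral>x. (\<phi> x)\<^sup>2 \<partial>lborel) * (\<integral>x. (\<psi> x)\<^sup>2 \<partial>lborel)"
  have bound: "(D n)\<^sup>2 \<le> ?C" for n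
  proof -
    note int = test_functions_integrable[OF \<phi>] test_functions_integrable[OF \<psi>]
      integrable_mollified_mult_test[OF \<rho> \<phi>, of n, folded M_def]
      integrable_mollified_mult_test[OF \<rho> \<psi>, of n, folded M_def]
    have "D n = (\<integral>x. M n x * \<phi> x * (\<integral>y. \<psi> y \<partial>lborel) - \<phi> x * (\<integral>y. M n y * \<psi> y \<partial>lborel) \<partial>lborel)"
      using int by (simp add: D_def)
    also have "\<dots> = (\<integral>x. (\<integral>y. M n x * \<phi> x * \<psi> y - \<phi> x * (M n y * \<psi> y) \<partial>lborel) \<partial>lborel)"
      using int by simp
    also have "\<dots> = (\<integral>x. (\<integral>y. (M n x - M n y) * (\<phi> x * \<psi> y) \<partial>lborel) \<partial>lborel)"
      by (simp add: algebra_simps)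
    finally have D_eq: "D n = (\<integral>x. (\<integral>y. (M n x - M n y) * (\<phi> x * \<psi> y) \<partial>lborel) \<partial>lborel)" .
    let ?F = "\<lambda>x y. indicator A x * indicator A y * ennreal \<bar>M n x - M n y\<bar>"
    let ?H = "\<lambda>x y. ennreal \<bar>\<phi> x\<bar> * ennreal \<bar>\<psi> y\<bar>"
    have "ennreal \<bar>D n\<bar> \<le> (\<integral>\<^sup>+x. ennreal \<bar>\<integral>y. (M n x - M n y) * (\<phi> x * \<psi> y) \<partial>lborel\<bar> \<partial>lborel)"
      unfolding D_eq by (rule ennreal_abs_integral_le)
    also have "\<dots> \<le> (\<integral>\<^sup>+x. (\<integral>\<^sup>+y. ennreal \<bar>(M n x - M n y) * (\<phi> x * \<psi> y)\<bar> \<partial>lborel) \<partial>lborel)"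
      by (intro nn_integral_mono ennreal_abs_integral_le)
    also have "\<dots> = (\<integral>\<^sup>+x. (\<integral>\<^sup>+y. ?F x y * ?H x y \<partial>lborel) \<partial>lborel)"
    proof (intro nn_integral_cong)
      fix x y show "ennreal \<bar>(M n x - M n y) * (\<phi> x * \<psi> y)\<bar> = ?F x y * ?H x y"
        using outside[of x] outside[of y]
        by (cases "x \<in> A"; cases "y \<in> A") (auto simp: abs_mult ennreal_mult)
    qed
    finally have "(ennreal \<bar>D n\<bar>)\<^sup>2 \<le> (\<integral>\<^sup>+x. (\<integral>\<^sup>+y. ?F x y * ?H x y \<partial>lborel) \<partial>lborel)\<^sup>2"
      by (intro power_mono) auto
    also have "\<dots> \<le> (\<integral>\<^sup>+x. (\<integral>\<^sup>+y. (?F x y)\<^sup>2 \<partial>lborel) \<partial>lborel) * (\<integral>\<^sup>+x. (\<integral>\<^sup>+y. (?H x y)\<^sup>2 \<partial>lborel) \<partial>lborel)"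
      by (rule Cauchy_Schwarz_iterated) measurable
    also have "(\<integral>\<^sup>+x. (\<integral>\<^sup>+y. (?F x y)\<^sup>2 \<partial>lborel) \<partial>lborel)
        = (\<integral>\<^sup>+x. (\<integral>\<^sup>+y. indicator A x * indicator A y * ennreal ((M n x - M n y)\<^sup>2) \<partial>lborel) \<partial>lborel)"
      by (intro nn_integral_cong) (auto simp: indicator_def ennreal_power)
    also have "\<dots> \<le> ennreal (h\<^sup>2) * (4 * ennreal energy * emeasure lborel A)"
      unfolding M_def
    proof (rule mollified_oscillation[OF \<rho>])
      show "x + z \<in> U" if "x \<in> A" "norm z \<le> r n" for x z
      proof -
        have "x + z \<in> ball x e" using that r_less[of n] by (simp add: dist_norm)
        then show ?thesis using e(2) that(1) by blast
      qed
    qed (use A diam in auto)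
    also have "(\<integral>\<^sup>+x. (\<integral>\<^sup>+y. (?H x y)\<^sup>2 \<partial>lborel) \<partial>lborel) = ennreal (\<integral>x. (\<phi> x)\<^sup>2 \<partial>lborel) * ennreal (\<integral>x. (\<psi> x)\<^sup>2 \<partial>lborel)"
      using nn_integral_square_eq_integral[OF test_functions_square_integrable[OF \<phi>]]
        nn_integral_square_eq_integral[OF test_functions_square_integrable[OF \<psi>]]
      by (simp add: power_mult_distrib ennreal_power nn_integral_cmult nn_integral_multc)
    also have "emeasure lborel A \<le> ennreal (measure lborel U)"
      using emeasure_mono[OF A(3), of lborel] finite_measure_U by (simp add: emeasure_eq_ennreal_measure)
    finally have "(ennreal \<bar>D n\<bar>)\<^sup>2 \<le> ennreal (h\<^sup>2) * (4 * ennreal energy * ennreal (measure lborel U))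
        * (ennreal (\<integral>x. (\<phi> x)\<^sup>2 \<partial>lborel) * ennreal (\<integral>x. (\<psi> x)\<^sup>2 \<partial>lborel))"
      by (simp add: mult_left_mono mult_right_mono)
    also have "\<dots> = ennreal ?C"
      using energy_nonneg by (simp add: ennreal_mult ac_simps)
    finally have "ennreal ((D n)\<^sup>2) \<le> ennreal ?C" by (simp add: ennreal_power)
    moreover have "?C \<ge> 0" using energy_nonneg by simp
    ultimately show ?thesis by simp
  qed
  have "(\<lambda>n. (D n)\<^sup>2) \<longlonglongrightarrow> ((\<integral>x. v x * \<phi> x \<partial>lborel) * (\<integral>x. \<psi> x \<partial>lborel)
      - (\<integral>x. \<phi> x \<partial>lborel) * (\<integral>x. v x * \<psi> x \<partial>lborel))\<^sup>2"
    unfolding D_def M_def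
    by (intro tendsto_intros mollified_tested_tendsto[OF \<rho> r_lim \<phi>] mollified_tested_tendsto[OF \<rho> r_lim \<psi>])
  then show ?thesis
    by (rule LIMSEQ_le_const2) (use bound in auto)
qed

text \<open>Duality is applied twice to the preceding lemma. For fixed \<open>\<phi>\<close>, duality in \<open>\<psi>\<close> bounds the norm of the function
  \<open>H = a * indicator U - c * v\<close>, where \<open>a\<close> and \<open>c\<close> are the integrals of \<open>v * \<phi>\<close> and \<open>\<phi>\<close>. The mean
  of \<open>H\<close> over \<open>U\<close> is, up to the sign, the integral of \<open>(m - v) * \<phi>\<close>, where \<open>m\<close> is the mean of \<open>v\<close>; so duality in \<open>\<phi>\<close>
  bounds the norm of \<open>m - v\<close>. The measure of \<open>U\<close> cancels.\<close>

lemma poincare: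
  assumes "convex U" and "h \<ge> 0" and diam: "\<And>x y. x \<in> U \<Longrightarrow> y \<in> U \<Longrightarrow> norm (x - y) \<le> h"
  obtains m where "(\<integral>x. (v x - m * indicator U x)\<^sup>2 \<partial>lborel) \<le> 4 * h\<^sup>2 * energy"
proof (cases "U = {}")
  case True
  then have "v x = 0" for x using v_outside by auto
  then show ?thesis using that[of 0] energy_nonneg by simp
next
  case False
  define \<mu> where "\<mu> = measure lborel U"
  have "\<not> negligible U" using open_not_negligible[OF open_U False] .
  then have "emeasure lborel U \<noteq> 0"
    using null_sets_completionI[of U lborel] by (auto simp: negligible_iff_null_sets null_sets_def)
  then have \<mu>: "\<mu> > 0"
    using finite_measure_U by (simp add: \<mu>_def measure_def enn2real_positive_iff zero_less_iff_neq_zero)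
  have ind2: "(indicator U x :: real)\<^sup>2 = indicator U x" for x
    by (auto simp: indicator_def)
  have int_ind: "integrable lborel (indicator U :: R2 \<Rightarrow> real)"
    using finite_measure_U by (simp add: integrable_real_indicator)
  then have int_ind2: "integrable lborel (\<lambda>x. (c * indicator U x :: real)\<^sup>2)" for c
    by (simp add: power_mult_distrib ind2)
  define E where "E = 4 * h\<^sup>2 * energy"
  have "E \<ge> 0" using energy_nonneg by (simp add: E_def)
  have test_ind: "(\<integral>x. indicator U x * \<phi> x \<partial>lborel) = (\<integral>x. \<phi> x \<partial>lborel)"
      "integrable lborel (\<lambda>x. indicator U x * \<phi> x)" if "\<phi> \<in> test_functions U" for \<phi>
  proof -
    have eq: "(\<lambda>x. indicator U x * \<phi> x) = \<phi>"
    proof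
      show "indicator U x * \<phi> x = \<phi> x" for x
        using test_functions_eq_0[OF that, of x] by (cases "x \<in> U") auto
    qed
    show "(\<integral>x. indicator U x * \<phi> x \<partial>lborel) = (\<integral>x. \<phi> x \<partial>lborel)"
      "integrable lborel (\<lambda>x. indicator U x * \<phi> x)"
      unfolding eq using test_functions_integrable[OF that] by simp_all
  qed
  have combination: "(\<lambda>x. a * indicator U x - c * v x) \<in> borel_measurable borel"
      "integrable lborel (\<lambda>x. (a * indicator U x - c * v x)\<^sup>2)" for a c
  proof -
    show "(\<lambda>x. a * indicator U x - c * v x) \<in> borel_measurable borel" by measurable
    have "integrable lborel (\<lambda>x. (a * indicator U x + - c * v x)\<^sup>2)"
      using square_integrable_v int_ind2[of a]
      by (intro integrable_square_add) (auto simp: power_mult_distrib)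
    then show "integrable lborel (\<lambda>x. (a * indicator U x - c * v x)\<^sup>2)" by simp
  qed
  define m where "m = (\<integral>x. v x \<partial>lborel) / \<mu>"
  have dual: "\<bar>\<integral>x. (m * indicator U x - 1 * v x) * \<phi> x \<partial>lborel\<bar> \<le> sqrt E * sqrt (\<integral>x. (\<phi> x)\<^sup>2 \<partial>lborel)"
    if \<phi>: "\<phi> \<in> test_functions U" for \<phi>
  proof -
    define a c where "a = (\<integral>x. v x * \<phi> x \<partial>lborel)" and "c = (\<integral>x. \<phi> x \<partial>lborel)"
    define H where "H x = a * indicator U x - c * v x" for x
    define C where "C = sqrt (E * \<mu> * (\<integral>x. (\<phi> x)\<^sup>2 \<partial>lborel))"
    have "C \<ge> 0"
      using \<open>E \<ge> 0\<close> \<mu> by (simp add: C_def)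
    have H: "H \<in> borel_measurable borel" "integrable lborel (\<lambda>x. (H x)\<^sup>2)"
      unfolding H_def by (rule combination)+
    have H2: "(\<integral>x. (H x)\<^sup>2 \<partial>lborel) \<le> C\<^sup>2"
    proof (rule L2_norm_by_duality[OF open_U H])
      fix \<psi> assume \<psi>: "\<psi> \<in> test_functions U"
      have "(\<integral>x. H x * \<psi> x \<partial>lborel) = (\<integral>x. a * (indicator U x * \<psi> x) - c * (v x * \<psi> x) \<partial>lborel)"
        by (simp add: H_def algebra_simps)
      also have "\<dots> = a * (\<integral>x. \<psi> x \<partial>lborel) - c * (\<integral>x. v x * \<psi> x \<partial>lborel)"
        using test_ind[OF \<psi>] integrable_v_mult_test[OF \<psi>] by simp
      finally have "(\<integral>x. H x * \<psi> x \<partial>lborel)\<^sup>2 \<le> E * \<mu> * (\<integral>x. (\<phi> x)\<^sup>2 \<partial>lborel) * (\<integral>x. (\<psi> x)\<^sup>2 \<partial>lborel)"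
        using oscillation_tested[OF \<open>convex U\<close> diam \<phi> \<psi>] by (simp add: a_def c_def E_def \<mu>_def)
      then have "sqrt ((\<integral>x. H x * \<psi> x \<partial>lborel)\<^sup>2) \<le> sqrt (E * \<mu> * (\<integral>x. (\<phi> x)\<^sup>2 \<partial>lborel) * (\<integral>x. (\<psi> x)\<^sup>2 \<partial>lborel))"
        by (rule real_sqrt_le_mono)
      then show "\<bar>\<integral>x. H x * \<psi> x \<partial>lborel\<bar> \<le> C * sqrt (\<integral>x. (\<psi> x)\<^sup>2 \<partial>lborel)"
        by (simp add: C_def real_sqrt_mult)
    qed (use v_outside \<open>C \<ge> 0\<close> in \<open>auto simp: H_def\<close>)
    have "\<bar>\<integral>x. H x * indicator U x \<partial>lborel\<bar> \<le> sqrt (\<integral>x. (H x)\<^sup>2 \<partial>lborel) * sqrt (\<integral>x. (indicator U x)\<^sup>2 \<partial>lborel)"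
      using H int_ind2[of 1] by (intro integral_mult_le_sqrt) auto
    also have "\<dots> \<le> C * sqrt \<mu>"
      using real_sqrt_le_mono[OF H2] \<open>C \<ge> 0\<close> by (simp add: ind2 \<mu>_def mult_right_mono)
    also have "C * sqrt \<mu> = \<mu> * (sqrt E * sqrt (\<integral>x. (\<phi> x)\<^sup>2 \<partial>lborel))"
      using \<mu> by (simp add: C_def real_sqrt_mult)
    also have "(\<integral>x. H x * indicator U x \<partial>lborel) = (\<integral>x. a * indicator U x - c * v x \<partial>lborel)"
      using v_outside by (intro Bochner_Integration.integral_cong) (auto simp: H_def indicator_def)
    also have "\<dots> = a * \<mu> - c * (\<integral>x. v x \<partial>lborel)"
      using int_ind integrable_v by (simp add: \<mu>_def)
    also have "\<dots> = - \<mu> * (m * c - a)"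
      using \<mu> by (simp add: m_def field_simps)
    also have "m * c - a = (\<integral>x. m * (indicator U x * \<phi> x) - v x * \<phi> x \<partial>lborel)"
      using test_ind[OF \<phi>] integrable_v_mult_test[OF \<phi>] by (simp add: a_def c_def)
    finally have "\<mu> * \<bar>\<integral>x. m * (indicator U x * \<phi> x) - v x * \<phi> x \<partial>lborel\<bar>
        \<le> \<mu> * (sqrt E * sqrt (\<integral>x. (\<phi> x)\<^sup>2 \<partial>lborel))"
      using \<mu> by (simp add: abs_mult)
    then show ?thesis using \<mu> by (simp add: algebra_simps)
  qed
  have "(\<integral>x. (m * indicator U x - 1 * v x)\<^sup>2 \<partial>lborel) \<le> (sqrt E)\<^sup>2"
    by (rule L2_norm_by_duality[OF open_U combination _ _ dual]) (use v_outside \<open>E \<ge> 0\<close> in auto)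
  then show ?thesis
    using \<open>E \<ge> 0\<close> by (intro that[of m]) (simp add: E_def power2_commute)
qed

end

section \<open>A trace inequality without line integrals\<close>

context weak_gradient
begin

text \<open>The difference of two values on a line in the direction \<open>c\<close> is bounded by an integral over the whole line; the
  integral over all these lines is, up to the determinant, an integral over the plane. The margin \<open>\<delta>\<close> keeps the
  parallelogram at a distance from the boundary where mollification is possible.\<close>

lemma mollified_strip:
  assumes \<rho>: "mollifier r \<rho>" and \<delta>: "0 \<le> \<delta>" and D: "cross b c \<noteq> 0"
    and inside: "\<And>y s z. y \<in> {\<delta>..1/2 - \<delta>} \<Longrightarrow> s \<in> {\<delta>..1/2 - \<delta>} \<Longrightarrow> norm z \<le> r \<Longrightarrow> a + y *\<^sub>R b + s *\<^sub>R c + z \<in> U"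
  shows "(\<integral>\<^sup>+y. (\<integral>\<^sup>+s. ennreal (\<bar>cross b c\<bar> * (indicator {\<delta>..1/2 - \<delta>} y * indicator {\<delta>..1/2 - \<delta>} s *
      (mollified \<rho> (a + y *\<^sub>R b + s *\<^sub>R c) - mollified \<rho> (a + y *\<^sub>R b + \<delta> *\<^sub>R c))\<^sup>2)) \<partial>lborel) \<partial>lborel)
    \<le> ennreal ((norm c)\<^sup>2 * energy)"
proof -
  note [measurable] = mollifierD(7)[OF \<rho>]
  let ?I = "{\<delta>..1/2 - \<delta>}"
  let ?L = "\<lambda>y s. a + y *\<^sub>R b + s *\<^sub>R c"
  let ?D = "ennreal \<bar>cross b c\<bar>"
  define H where "H y t = (\<integral>\<^sup>+z. ennreal (G (?L y t + z)) * ennreal (\<rho> z) \<partial>lborel)" for y t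
  have [measurable]: "(\<lambda>p. H (f p) (g p)) \<in> borel_measurable M"
    if [measurable]: "f \<in> borel_measurable M" "g \<in> borel_measurable M" for f g and M :: "'b measure"
    unfolding H_def by measurable
  have pointwise: "ennreal (\<bar>cross b c\<bar> * (indicator ?I y * indicator ?I s * (mollified \<rho> (?L y s) - mollified \<rho> (?L y \<delta>))\<^sup>2))
      \<le> ?D * ennreal ((norm c)\<^sup>2) * (\<integral>\<^sup>+t. H y t \<partial>lborel) * indicator ?I s" for y s
  proof (cases "y \<in> ?I \<and> s \<in> ?I \<and> s \<noteq> \<delta>")
    case True
    then have s: "s - \<delta> > 0" "s - \<delta> \<le> 1" using \<delta> by auto
    have J: "ennreal ((mollified \<rho> (?L y \<delta> + (s - \<delta>) *\<^sub>R c) - mollified \<rho> (?L y \<delta>))\<^sup>2)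
        \<le> ennreal ((norm ((s - \<delta>) *\<^sub>R c))\<^sup>2) *
          (\<integral>\<^sup>+t. (\<integral>\<^sup>+z. ennreal (G (?L y \<delta> + t *\<^sub>R ((s - \<delta>) *\<^sub>R c) + z)) * ennreal (\<rho> z) \<partial>lborel) * indicator {0..1} t \<partial>lborel)"
    proof (rule mollified_difference_square_le[OF \<rho>])
      fix t :: real and z :: R2 assume t: "0 \<le> t" "t \<le> 1" "norm z \<le> r"
      have "t * (s - \<delta>) \<le> 1 * (s - \<delta>)" using t s by (intro mult_right_mono) auto
      moreover have "0 \<le> t * (s - \<delta>)" using t s by simp
      ultimately have "\<delta> + t * (s - \<delta>) \<in> ?I" using True by auto
      from inside[OF _ this t(3)] True have "?L y (\<delta> + t * (s - \<delta>)) + z \<in> U" by auto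
      then show "?L y \<delta> + t *\<^sub>R ((s - \<delta>) *\<^sub>R c) + z \<in> U" by (simp add: algebra_simps)
    qed
    have eq: "?L y \<delta> + t *\<^sub>R ((s - \<delta>) *\<^sub>R c) = ?L y (\<delta> + (s - \<delta>) * t)" for t
      by (simp add: algebra_simps)
    have eq': "?L y \<delta> + (s - \<delta>) *\<^sub>R c = ?L y s"
      by (simp add: algebra_simps)
    note J[unfolded eq eq']
    also have "ennreal ((norm ((s - \<delta>) *\<^sub>R c))\<^sup>2) *
        (\<integral>\<^sup>+t. (\<integral>\<^sup>+z. ennreal (G (?L y (\<delta> + (s - \<delta>) * t) + z)) * ennreal (\<rho> z) \<partial>lborel) * indicator {0..1} t \<partial>lborel)
      \<le> ennreal ((norm c)\<^sup>2) * (\<integral>\<^sup>+t. H y t \<partial>lborel)"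
    proof -
      have "ennreal ((norm ((s - \<delta>) *\<^sub>R c))\<^sup>2) = ennreal (s - \<delta>) * (ennreal (s - \<delta>) * ennreal ((norm c)\<^sup>2))"
        using s by (simp add: power_mult_distrib power2_eq_square ennreal_mult ac_simps)
      also have "\<dots> \<le> 1 * (ennreal (s - \<delta>) * ennreal ((norm c)\<^sup>2))"
        using s by (intro mult_right_mono) (auto intro: ennreal_leI[of _ 1, simplified])
      finally have "ennreal ((norm ((s - \<delta>) *\<^sub>R c))\<^sup>2) * (\<integral>\<^sup>+t. H y (\<delta> + (s - \<delta>) * t) * indicator {0..1} t \<partial>lborel)
          \<le> (ennreal (s - \<delta>) * ennreal ((norm c)\<^sup>2)) * (\<integral>\<^sup>+t. H y (\<delta> + (s - \<delta>) * t) \<partial>lborel)"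
        by (intro mult_mono nn_integral_mono) (auto simp: indicator_def)
      also have "\<dots> = ennreal ((norm c)\<^sup>2) * (ennreal \<bar>s - \<delta>\<bar> * (\<integral>\<^sup>+t. H y (\<delta> + (s - \<delta>) * t) \<partial>lborel))"
        using s by (simp add: ac_simps)
      also have "ennreal \<bar>s - \<delta>\<bar> * (\<integral>\<^sup>+t. H y (\<delta> + (s - \<delta>) * t) \<partial>lborel) = (\<integral>\<^sup>+t. H y t \<partial>lborel)"
        using s by (intro nn_integral_real_affine[symmetric]) auto
      finally show ?thesis by (simp add: H_def)
    qed
    finally have "?D * ennreal ((mollified \<rho> (?L y s) - mollified \<rho> (?L y \<delta>))\<^sup>2)
        \<le> ?D * (ennreal ((norm c)\<^sup>2) * (\<integral>\<^sup>+t. H y t \<partial>lborel))"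
      by (rule mult_left_mono) simp
    then show ?thesis using True by (simp add: ennreal_mult mult.assoc)
  next
    case False
    then show ?thesis by (cases "s = \<delta>") (auto simp: indicator_def)
  qed
  have K: "?D * (\<integral>\<^sup>+y. (\<integral>\<^sup>+t. H y t \<partial>lborel) \<partial>lborel) = ennreal energy"
  proof -
    have "(\<integral>\<^sup>+y. (\<integral>\<^sup>+t. H y t \<partial>lborel) \<partial>lborel)
        = (\<integral>\<^sup>+y. (\<integral>\<^sup>+z. (\<integral>\<^sup>+t. ennreal (G (?L y t + z)) * ennreal (\<rho> z) \<partial>lborel) \<partial>lborel) \<partial>lborel)"
      unfolding H_def by (intro nn_integral_cong nn_integral_swap) measurable
    also have "\<dots> = (\<integral>\<^sup>+z. (\<integral>\<^sup>+y. (\<integral>\<^sup>+t. ennreal (G (?L y t + z)) * ennreal (\<rho> z) \<partial>lborel) \<partial>lborel) \<partial>lborel)"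
      by (intro nn_integral_swap) measurable
    also have "\<dots> = (\<integral>\<^sup>+z. (\<integral>\<^sup>+y. (\<integral>\<^sup>+t. ennreal (G ((a + z) + y *\<^sub>R b + t *\<^sub>R c)) \<partial>lborel) \<partial>lborel) * ennreal (\<rho> z) \<partial>lborel)"
      by (simp add: nn_integral_multc add_ac)
    finally have "?D * (\<integral>\<^sup>+y. (\<integral>\<^sup>+t. H y t \<partial>lborel) \<partial>lborel)
        = (\<integral>\<^sup>+z. ?D * (\<integral>\<^sup>+y. (\<integral>\<^sup>+t. ennreal (G ((a + z) + y *\<^sub>R b + t *\<^sub>R c)) \<partial>lborel) \<partial>lborel) * ennreal (\<rho> z) \<partial>lborel)"
      by (simp add: nn_integral_cmult mult.assoc)
    also have "\<dots> = (\<integral>\<^sup>+z. ennreal energy * ennreal (\<rho> z) \<partial>lborel)"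
      using nn_integral_parallelogram[OF _ D, of "\<lambda>x. ennreal (G x)"] by (simp add: nn_integral_G)
    also have "\<dots> = ennreal energy"
      using mollifierD(9)[OF \<rho>] by (simp add: nn_integral_cmult)
    finally show ?thesis .
  qed
  have small: "emeasure lborel ?I \<le> 1"
    using \<delta> by (cases "\<delta> \<le> 1/2 - \<delta>") auto
  have "(\<integral>\<^sup>+y. (\<integral>\<^sup>+s. ennreal (\<bar>cross b c\<bar> * (indicator ?I y * indicator ?I s *
      (mollified \<rho> (?L y s) - mollified \<rho> (?L y \<delta>))\<^sup>2)) \<partial>lborel) \<partial>lborel)
    \<le> (\<integral>\<^sup>+y. (\<integral>\<^sup>+s. ?D * ennreal ((norm c)\<^sup>2) * (\<integral>\<^sup>+t. H y t \<partial>lborel) * indicator ?I s \<partial>lborel) \<partial>lborel)"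
    by (intro nn_integral_mono pointwise)
  also have "\<dots> = (\<integral>\<^sup>+y. ?D * ennreal ((norm c)\<^sup>2) * (\<integral>\<^sup>+t. H y t \<partial>lborel) * emeasure lborel ?I \<partial>lborel)"
    by (simp add: nn_integral_cmult)
  also have "\<dots> \<le> (\<integral>\<^sup>+y. ?D * ennreal ((norm c)\<^sup>2) * (\<integral>\<^sup>+t. H y t \<partial>lborel) * 1 \<partial>lborel)"
    by (intro nn_integral_mono mult_left_mono small) simp
  also have "\<dots> = ?D * ennreal ((norm c)\<^sup>2) * (\<integral>\<^sup>+y. (\<integral>\<^sup>+t. H y t \<partial>lborel) \<partial>lborel)"
    by (simp add: nn_integral_cmult)
  also have "\<dots> = ennreal ((norm c)\<^sup>2) * (?D * (\<integral>\<^sup>+y. (\<integral>\<^sup>+t. H y t \<partial>lborel) \<partial>lborel))"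
    by (simp only: ac_simps)
  also have "\<dots> = ennreal ((norm c)\<^sup>2 * energy)"
    using energy_nonneg by (simp add: K ennreal_mult)
  finally show ?thesis .
qed

text \<open>Fatou's lemma removes the mollification, as the mollified functions converge at the points of continuity.\<close>

lemma strip_inside:
  assumes cont: "continuous_on U v" and \<delta>: "0 < \<delta>" and D: "cross b c \<noteq> 0"
    and inside: "\<And>y s. 0 < y \<Longrightarrow> y < 1/2 \<Longrightarrow> 0 < s \<Longrightarrow> s < 1/2 \<Longrightarrow> a + y *\<^sub>R b + s *\<^sub>R c \<in> U"
  shows "(\<integral>\<^sup>+y. (\<integral>\<^sup>+s. ennreal (\<bar>cross b c\<bar> * (indicator {\<delta>..1/2 - \<delta>} y * indicator {\<delta>..1/2 - \<delta>} s *
      (v (a + y *\<^sub>R b + s *\<^sub>R c) - v (a + y *\<^sub>R b + \<delta> *\<^sub>R c))\<^sup>2)) \<partial>lborel) \<partial>lborel)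
    \<le> ennreal ((norm c)\<^sup>2 * energy)"
proof -
  let ?I = "{\<delta>..1/2 - \<delta>}"
  let ?L = "\<lambda>y s. a + y *\<^sub>R b + s *\<^sub>R c"
  define C where "C = (\<lambda>p. ?L (fst p) (snd p)) ` (?I \<times> ?I)"
  have C: "compact C" unfolding C_def
    by (intro compact_continuous_image compact_Times compact_Icc continuous_intros)
  have CU: "C \<subseteq> U" using inside \<delta> by (auto simp: C_def)
  obtain e where e: "e > 0" "(\<Union>x\<in>C. ball x e) \<subseteq> U"
    using compact_subset_open_imp_ball_epsilon_subset[OF C open_U CU] by metis
  define r where "r n = e / 2 / real (Suc n)" for n
  have r_pos: "r n > 0" and r_less: "r n < e" for n
  proof -
    show "r n > 0" using e(1) by (simp add: r_def)
    have "r n \<le> e / 2 / 1" unfolding r_def using e(1) by (intro divide_left_mono) auto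
    then show "r n < e" using e(1) by simp
  qed
  have r_lim: "r \<longlonglongrightarrow> 0"
    unfolding r_def by (rule LIMSEQ_Suc[of "\<lambda>n. e / 2 / real n"]) (rule lim_const_over_n)
  have "\<exists>\<rho>. mollifier (r n) \<rho>" for n
    by (rule mollifier_exists[OF r_pos[of n]]) blast
  then obtain \<rho> where \<rho>: "\<And>n. mollifier (r n) (\<rho> n)"
    by metis
  note [measurable] = mollifierD(7)[OF \<rho>]
  have lim: "(\<lambda>n. mollified (\<rho> n) x) \<longlonglongrightarrow> v x" if "x \<in> U" for x
  proof -
    have "isCont v x" using cont open_U that by (simp add: continuous_on_eq_continuous_at)
    then show ?thesis unfolding mollified_def by (rule mollified_tendsto[OF \<rho> r_lim measurable_v])
  qed
  show ?thesis
  proof (rule fatou_iterated[where f = "\<lambda>n y s. ennreal (\<bar>cross b c\<bar> * (indicator ?I y * indicator ?I s *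
      (mollified (\<rho> n) (?L y s) - mollified (\<rho> n) (?L y \<delta>))\<^sup>2))"])
    show "(\<lambda>n. ennreal (\<bar>cross b c\<bar> * (indicator ?I y * indicator ?I s *
        (mollified (\<rho> n) (?L y s) - mollified (\<rho> n) (?L y \<delta>))\<^sup>2)))
      \<longlonglongrightarrow> ennreal (\<bar>cross b c\<bar> * (indicator ?I y * indicator ?I s * (v (?L y s) - v (?L y \<delta>))\<^sup>2))" for y s
    proof (cases "y \<in> ?I \<and> s \<in> ?I")
      case True
      then have "?L y s \<in> U" "?L y \<delta> \<in> U" using \<delta> inside by auto
      then show ?thesis by (intro tendsto_ennrealI tendsto_intros lim)
    qed auto
    show "(\<integral>\<^sup>+y. (\<integral>\<^sup>+s. ennreal (\<bar>cross b c\<bar> * (indicator ?I y * indicator ?I s *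
      (mollified (\<rho> n) (?L y s) - mollified (\<rho> n) (?L y \<delta>))\<^sup>2)) \<partial>lborel) \<partial>lborel) \<le> ennreal ((norm c)\<^sup>2 * energy)" for n
    proof (rule mollified_strip[OF \<rho> _ D])
      fix y s z assume "y \<in> ?I" "s \<in> ?I" and z: "norm (z :: R2) \<le> r n"
      then have "?L y s \<in> C" unfolding C_def by force
      moreover have "?L y s + z \<in> ball (?L y s) e" using z r_less[of n] by (simp add: dist_norm)
      ultimately show "?L y s + z \<in> U" using e(2) by blast
    qed (use \<delta> in simp)
  qed measurable
qed

text \<open>Fatou's lemma for the margin that tends to zero; the lower end of the lines reaches the edge by the continuity
  of \<open>u\<close> up to the edge.\<close>

lemma strip_up_to_edge:
  assumes u: "continuous_on (U \<union> {a + y *\<^sub>R b | y. 0 < y \<and> y < 1/2}) u" and uv: "\<And>x. x \<in> U \<Longrightarrow> v x = u x"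
    and D: "cross b c \<noteq> 0"
    and inside: "\<And>y s. 0 < y \<Longrightarrow> y < 1/2 \<Longrightarrow> 0 < s \<Longrightarrow> s < 1/2 \<Longrightarrow> a + y *\<^sub>R b + s *\<^sub>R c \<in> U"
  shows "(\<integral>\<^sup>+y. (\<integral>\<^sup>+s. ennreal (\<bar>cross b c\<bar> * (indicator {0<..<1/2} y * indicator {0<..<1/2} s *
      (v (a + y *\<^sub>R b + s *\<^sub>R c) - u (a + y *\<^sub>R b))\<^sup>2)) \<partial>lborel) \<partial>lborel)
    \<le> ennreal ((norm c)\<^sup>2 * energy)"
proof -
  let ?L = "\<lambda>y s. a + y *\<^sub>R b + s *\<^sub>R c"
  define \<delta> where "\<delta> k = 1 / real (Suc k)" for k
  have \<delta>_pos: "\<delta> k > 0" for k by (simp add: \<delta>_def)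
  have \<delta>_lim: "\<delta> \<longlonglongrightarrow> 0" unfolding \<delta>_def by (rule LIMSEQ_Suc[OF lim_inverse_n'])
  have "continuous_on U u" using u by (rule continuous_on_subset) simp
  then have cont: "continuous_on U v"
    using continuous_on_cong[of U U v u] uv by blast
  show ?thesis
  proof (rule fatou_iterated[where f = "\<lambda>k y s. ennreal (\<bar>cross b c\<bar> * (indicator {\<delta> k..1/2 - \<delta> k} y *
      indicator {\<delta> k..1/2 - \<delta> k} s * (v (?L y s) - v (?L y (\<delta> k)))\<^sup>2))"])
    show "(\<lambda>k. ennreal (\<bar>cross b c\<bar> * (indicator {\<delta> k..1/2 - \<delta> k} y *
        indicator {\<delta> k..1/2 - \<delta> k} s * (v (?L y s) - v (?L y (\<delta> k)))\<^sup>2)))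
      \<longlonglongrightarrow> ennreal (\<bar>cross b c\<bar> * (indicator {0<..<1/2} y * indicator {0<..<1/2} s * (v (?L y s) - u (a + y *\<^sub>R b))\<^sup>2))" for y s
    proof (cases "y \<in> {0<..<1/2} \<and> s \<in> {0<..<1/2}")
      case True
      define \<eta> where "\<eta> = min (min y s) (min (1/2 - y) (1/2 - s))"
      have \<eta>: "\<eta> > 0" "\<eta> \<le> y" "\<eta> \<le> s" "\<eta> \<le> 1/2 - y" "\<eta> \<le> 1/2 - s"
        using True by (simp_all add: \<eta>_def min_le_iff_disj)
      have ev: "\<forall>\<^sub>F k in sequentially. \<delta> k < \<eta>"
        using order_tendstoD(2)[OF \<delta>_lim \<eta>(1)] .
      have "((\<lambda>k. u (?L y (\<delta> k))) \<longlonglongrightarrow> u (a + y *\<^sub>R b))"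
      proof (rule continuous_on_tendsto_compose[OF u])
        have "(\<lambda>k. ?L y (\<delta> k)) \<longlonglongrightarrow> ?L y 0" by (intro tendsto_intros \<delta>_lim)
        then show "(\<lambda>k. ?L y (\<delta> k)) \<longlonglongrightarrow> a + y *\<^sub>R b" by simp
        show "a + y *\<^sub>R b \<in> U \<union> {a + y *\<^sub>R b | y. 0 < y \<and> y < 1/2}" using True by auto
        show "\<forall>\<^sub>F k in sequentially. ?L y (\<delta> k) \<in> U \<union> {a + y *\<^sub>R b | y. 0 < y \<and> y < 1/2}"
          using ev
        proof eventually_elim
          case (elim k)
          then have "?L y (\<delta> k) \<in> U" using True \<delta>_pos[of k] \<eta> by (intro inside) auto
          then show ?case by simp
        qed
      qed
      then have "(\<lambda>k. ennreal (\<bar>cross b c\<bar> * (v (?L y s) - u (?L y (\<delta> k)))\<^sup>2))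
          \<longlonglongrightarrow> ennreal (\<bar>cross b c\<bar> * (v (?L y s) - u (a + y *\<^sub>R b))\<^sup>2)"
        by (intro tendsto_ennrealI tendsto_intros)
      moreover have "\<forall>\<^sub>F k in sequentially. ennreal (\<bar>cross b c\<bar> * (v (?L y s) - u (?L y (\<delta> k)))\<^sup>2)
          = ennreal (\<bar>cross b c\<bar> * (indicator {\<delta> k..1/2 - \<delta> k} y * indicator {\<delta> k..1/2 - \<delta> k} s * (v (?L y s) - v (?L y (\<delta> k)))\<^sup>2))"
        using ev
      proof eventually_elim
        case (elim k)
        then have "?L y (\<delta> k) \<in> U" using True \<delta>_pos[of k] \<eta> by (intro inside) auto
        moreover have "y \<in> {\<delta> k..1/2 - \<delta> k}" "s \<in> {\<delta> k..1/2 - \<delta> k}" using elim \<eta> by auto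
        ultimately show ?case by (simp add: uv)
      qed
      ultimately have "(\<lambda>k. ennreal (\<bar>cross b c\<bar> * (indicator {\<delta> k..1/2 - \<delta> k} y *
          indicator {\<delta> k..1/2 - \<delta> k} s * (v (?L y s) - v (?L y (\<delta> k)))\<^sup>2)))
        \<longlonglongrightarrow> ennreal (\<bar>cross b c\<bar> * (v (?L y s) - u (a + y *\<^sub>R b))\<^sup>2)"
        by (rule Lim_transform_eventually)
      then show ?thesis using True by simp
    next
      case False
      then have "y \<notin> {\<delta> k..1/2 - \<delta> k} \<or> s \<notin> {\<delta> k..1/2 - \<delta> k}" for k
        using \<delta>_pos[of k] by auto
      then have zero: "indicator {\<delta> k..1/2 - \<delta> k} y * indicator {\<delta> k..1/2 - \<delta> k} s = (0 :: real)" for k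
        by (auto simp: indicator_def)
      have zero': "indicator {0<..<1/2} y * indicator {0<..<1/2} s = (0 :: real)"
        using False by (auto simp: indicator_def)
      show ?thesis by (simp only: zero zero' mult_zero_left mult_zero_right ennreal_0 tendsto_const)
    qed
    show "(\<integral>\<^sup>+y. (\<integral>\<^sup>+s. ennreal (\<bar>cross b c\<bar> * (indicator {\<delta> k..1/2 - \<delta> k} y *
      indicator {\<delta> k..1/2 - \<delta> k} s * (v (?L y s) - v (?L y (\<delta> k)))\<^sup>2)) \<partial>lborel) \<partial>lborel)
      \<le> ennreal ((norm c)\<^sup>2 * energy)" for k
      by (rule strip_inside[OF cont \<delta>_pos D inside])
  qed measurable
qed

text \<open>The value at a point of the edge is compared with the values on the line in the direction \<open>c\<close> that starts there, and
  the comparison is averaged over this line. Only half of the edge is covered: the parallelogram with half the sides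
  of a triangle is contained in the triangle.\<close>

lemma trace_inequality:
  assumes u: "continuous_on (U \<union> {a + y *\<^sub>R b | y. 0 < y \<and> y < 1/2}) u" and uv: "\<And>x. x \<in> U \<Longrightarrow> v x = u x"
    and D: "cross b c \<noteq> 0"
    and inside: "\<And>y s. 0 < y \<Longrightarrow> y < 1/2 \<Longrightarrow> 0 < s \<Longrightarrow> s < 1/2 \<Longrightarrow> a + y *\<^sub>R b + s *\<^sub>R c \<in> U"
  shows "ennreal \<bar>cross b c\<bar> * (\<integral>\<^sup>+y. ennreal ((u (a + y *\<^sub>R b))\<^sup>2) * indicator {0<..<1/2} y \<partial>lborel)
    \<le> ennreal (4 * (\<integral>x. (v x)\<^sup>2 \<partial>lborel) + 4 * (norm c)\<^sup>2 * energy)"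
proof -
  let ?L = "\<lambda>y s. a + y *\<^sub>R b + s *\<^sub>R c"
  let ?I = "{0<..<1/2::real}"
  let ?D = "\<bar>cross b c\<bar>"
  define e where "e y = indicator ?I y *\<^sub>R u (a + y *\<^sub>R b)" for y
  have "continuous_on ?I (\<lambda>y. u (a + y *\<^sub>R b))"
    by (rule continuous_on_compose2[OF u]) (auto intro!: continuous_intros)
  then have [measurable]: "e \<in> borel_measurable borel"
    unfolding e_def by (intro borel_measurable_continuous_on_indicator) auto
  define F where "F y s = ennreal (?D * (v (?L y s))\<^sup>2)" for y s
  define E where "E y s = ennreal (?D * (indicator ?I y * indicator ?I s * (v (?L y s) - e y)\<^sup>2))" for y s
  have E: "(\<integral>\<^sup>+y. (\<integral>\<^sup>+s. E y s \<partial>lborel) \<partial>lborel) \<le> ennreal ((norm c)\<^sup>2 * energy)"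
  proof -
    have "E y s = ennreal (?D * (indicator ?I y * indicator ?I s * (v (?L y s) - u (a + y *\<^sub>R b))\<^sup>2))" for y s
      by (auto simp: E_def e_def indicator_def)
    then show ?thesis using strip_up_to_edge[OF assms] by simp
  qed
  have F: "(\<integral>\<^sup>+y. (\<integral>\<^sup>+s. F y s \<partial>lborel) \<partial>lborel) = ennreal (\<integral>x. (v x)\<^sup>2 \<partial>lborel)"
  proof -
    have "(\<integral>\<^sup>+y. (\<integral>\<^sup>+s. F y s \<partial>lborel) \<partial>lborel) = ennreal ?D * (\<integral>\<^sup>+y. (\<integral>\<^sup>+s. ennreal ((v (?L y s))\<^sup>2) \<partial>lborel) \<partial>lborel)"
      by (simp add: F_def ennreal_mult nn_integral_cmult)
    also have "\<dots> = (\<integral>\<^sup>+x. ennreal ((v x)\<^sup>2) \<partial>lborel)"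
      by (intro nn_integral_parallelogram D) measurable
    finally show ?thesis using square_integrable_v by (simp add: nn_integral_square_eq_integral)
  qed
  have [measurable]: "(\<lambda>(y, s). F y s) \<in> borel_measurable (lborel \<Otimes>\<^sub>M lborel)"
      "(\<lambda>(y, s). E y s) \<in> borel_measurable (lborel \<Otimes>\<^sub>M lborel)"
    unfolding F_def E_def by measurable
  have pointwise: "ennreal (?D * (e y)\<^sup>2) * indicator ?I s \<le> 2 * F y s + 2 * E y s" for y s
  proof (cases "y \<in> ?I \<and> s \<in> ?I")
    case True
    have "(e y)\<^sup>2 + (2 * v (?L y s) - e y)\<^sup>2 = 2 * (v (?L y s))\<^sup>2 + 2 * (v (?L y s) - e y)\<^sup>2"
      by (simp add: power2_eq_square algebra_simps)
    then have "(e y)\<^sup>2 \<le> 2 * (v (?L y s))\<^sup>2 + 2 * (v (?L y s) - e y)\<^sup>2"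
      using zero_le_power2[of "2 * v (?L y s) - e y"] by linarith
    then have "?D * (e y)\<^sup>2 \<le> ?D * (2 * (v (?L y s))\<^sup>2 + 2 * (v (?L y s) - e y)\<^sup>2)"
      by (rule mult_left_mono) simp
    then have "ennreal (?D * (e y)\<^sup>2) \<le> ennreal (2 * (?D * (v (?L y s))\<^sup>2) + 2 * (?D * (v (?L y s) - e y)\<^sup>2))"
      by (intro ennreal_leI) (simp add: algebra_simps)
    also have "\<dots> = 2 * F y s + 2 * E y s"
      using True by (simp add: F_def E_def ennreal_mult)
    finally show ?thesis using True by simp
  qed (auto simp: e_def indicator_def)
  have half: "emeasure lborel ?I = ennreal (1/2)"
    by simp
  have "ennreal (1/2) * (ennreal ?D * (\<integral>\<^sup>+y. ennreal ((u (a + y *\<^sub>R b))\<^sup>2) * indicator ?I y \<partial>lborel))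
      = ennreal (1/2) * (ennreal ?D * (\<integral>\<^sup>+y. ennreal ((e y)\<^sup>2) \<partial>lborel))"
    by (intro arg_cong[where f = "\<lambda>x. ennreal (1/2) * (ennreal ?D * x)"] nn_integral_cong) (auto simp: e_def indicator_def)
  also have "\<dots> = (\<integral>\<^sup>+y. (\<integral>\<^sup>+s. ennreal (?D * (e y)\<^sup>2) * indicator ?I s \<partial>lborel) \<partial>lborel)"
    by (simp add: nn_integral_cmult nn_integral_multc half ennreal_mult ac_simps)
  also have "\<dots> \<le> (\<integral>\<^sup>+y. (\<integral>\<^sup>+s. 2 * F y s + 2 * E y s \<partial>lborel) \<partial>lborel)"
    by (intro nn_integral_mono pointwise)
  also have "\<dots> = 2 * (\<integral>\<^sup>+y. (\<integral>\<^sup>+s. F y s \<partial>lborel) \<partial>lborel) + 2 * (\<integral>\<^sup>+y. (\<integral>\<^sup>+s. E y s \<partial>lborel) \<partial>lborel)"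
    by (simp add: nn_integral_add nn_integral_cmult)
  also have "\<dots> \<le> 2 * ennreal (\<integral>x. (v x)\<^sup>2 \<partial>lborel) + 2 * ennreal ((norm c)\<^sup>2 * energy)"
    unfolding F by (intro add_left_mono mult_left_mono E) simp
  finally have "ennreal 2 * (ennreal (1/2) * (ennreal ?D * (\<integral>\<^sup>+y. ennreal ((u (a + y *\<^sub>R b))\<^sup>2) * indicator ?I y \<partial>lborel)))
      \<le> ennreal 2 * (2 * ennreal (\<integral>x. (v x)\<^sup>2 \<partial>lborel) + 2 * ennreal ((norm c)\<^sup>2 * energy))"
    by (rule mult_left_mono) simp
  moreover have "ennreal 2 * (ennreal (1/2) * X) = X" for X
    by (simp only: mult.assoc[symmetric] ennreal_mult[symmetric, of 2 "1/2"]) simp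
  moreover have "ennreal 2 * (2 * ennreal (\<integral>x. (v x)\<^sup>2 \<partial>lborel) + 2 * ennreal ((norm c)\<^sup>2 * energy))
      = ennreal (4 * (\<integral>x. (v x)\<^sup>2 \<partial>lborel) + 4 * (norm c)\<^sup>2 * energy)"
    using energy_nonneg
    by (simp add: ennreal_mult distrib_left mult.assoc[symmetric] flip: ennreal_numeral) (simp add: mult.assoc)
  ultimately show ?thesis by simp
qed

end

section \<open>Weak derivatives and Sobolev seminorms\<close>

definition mi :: "nat \<Rightarrow> nat \<Rightarrow> 2 \<Rightarrow> nat" where
  "mi j k i = (if i = 1 then j else k)"

lemma mi_simps [simp]: "mi j k 1 = j" "mi j k 2 = k"
  by (simp_all add: mi_def)

lemma mi_order_mi [simp]: "mi_order (mi j k) = j + k"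
  by (simp add: mi_order_def sum_2)

lemma mi_surj: "\<alpha> = mi (\<alpha> 1) (\<alpha> 2)"
  using exhaust_2 by (auto simp: mi_def fun_eq_iff)

lemma mi_eq_iff: "mi j k = mi j' k' \<longleftrightarrow> j = j' \<and> k = k'"
  by (metis mi_simps)

lemma multi_indices_0: "{\<alpha>. mi_order \<alpha> = 0} = {mi 0 0}"
  and multi_indices_1: "{\<alpha>. mi_order \<alpha> = 1} = {mi 1 0, mi 0 1}"
  and multi_indices_2: "{\<alpha>. mi_order \<alpha> = 2} = {mi 2 0, mi 1 1, mi 0 2}"
proof -
  have order: "mi_order \<alpha> = \<alpha> 1 + \<alpha> 2" for \<alpha> by (simp add: mi_order_def sum_2)
  have eq: "\<alpha> = mi j k" if "\<alpha> 1 = j" "\<alpha> 2 = k" for \<alpha> j k using mi_surj[of \<alpha>] that by simp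
  have "\<alpha> \<in> {mi 0 0}" if "mi_order \<alpha> = 0" for \<alpha>
  proof -
    have "\<alpha> 1 = 0 \<and> \<alpha> 2 = 0" using that unfolding order by arith
    then show ?thesis using eq by blast
  qed
  then show "{\<alpha>. mi_order \<alpha> = 0} = {mi 0 0}" by auto
  have "\<alpha> \<in> {mi 1 0, mi 0 1}" if "mi_order \<alpha> = 1" for \<alpha>
  proof -
    have "\<alpha> 1 = 1 \<and> \<alpha> 2 = 0 \<or> \<alpha> 1 = 0 \<and> \<alpha> 2 = 1" using that unfolding order by arith
    then show ?thesis using eq by blast
  qed
  then show "{\<alpha>. mi_order \<alpha> = 1} = {mi 1 0, mi 0 1}" by auto
  have "\<alpha> \<in> {mi 2 0, mi 1 1, mi 0 2}" if "mi_order \<alpha> = 2" for \<alpha>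
  proof -
    have "\<alpha> 1 = 2 \<and> \<alpha> 2 = 0 \<or> \<alpha> 1 = 1 \<and> \<alpha> 2 = 1 \<or> \<alpha> 1 = 0 \<and> \<alpha> 2 = 2" using that unfolding order by arith
    then show ?thesis using eq by blast
  qed
  then show "{\<alpha>. mi_order \<alpha> = 2} = {mi 2 0, mi 1 1, mi 0 2}" by auto
qed

lemma multi_partial_mi:
  "multi_partial (mi 0 0) f = f" "multi_partial (mi 1 0) f = partial 1 f" "multi_partial (mi 0 1) f = partial 2 f"
  "multi_partial (mi 2 0) f = partial 1 (partial 1 f)" "multi_partial (mi 1 1) f = partial 1 (partial 2 f)"
  "multi_partial (mi 0 2) f = partial 2 (partial 2 f)"
  "multi_partial (mi (Suc 0) 0) f = partial 1 f" "multi_partial (mi 0 (Suc 0)) f = partial 2 f"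
  "multi_partial (mi (Suc 0) (Suc 0)) f = partial 1 (partial 2 f)"
  by (simp_all add: multi_partial_def numeral_2_eq_2)

lemma L2_norm_nonneg: "L2_norm S v \<ge> 0"
  by (simp add: L2_norm_def)

text \<open>The difference of two weak derivatives is orthogonal to all test functions.\<close>

lemma weak_partial_L2_norm_unique:
  assumes "open S" "g \<in> L2_space S" "g' \<in> L2_space S" "is_weak_partial S \<alpha> v g" "is_weak_partial S \<alpha> v g'"
  shows "L2_norm S g = L2_norm S g'"
proof -
  obtain w where w: "borel_version S g w" using borel_version_exists[OF assms(1,2)] .
  obtain w' where w': "borel_version S g' w'" using borel_version_exists[OF assms(1,3)] .
  note [measurable] = borel_versionD(1)[OF w] borel_versionD(1)[OF w']
  have d: "borel_version S (\<lambda>x. g x - g' x) (\<lambda>x. w x - w' x)" by (rule borel_version_diff[OF w w'])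
  have "(\<integral>x. (w x - w' x)\<^sup>2 \<partial>lborel) \<le> 0\<^sup>2"
  proof (rule L2_norm_by_duality[OF assms(1) borel_versionD(1)[OF d] borel_versionD(3)[OF d]])
    fix \<phi> assume \<phi>: "\<phi> \<in> test_functions S"
    note [measurable] = test_functions_measurable[OF \<phi>]
    have int: "integrable lborel (\<lambda>x. w x * \<phi> x)" "integrable lborel (\<lambda>x. w' x * \<phi> x)"
      using borel_versionD[OF w] borel_versionD[OF w'] test_functions_square_integrable[OF \<phi>]
      by (auto intro!: integrable_mult_square_integrable)
    have "(- 1) ^ mi_order \<alpha> * (LINT x|lebesgue_on S. g x * \<phi> x) = (- 1) ^ mi_order \<alpha> * (LINT x|lebesgue_on S. g' x * \<phi> x)"
      using assms(4,5) \<phi> by (simp add: is_weak_partial_def)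
    then have "(LINT x|lebesgue_on S. g x * \<phi> x) = (LINT x|lebesgue_on S. g' x * \<phi> x)"
      by simp
    then have "(\<integral>x. w x * \<phi> x \<partial>lborel) = (\<integral>x. w' x * \<phi> x \<partial>lborel)"
      using borel_version_integral[OF assms(1) w, of \<phi>] borel_version_integral[OF assms(1) w', of \<phi>] by simp
    then show "\<bar>\<integral>x. (w x - w' x) * \<phi> x \<partial>lborel\<bar> \<le> 0 * sqrt (\<integral>x. (\<phi> x)\<^sup>2 \<partial>lborel)"
      using int by (simp add: left_diff_distrib)
  qed (use borel_versionD(2)[OF d] in auto)
  moreover have "(\<integral>x. (w x - w' x)\<^sup>2 \<partial>lborel) \<ge> 0" by simp
  ultimately have "(\<integral>x. (w x - w' x)\<^sup>2 \<partial>lborel) = 0" by simp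
  then have "AE x in lborel. (w x - w' x)\<^sup>2 = 0"
    using integral_nonneg_eq_0_iff_AE[OF borel_versionD(3)[OF d]] by simp
  then have "AE x in lborel. (w x)\<^sup>2 = (w' x)\<^sup>2"
    by eventually_elim simp
  then have "(\<integral>x. (w x)\<^sup>2 \<partial>lborel) = (\<integral>x. (w' x)\<^sup>2 \<partial>lborel)"
    by (intro integral_cong_AE) auto
  then have "(L2_norm S g)\<^sup>2 = (L2_norm S g')\<^sup>2"
    by (simp add: borel_version_L2_norm[OF assms(1) w] borel_version_L2_norm[OF assms(1) w'])
  then show ?thesis
    using L2_norm_nonneg by (simp add: power2_eq_iff_nonneg)
qed

lemma weak_partial_chosen:
  assumes "g \<in> L2_space S" "is_weak_partial S \<alpha> v g"
  shows "weak_partial S \<alpha> v \<in> L2_space S" "is_weak_partial S \<alpha> v (weak_partial S \<alpha> v)"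
  using someI[of "\<lambda>g. g \<in> L2_space S \<and> is_weak_partial S \<alpha> v g" g] assms
  by (auto simp: weak_partial_def)

lemma L2_norm_weak_partial:
  assumes "open S" "g \<in> L2_space S" "is_weak_partial S \<alpha> v g"
  shows "L2_norm S (weak_partial S \<alpha> v) = L2_norm S g"
  using weak_partial_L2_norm_unique[OF assms(1) _ assms(2) _ assms(3)] weak_partial_chosen[OF assms(2,3)] by blast

lemma sobolev_seminorm_0:
  assumes "open S" "v \<in> L2_space S"
  shows "sobolev_seminorm 0 S v = L2_norm S v"
proof -
  have "is_weak_partial S (mi 0 0) v v"
    by (simp add: is_weak_partial_def multi_partial_mi)
  from L2_norm_weak_partial[OF assms this] show ?thesis
    by (simp add: sobolev_seminorm_def multi_indices_0 L2_norm_nonneg)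
qed

lemma sobolev_seminorm_1:
  assumes "open S" "g1 \<in> L2_space S" "g2 \<in> L2_space S"
    "is_weak_partial S (mi 1 0) v g1" "is_weak_partial S (mi 0 1) v g2"
  shows "(sobolev_seminorm 1 S v)\<^sup>2 = (L2_norm S g1)\<^sup>2 + (L2_norm S g2)\<^sup>2"
  using L2_norm_weak_partial[OF assms(1,2,4)] L2_norm_weak_partial[OF assms(1,3,5)]
  unfolding sobolev_seminorm_def multi_indices_1 by (simp add: mi_eq_iff)

lemma sobolev_seminorm_2:
  "(sobolev_seminorm 2 S v)\<^sup>2 = (L2_norm S (weak_partial S (mi 2 0) v))\<^sup>2
     + (L2_norm S (weak_partial S (mi 1 1) v))\<^sup>2 + (L2_norm S (weak_partial S (mi 0 2) v))\<^sup>2"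
  unfolding sobolev_seminorm_def multi_indices_2 by (simp add: mi_eq_iff)

lemma sobolev_space_weak_partial:
  assumes "v \<in> sobolev_space m S" "mi_order \<alpha> \<le> m"
  shows "weak_partial S \<alpha> v \<in> L2_space S" "is_weak_partial S \<alpha> v (weak_partial S \<alpha> v)"
  using assms weak_partial_chosen[of _ S \<alpha> v] by (auto simp: sobolev_space_def)

lemma is_weak_partial_borel:
  assumes "open S" "borel_version S v v'" "borel_version S g g'" "mi_order \<alpha> = 1"
    and "\<And>\<phi>. \<phi> \<in> test_functions S \<Longrightarrow> multi_partial \<alpha> \<phi> = partial i \<phi>"
  shows "is_weak_partial S \<alpha> v g \<longleftrightarrow>
    (\<forall>\<phi>\<in>test_functions S. (\<integral>x. v' x * partial i \<phi> x \<partial>lborel) = - (\<integral>x. g' x * \<phi> x \<partial>lborel))"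
  unfolding is_weak_partial_def
proof (rule ball_cong)
  fix \<phi> assume \<phi>: "\<phi> \<in> test_functions S"
  show "((LINT x|lebesgue_on S. v x * multi_partial \<alpha> \<phi> x) = (- 1) ^ mi_order \<alpha> * (LINT x|lebesgue_on S. g x * \<phi> x))
    \<longleftrightarrow> ((\<integral>x. v' x * partial i \<phi> x \<partial>lborel) = - (\<integral>x. g' x * \<phi> x \<partial>lborel))"
    using borel_version_integral[OF assms(1,2) test_functions_measurable[OF partial_in_test_functions[OF \<phi>, of i]]]
      borel_version_integral[OF assms(1,3) test_functions_measurable[OF \<phi>]] assms(4) assms(5)[OF \<phi>]
    by simp
qed simp

lemma weak_gradient_of_versions:
  assumes "open S" "bounded S" "borel_version S v v'" "borel_version S g1 g1'" "borel_version S g2 g2'"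
    "is_weak_partial S (mi 1 0) v g1" "is_weak_partial S (mi 0 1) v g2"
  shows "weak_gradient S v' g1' g2'"
    and "weak_gradient.energy g1' g2' = (L2_norm S g1)\<^sup>2 + (L2_norm S g2)\<^sup>2"
proof -
  have "is_weak_partial S (mi 1 0) v g1 \<longleftrightarrow>
    (\<forall>\<phi>\<in>test_functions S. (\<integral>x. v' x * partial 1 \<phi> x \<partial>lborel) = - (\<integral>x. g1' x * \<phi> x \<partial>lborel))"
    by (rule is_weak_partial_borel[OF assms(1,3,4)]) (simp_all add: multi_partial_mi)
  moreover have "is_weak_partial S (mi 0 1) v g2 \<longleftrightarrow>
    (\<forall>\<phi>\<in>test_functions S. (\<integral>x. v' x * partial 2 \<phi> x \<partial>lborel) = - (\<integral>x. g2' x * \<phi> x \<partial>lborel))"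
    by (rule is_weak_partial_borel[OF assms(1,3,5)]) (simp_all add: multi_partial_mi)
  ultimately show wg: "weak_gradient S v' g1' g2'"
    using assms borel_versionD[OF assms(3)] borel_versionD[OF assms(4)] borel_versionD[OF assms(5)]
    by unfold_locales auto
  show "weak_gradient.energy g1' g2' = (L2_norm S g1)\<^sup>2 + (L2_norm S g2)\<^sup>2"
    using borel_version_L2_norm[OF assms(1,4)] borel_version_L2_norm[OF assms(1,5)]
    by (simp add: weak_gradient.energy_def[OF wg])
qed

lemma poincare_L2:
  assumes "open S" "convex S" "bounded S" "h \<ge> 0" "\<And>x y. x \<in> S \<Longrightarrow> y \<in> S \<Longrightarrow> norm (x - y) \<le> h"
    "v \<in> L2_space S" "g1 \<in> L2_space S" "g2 \<in> L2_space S"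
    "is_weak_partial S (mi 1 0) v g1" "is_weak_partial S (mi 0 1) v g2"
  obtains m where "(L2_norm S (\<lambda>x. v x - m))\<^sup>2 \<le> 4 * h\<^sup>2 * ((L2_norm S g1)\<^sup>2 + (L2_norm S g2)\<^sup>2)"
proof -
  obtain v' where v': "borel_version S v v'" using borel_version_exists[OF assms(1,6)] .
  obtain g1' where g1': "borel_version S g1 g1'" using borel_version_exists[OF assms(1,7)] .
  obtain g2' where g2': "borel_version S g2 g2'" using borel_version_exists[OF assms(1,8)] .
  note wg = weak_gradient_of_versions[OF assms(1,3) v' g1' g2' assms(9,10)]
  obtain m where m: "(\<integral>x. (v' x - m * indicator S x)\<^sup>2 \<partial>lborel) \<le> 4 * h\<^sup>2 * weak_gradient.energy g1' g2'"
    using weak_gradient.poincare[OF wg(1) assms(2,4,5)] by metis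
  have "borel_version S (\<lambda>x. v x - m) (\<lambda>x. v' x - indicator S x * m)"
    by (intro borel_version_diff v' borel_version_continuous assms continuous_on_const)
  from borel_version_L2_norm[OF assms(1) this] show ?thesis
    using m wg(2) by (intro that[of m]) (simp add: mult.commute)
qed

lemma trace_L2:
  assumes "open S" "bounded S" "v \<in> L2_space S" "g1 \<in> L2_space S" "g2 \<in> L2_space S"
    "is_weak_partial S (mi 1 0) v g1" "is_weak_partial S (mi 0 1) v g2"
    and cont: "continuous_on (S \<union> {a + y *\<^sub>R b | y. 0 < y \<and> y < 1/2}) v"
    and D: "cross b c \<noteq> 0"
    and inside: "\<And>y s. 0 < y \<Longrightarrow> y < 1/2 \<Longrightarrow> 0 < s \<Longrightarrow> s < 1/2 \<Longrightarrow> a + y *\<^sub>R b + s *\<^sub>R c \<in> S"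
  shows "ennreal \<bar>cross b c\<bar> * (\<integral>\<^sup>+y. ennreal ((v (a + y *\<^sub>R b))\<^sup>2) * indicator {0<..<1/2} y \<partial>lborel)
    \<le> ennreal (4 * (L2_norm S v)\<^sup>2 + 4 * (norm c)\<^sup>2 * ((L2_norm S g1)\<^sup>2 + (L2_norm S g2)\<^sup>2))"
proof -
  have "continuous_on S v" using cont by (rule continuous_on_subset) simp
  then have v': "borel_version S v (\<lambda>x. indicator S x * v x)"
    by (intro borel_version_continuous_on_open assms)
  obtain g1' where g1': "borel_version S g1 g1'" using borel_version_exists[OF assms(1,4)] .
  obtain g2' where g2': "borel_version S g2 g2'" using borel_version_exists[OF assms(1,5)] .
  note wg = weak_gradient_of_versions[OF assms(1,2) v' g1' g2' assms(6,7)]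
  show ?thesis
    using weak_gradient.trace_inequality[OF wg(1) cont _ D inside]
    by (simp add: borel_version_L2_norm[OF assms(1) v'] wg(2))
qed

text \<open>The derivatives along the segments from \<open>x\<close> to \<open>x + axis i 1\<close> add up to the difference of two translates of
  \<open>\<psi>\<close>, and the integral of this difference vanishes.\<close>

lemma integral_partial_test_function:
  assumes \<psi>: "\<psi> \<in> test_functions S"
  shows "(\<integral>x. partial i \<psi> x \<partial>lborel) = 0"
proof -
  note [measurable] = test_functions_measurable[OF \<psi>]
  have \<psi>i: "partial i \<psi> \<in> test_functions S" using \<psi> by (rule partial_in_test_functions)
  note [measurable] = test_functions_measurable[OF \<psi>i]
  let ?e = "axis i 1 :: R2"
  have ax: "?e $ 1 * partial 1 f y + ?e $ 2 * partial 2 f y = partial i f y" for f y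
    using exhaust_2[of i] by (auto simp: axis_def)
  have shift: "(\<integral>x. f (x + d) \<partial>lborel) = (\<integral>x. f x \<partial>lborel)" for f :: "R2 \<Rightarrow> real" and d
    using integral_translate(1)[of f "- d"] by simp
  have int_shift: "integrable lborel (\<lambda>x. f (x + d))" if "integrable lborel f" for f :: "R2 \<Rightarrow> real" and d
    using integral_translate(2)[OF that, of "- d"] by simp
  have line: "(\<integral>t. partial i \<psi> (x + t *\<^sub>R ?e) * indicator {0..1} t \<partial>lborel) = \<psi> (x + ?e) - \<psi> x" for x
  proof -
    have "(\<integral>t. partial i \<psi> (x + t *\<^sub>R ?e) * indicator {0..1} t \<partial>lborel) = \<psi> (x + 1 *\<^sub>R ?e) - \<psi> (x + 0 *\<^sub>R ?e)"
    proof (rule integral_FTC_Icc_real)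
      show "DERIV (\<lambda>t. \<psi> (x + t *\<^sub>R ?e)) t :> partial i \<psi> (x + t *\<^sub>R ?e)" for t
        using has_real_derivative_along_line[of \<psi> x t ?e UNIV] test_functions_differentiable[OF \<psi>] by (simp add: ax)
      have "continuous_on UNIV (\<lambda>t. partial i \<psi> (x + t *\<^sub>R ?e))"
        by (rule continuous_on_compose2[OF test_functions_continuous[OF \<psi>i, of UNIV]])
           (auto intro!: continuous_intros)
      then show "isCont (\<lambda>t. partial i \<psi> (x + t *\<^sub>R ?e)) t" for t
        by (simp add: continuous_on_eq_continuous_at)
    qed simp
    then show ?thesis by simp
  qed
  have int: "integrable (lborel \<Otimes>\<^sub>M lborel) (\<lambda>(t, x). partial i \<psi> (x + t *\<^sub>R ?e) * indicator {0..1} t)"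
  proof (rule lborel_pair.Fubini_integrable)
    have "(\<integral>x. norm (partial i \<psi> (x + t *\<^sub>R ?e) * indicator {0..1} t) \<partial>lborel)
        = (\<integral>x. \<bar>partial i \<psi> x\<bar> \<partial>lborel) * indicator {0..1} t" for t
      using shift[of "\<lambda>x. \<bar>partial i \<psi> x\<bar>" "t *\<^sub>R ?e"] by (simp add: abs_mult)
    then show "integrable lborel (\<lambda>t. \<integral>x. norm (case (t, x) of (t, x) \<Rightarrow> partial i \<psi> (x + t *\<^sub>R ?e) * indicator {0..1} t) \<partial>lborel)"
      by (simp add: integrable_real_indicator)
    show "AE t in lborel. integrable lborel (\<lambda>x. case (t, x) of (t, x) \<Rightarrow> partial i \<psi> (x + t *\<^sub>R ?e) * indicator {0..1} t)"
      using int_shift[OF test_functions_integrable[OF \<psi>i]] by simp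
  qed measurable
  have "0 = (\<integral>x. \<psi> (x + ?e) - \<psi> x \<partial>lborel)"
    using test_functions_integrable[OF \<psi>] int_shift[OF test_functions_integrable[OF \<psi>], of ?e] by (simp add: shift)
  also have "\<dots> = (\<integral>x. (\<integral>t. partial i \<psi> (x + t *\<^sub>R ?e) * indicator {0..1} t \<partial>lborel) \<partial>lborel)"
    by (simp only: line)
  also have "\<dots> = (\<integral>t. (\<integral>x. partial i \<psi> (x + t *\<^sub>R ?e) * indicator {0..1} t \<partial>lborel) \<partial>lborel)"
    by (rule lborel_pair.Fubini_integral[OF int])
  also have "\<dots> = (\<integral>t. (\<integral>x. partial i \<psi> x \<partial>lborel) * indicator {0..1::real} t \<partial>lborel)"
    by (simp add: shift)
  also have "\<dots> = (\<integral>x. partial i \<psi> x \<partial>lborel)"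
    by simp
  finally show ?thesis ..
qed

text \<open>The product of an affine function and a test function is a test function, and the integral of its derivative
  vanishes.\<close>

lemma affine_weak_partial:
  assumes "open S" "bounded S" "mi_order \<alpha> = 1" "\<And>\<phi>. multi_partial \<alpha> \<phi> = partial i \<phi>"
  shows "is_weak_partial S \<alpha> (\<lambda>x. a + b \<bullet> x) (\<lambda>x. b $ i)"
proof -
  have c: "continuous_on UNIV (\<lambda>x. a + b \<bullet> x)" by (intro continuous_intros)
  note v = borel_version_continuous[OF assms(1,2) c]
  note g = borel_version_continuous[OF assms(1,2) continuous_on_const[of UNIV "b $ i"]]
  show ?thesis
  proof (subst is_weak_partial_borel[OF assms(1) v g assms(3,4)], rule ballI)
    fix \<phi> assume \<phi>: "\<phi> \<in> test_functions S"
    have \<phi>i: "partial i \<phi> \<in> test_functions S" using \<phi> by (rule partial_in_test_functions)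
    have smooth: "C_k k (\<lambda>x. a + b \<bullet> x)" for k
      by (intro C_k_add C_k_const C_k_linear bounded_linear_inner_right)
    have p: "(\<lambda>x. (a + b \<bullet> x) * \<phi> x) \<in> test_functions S" "(\<lambda>x. (a + b \<bullet> x) * partial i \<phi> x) \<in> test_functions S"
      by (intro mult_in_test_functions smooth \<phi> \<phi>i)+
    have der: "((\<lambda>x. a + b \<bullet> x) has_derivative (\<lambda>d. b \<bullet> d)) (at x)" for x
      by (auto intro!: derivative_eq_intros)
    have partial_affine: "partial i (\<lambda>x. a + b \<bullet> x) x = b $ i" for x
      using partial_eqI[OF der] by (simp add: inner_axis)
    have "(\<lambda>x. a + b \<bullet> x) differentiable (at x)" for x
      using smooth[of "Suc 0"] by simp
    then have "partial i (\<lambda>x. (a + b \<bullet> x) * \<phi> x) x = (a + b \<bullet> x) * partial i \<phi> x + b $ i * \<phi> x" for x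
      using test_functions_differentiable[OF \<phi>] by (subst partial_mult) (auto simp: partial_affine)
    then have "0 = (\<integral>x. (a + b \<bullet> x) * partial i \<phi> x + b $ i * \<phi> x \<partial>lborel)"
      using integral_partial_test_function[OF p(1), of i] by simp
    also have "\<dots> = (\<integral>x. (a + b \<bullet> x) * partial i \<phi> x \<partial>lborel) + b $ i * (\<integral>x. \<phi> x \<partial>lborel)"
      using test_functions_integrable[OF p(2)] test_functions_integrable[OF \<phi>] by simp
    also have "(\<lambda>x. (a + b \<bullet> x) * partial i \<phi> x) = (\<lambda>x. indicator S x * (a + b \<bullet> x) * partial i \<phi> x)"
      using test_functions_eq_0[OF \<phi>i] by (auto simp: indicator_def fun_eq_iff)
    also have "b $ i * (\<integral>x. \<phi> x \<partial>lborel) = (\<integral>x. indicator S x * b $ i * \<phi> x \<partial>lborel)"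
    proof -
      have "(\<lambda>x. indicator S x * b $ i * \<phi> x) = (\<lambda>x. b $ i * \<phi> x)"
        using test_functions_eq_0[OF \<phi>] by (auto simp: indicator_def fun_eq_iff)
      then show ?thesis by simp
    qed
    finally show "(\<integral>x. indicator S x * (a + b \<bullet> x) * partial i \<phi> x \<partial>lborel) = - (\<integral>x. indicator S x * b $ i * \<phi> x \<partial>lborel)"
      by simp
  qed
qed

lemma affine_weak_gradient:
  assumes "open S" "bounded S"
  shows "is_weak_partial S (mi 1 0) (\<lambda>x. a + b \<bullet> x) (\<lambda>x. b $ 1)"
    and "is_weak_partial S (mi 0 1) (\<lambda>x. a + b \<bullet> x) (\<lambda>x. b $ 2)"
  by (intro affine_weak_partial[OF assms]; simp add: multi_partial_mi)+

lemma is_weak_partial_diff: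
  assumes "open S" "v \<in> L2_space S" "w \<in> L2_space S" "g \<in> L2_space S" "k \<in> L2_space S"
    "is_weak_partial S \<alpha> v g" "is_weak_partial S \<alpha> w k" "mi_order \<alpha> = 1" "\<And>\<phi>. multi_partial \<alpha> \<phi> = partial i \<phi>"
  shows "is_weak_partial S \<alpha> (\<lambda>x. v x - w x) (\<lambda>x. g x - k x)"
proof -
  obtain v' where v': "borel_version S v v'" using borel_version_exists[OF assms(1,2)] .
  obtain w' where w': "borel_version S w w'" using borel_version_exists[OF assms(1,3)] .
  obtain g' where g': "borel_version S g g'" using borel_version_exists[OF assms(1,4)] .
  obtain k' where k': "borel_version S k k'" using borel_version_exists[OF assms(1,5)] .
  note versions = borel_versionD[OF v'] borel_versionD[OF w'] borel_versionD[OF g'] borel_versionD[OF k']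
  show ?thesis
  proof (subst is_weak_partial_borel[OF assms(1) borel_version_diff[OF v' w'] borel_version_diff[OF g' k'] assms(8,9)], rule ballI)
    fix \<phi> assume \<phi>: "\<phi> \<in> test_functions S"
    have \<phi>i: "partial i \<phi> \<in> test_functions S" using \<phi> by (rule partial_in_test_functions)
    have int: "integrable lborel (\<lambda>x. f x * \<psi> x)"
      if "f \<in> borel_measurable borel" "integrable lborel (\<lambda>x. (f x)\<^sup>2)" "\<psi> \<in> test_functions S" for f \<psi> :: "R2 \<Rightarrow> real"
      using that test_functions_measurable[OF that(3)] test_functions_square_integrable[OF that(3)]
      by (intro integrable_mult_square_integrable) auto
    have "(\<integral>x. v' x * partial i \<phi> x \<partial>lborel) = - (\<integral>x. g' x * \<phi> x \<partial>lborel)"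
      using is_weak_partial_borel[OF assms(1) v' g' assms(8,9)] assms(6) \<phi> by blast
    moreover have "(\<integral>x. w' x * partial i \<phi> x \<partial>lborel) = - (\<integral>x. k' x * \<phi> x \<partial>lborel)"
      using is_weak_partial_borel[OF assms(1) w' k' assms(8,9)] assms(7) \<phi> by blast
    ultimately show "(\<integral>x. (v' x - w' x) * partial i \<phi> x \<partial>lborel) = - (\<integral>x. (g' x - k' x) * \<phi> x \<partial>lborel)"
      using versions int \<phi> \<phi>i by (simp add: left_diff_distrib)
  qed
qed

lemma L2_space_diff:
  assumes "open S" "v \<in> L2_space S" "w \<in> L2_space S"
  shows "(\<lambda>x. v x - w x) \<in> L2_space S"
  using borel_version_exists[OF assms(1,2)] borel_version_exists[OF assms(1,3)]
    borel_version_diff borel_version_in_L2[OF assms(1)] by metis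

lemma L2_space_continuous: "open S \<Longrightarrow> bounded S \<Longrightarrow> continuous_on UNIV f \<Longrightarrow> f \<in> L2_space S"
  using borel_version_continuous borel_version_in_L2 by blast

lemma L2_norm_square_diff_le:
  assumes "open S" "v \<in> L2_space S" "w \<in> L2_space S"
  shows "(L2_norm S (\<lambda>x. v x - w x))\<^sup>2 \<le> 2 * (L2_norm S v)\<^sup>2 + 2 * (L2_norm S w)\<^sup>2"
proof -
  obtain v' where v': "borel_version S v v'" using borel_version_exists[OF assms(1,2)] .
  obtain w' where w': "borel_version S w w'" using borel_version_exists[OF assms(1,3)] .
  note d = borel_version_diff[OF v' w']
  have "(v' x - w' x)\<^sup>2 \<le> 2 * (v' x)\<^sup>2 + 2 * (w' x)\<^sup>2" for x
    using zero_le_power2[of "v' x + w' x"] by (simp add: power2_eq_square algebra_simps)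
  then have "(\<integral>x. (v' x - w' x)\<^sup>2 \<partial>lborel) \<le> (\<integral>x. 2 * (v' x)\<^sup>2 + 2 * (w' x)\<^sup>2 \<partial>lborel)"
    using borel_versionD(3)[OF v'] borel_versionD(3)[OF w'] borel_versionD(3)[OF d]
    by (intro integral_mono) auto
  then show ?thesis
    using borel_versionD(3)[OF v'] borel_versionD(3)[OF w']
    by (simp add: borel_version_L2_norm[OF assms(1) v'] borel_version_L2_norm[OF assms(1) w'] borel_version_L2_norm[OF assms(1) d])
qed

lemma L2_norm_square_le_bound:
  assumes "open S" "bounded S" "continuous_on UNIV f" "\<And>x. x \<in> S \<Longrightarrow> \<bar>f x\<bar> \<le> B"
  shows "(L2_norm S f)\<^sup>2 \<le> B\<^sup>2 * measure lborel S"
proof -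
  note f = borel_version_continuous[OF assms(1-3)]
  have fin: "emeasure lborel S < \<infinity>" using assms(2) by (rule emeasure_bounded_finite)
  have S: "S \<in> sets borel" using assms(1) by simp
  have "(indicator S x * f x)\<^sup>2 \<le> B\<^sup>2 * indicator S x" for x
    using power_mono[OF assms(4)[of x] abs_ge_zero, of 2] by (cases "x \<in> S") auto
  then have "(\<integral>x. (indicator S x * f x)\<^sup>2 \<partial>lborel) \<le> (\<integral>x. B\<^sup>2 * indicator S x \<partial>lborel)"
    using borel_versionD(3)[OF f] fin S by (intro integral_mono) (auto simp: integrable_real_indicator)
  then show ?thesis
    using fin S by (simp add: borel_version_L2_norm[OF assms(1) f])
qed

section \<open>Approximation by polynomials on one convex cell\<close>

text \<open>What the interpolant needs to know about an affine function close to \<open>u\<close> on a cell of diameter \<open>h\<close>: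
  the error and its gradient are controlled by one number \<open>X\<close>. The constant is the one of the affine case, where
  Poincare's inequality is applied to the two components of the gradient and once more to the function:
  \<open>32 = 4 * (4 + 4)\<close>.\<close>

definition affine_close :: "R2 set \<Rightarrow> real \<Rightarrow> (R2 \<Rightarrow> real) \<Rightarrow> real \<Rightarrow> R2 \<Rightarrow> real \<Rightarrow> bool" where
  "affine_close S h u \<alpha> \<beta> X \<longleftrightarrow> (\<exists>g1\<in>L2_space S. \<exists>g2\<in>L2_space S.
     is_weak_partial S (mi 1 0) (\<lambda>x. u x - (\<alpha> + \<beta> \<bullet> x)) g1 \<and>
     is_weak_partial S (mi 0 1) (\<lambda>x. u x - (\<alpha> + \<beta> \<bullet> x)) g2 \<and>
     (L2_norm S (\<lambda>x. u x - (\<alpha> + \<beta> \<bullet> x)))\<^sup>2 \<le> 32 * h\<^sup>2 * X\<^sup>2 \<and>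
     (L2_norm S g1)\<^sup>2 + (L2_norm S g2)\<^sup>2 \<le> 32 * X\<^sup>2)"

lemma affine_closeI:
  assumes "g1 \<in> L2_space S" "g2 \<in> L2_space S"
    "is_weak_partial S (mi 1 0) (\<lambda>x. u x - (\<alpha> + \<beta> \<bullet> x)) g1"
    "is_weak_partial S (mi 0 1) (\<lambda>x. u x - (\<alpha> + \<beta> \<bullet> x)) g2"
    "(L2_norm S (\<lambda>x. u x - (\<alpha> + \<beta> \<bullet> x)))\<^sup>2 \<le> 32 * h\<^sup>2 * X\<^sup>2"
    "(L2_norm S g1)\<^sup>2 + (L2_norm S g2)\<^sup>2 \<le> 32 * X\<^sup>2"
  shows "affine_close S h u \<alpha> \<beta> X"
  using assms unfolding affine_close_def by blast

lemma constant_approximation: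
  assumes "open S" "convex S" "bounded S" "h \<ge> 0" "\<And>x y. x \<in> S \<Longrightarrow> y \<in> S \<Longrightarrow> norm (x - y) \<le> h"
    "u \<in> sobolev_space 1 S"
  obtains \<alpha> \<beta> where "affine_close S h u \<alpha> \<beta> (sobolev_seminorm 1 S u)"
proof -
  let ?g1 = "weak_partial S (mi 1 0) u" and ?g2 = "weak_partial S (mi 0 1) u"
  have g: "?g1 \<in> L2_space S" "?g2 \<in> L2_space S" "is_weak_partial S (mi 1 0) u ?g1" "is_weak_partial S (mi 0 1) u ?g2"
    using sobolev_space_weak_partial[OF assms(6)] by simp_all
  have u: "u \<in> L2_space S" using assms(6) by (simp add: sobolev_space_def)
  note sn = sobolev_seminorm_1[OF assms(1) g]
  obtain m where m: "(L2_norm S (\<lambda>x. u x - m))\<^sup>2 \<le> 4 * h\<^sup>2 * ((L2_norm S ?g1)\<^sup>2 + (L2_norm S ?g2)\<^sup>2)"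
    using poincare_L2[OF assms(1-5) u g] by metis
  have zero: "(\<lambda>x. (0 :: R2) $ i) \<in> L2_space S" for i
    using assms by (auto intro!: L2_space_continuous)
  have const: "(\<lambda>x. m + 0 \<bullet> x) \<in> L2_space S"
    using assms by (auto intro!: L2_space_continuous)
  have w1: "is_weak_partial S (mi 1 0) (\<lambda>x. u x - (m + 0 \<bullet> x)) (\<lambda>x. ?g1 x - (0 :: R2) $ 1)"
    by (rule is_weak_partial_diff[OF assms(1) u const g(1) zero g(3) affine_weak_gradient(1)[OF assms(1,3)], where i = 1])
       (simp_all add: multi_partial_mi)
  have w2: "is_weak_partial S (mi 0 1) (\<lambda>x. u x - (m + 0 \<bullet> x)) (\<lambda>x. ?g2 x - (0 :: R2) $ 2)"
    by (rule is_weak_partial_diff[OF assms(1) u const g(2) zero g(4) affine_weak_gradient(2)[OF assms(1,3)], where i = 2])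
       (simp_all add: multi_partial_mi)
  have "affine_close S h u m 0 (sobolev_seminorm 1 S u)"
  proof (rule affine_closeI)
    show "is_weak_partial S (mi 1 0) (\<lambda>x. u x - (m + 0 \<bullet> x)) ?g1" "is_weak_partial S (mi 0 1) (\<lambda>x. u x - (m + 0 \<bullet> x)) ?g2"
      using w1 w2 by simp_all
    have "4 * h\<^sup>2 * (sobolev_seminorm 1 S u)\<^sup>2 \<le> 32 * h\<^sup>2 * (sobolev_seminorm 1 S u)\<^sup>2"
      by (intro mult_right_mono) auto
    from order_trans[OF m[folded sn] this]
    show "(L2_norm S (\<lambda>x. u x - (m + 0 \<bullet> x)))\<^sup>2 \<le> 32 * h\<^sup>2 * (sobolev_seminorm 1 S u)\<^sup>2"
      by simp
    show "(L2_norm S ?g1)\<^sup>2 + (L2_norm S ?g2)\<^sup>2 \<le> 32 * (sobolev_seminorm 1 S u)\<^sup>2"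
      unfolding sn by (rule order_trans[OF _ mult_right_mono[of 1 32]]) auto
  qed (fact g)+
  then show ?thesis by (rule that)
qed

text \<open>Derivatives of test functions are test functions, so the definitions of the derivatives of first and second order
  can be combined; the order of the two derivatives in the mixed one is immaterial by \<open>partial_commute\<close>.\<close>

lemma weak_partial_of_weak_partial:
  assumes "is_weak_partial S (mi 1 0) u g1" "is_weak_partial S (mi 0 1) u g2"
    "is_weak_partial S (mi 2 0) u g11" "is_weak_partial S (mi 1 1) u g12" "is_weak_partial S (mi 0 2) u g22"
  shows "is_weak_partial S (mi 1 0) g1 g11" "is_weak_partial S (mi 0 1) g1 g12"
    "is_weak_partial S (mi 1 0) g2 g12" "is_weak_partial S (mi 0 1) g2 g22"
proof -
  have first: "(LINT x|lebesgue_on S. u x * partial 1 \<phi> x) = - (LINT x|lebesgue_on S. g1 x * \<phi> x)"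
    "(LINT x|lebesgue_on S. u x * partial 2 \<phi> x) = - (LINT x|lebesgue_on S. g2 x * \<phi> x)"
    if "\<phi> \<in> test_functions S" for \<phi>
    using assms(1,2) that by (simp_all add: is_weak_partial_def multi_partial_mi)
  have second: "(LINT x|lebesgue_on S. u x * partial 1 (partial 1 \<phi>) x) = (LINT x|lebesgue_on S. g11 x * \<phi> x)"
    "(LINT x|lebesgue_on S. u x * partial 1 (partial 2 \<phi>) x) = (LINT x|lebesgue_on S. g12 x * \<phi> x)"
    "(LINT x|lebesgue_on S. u x * partial 2 (partial 2 \<phi>) x) = (LINT x|lebesgue_on S. g22 x * \<phi> x)"
    if "\<phi> \<in> test_functions S" for \<phi>
    using assms(3-5) that by (simp_all add: is_weak_partial_def multi_partial_mi)
  have mixed: "(LINT x|lebesgue_on S. g1 x * partial 1 \<phi> x) = - (LINT x|lebesgue_on S. g11 x * \<phi> x)"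
    "(LINT x|lebesgue_on S. g1 x * partial 2 \<phi> x) = - (LINT x|lebesgue_on S. g12 x * \<phi> x)"
    "(LINT x|lebesgue_on S. g2 x * partial 1 \<phi> x) = - (LINT x|lebesgue_on S. g12 x * \<phi> x)"
    "(LINT x|lebesgue_on S. g2 x * partial 2 \<phi> x) = - (LINT x|lebesgue_on S. g22 x * \<phi> x)"
    if \<phi>: "\<phi> \<in> test_functions S" for \<phi>
  proof -
    note D = partial_in_test_functions[OF \<phi>]
    have commute: "partial 2 (partial 1 \<phi>) = partial 1 (partial 2 \<phi>)"
      using partial_commute[OF test_functionsD(1)[OF \<phi>]] by simp
    show "(LINT x|lebesgue_on S. g1 x * partial 1 \<phi> x) = - (LINT x|lebesgue_on S. g11 x * \<phi> x)"
      using first(1)[OF D, of 1] second(1)[OF \<phi>] by simp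
    show "(LINT x|lebesgue_on S. g1 x * partial 2 \<phi> x) = - (LINT x|lebesgue_on S. g12 x * \<phi> x)"
      using first(1)[OF D, of 2] second(2)[OF \<phi>] by simp
    show "(LINT x|lebesgue_on S. g2 x * partial 1 \<phi> x) = - (LINT x|lebesgue_on S. g12 x * \<phi> x)"
      using first(2)[OF D, of 1] second(2)[OF \<phi>] by (simp add: commute)
    show "(LINT x|lebesgue_on S. g2 x * partial 2 \<phi> x) = - (LINT x|lebesgue_on S. g22 x * \<phi> x)"
      using first(2)[OF D, of 2] second(3)[OF \<phi>] by simp
  qed
  show "is_weak_partial S (mi 1 0) g1 g11" "is_weak_partial S (mi 0 1) g1 g12"
    "is_weak_partial S (mi 1 0) g2 g12" "is_weak_partial S (mi 0 1) g2 g22"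
    unfolding is_weak_partial_def multi_partial_mi by (simp_all add: mixed)
qed

text \<open>The gradient of the affine function is the mean of the weak gradient. Poincare's inequality bounds the gradient of
  the error by the second derivatives, and then the error itself, up to its mean, by its gradient.\<close>

lemma affine_approximation:
  assumes "open S" "convex S" "bounded S" "h \<ge> 0" "\<And>x y. x \<in> S \<Longrightarrow> y \<in> S \<Longrightarrow> norm (x - y) \<le> h"
    "u \<in> sobolev_space 2 S"
  obtains \<alpha> \<beta> where "affine_close S h u \<alpha> \<beta> (h * sobolev_seminorm 2 S u)"
proof -
  let ?w = "\<lambda>j k. weak_partial S (mi j k) u"
  have L2: "?w j k \<in> L2_space S" and wp: "is_weak_partial S (mi j k) u (?w j k)" if "j + k \<le> 2" for j k
    using sobolev_space_weak_partial[OF assms(6), of "mi j k"] that by simp_all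
  have u: "u \<in> L2_space S" using assms(6) by (simp add: sobolev_space_def)
  have w: "is_weak_partial S (mi 1 0) u (?w 1 0)" "is_weak_partial S (mi 0 1) u (?w 0 1)"
    "is_weak_partial S (mi 2 0) u (?w 2 0)" "is_weak_partial S (mi 1 1) u (?w 1 1)"
    "is_weak_partial S (mi 0 2) u (?w 0 2)"
    by (rule wp; simp)+
  have L: "?w 1 0 \<in> L2_space S" "?w 0 1 \<in> L2_space S" "?w 2 0 \<in> L2_space S" "?w 1 1 \<in> L2_space S" "?w 0 2 \<in> L2_space S"
    by (rule L2; simp)+
  note second = weak_partial_of_weak_partial[OF w]
  define X where "X = sobolev_seminorm 2 S u"
  have X: "X\<^sup>2 = (L2_norm S (?w 2 0))\<^sup>2 + (L2_norm S (?w 1 1))\<^sup>2 + (L2_norm S (?w 0 2))\<^sup>2"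
    unfolding X_def by (rule sobolev_seminorm_2)
  obtain m1 where m1: "(L2_norm S (\<lambda>x. ?w 1 0 x - m1))\<^sup>2 \<le> 4 * h\<^sup>2 * ((L2_norm S (?w 2 0))\<^sup>2 + (L2_norm S (?w 1 1))\<^sup>2)"
    using poincare_L2[OF assms(1-5) L(1,3,4) second(1,2)] by metis
  obtain m2 where m2: "(L2_norm S (\<lambda>x. ?w 0 1 x - m2))\<^sup>2 \<le> 4 * h\<^sup>2 * ((L2_norm S (?w 1 1))\<^sup>2 + (L2_norm S (?w 0 2))\<^sup>2)"
    using poincare_L2[OF assms(1-5) L(2,4,5) second(3,4)] by metis
  define \<beta> :: R2 where "\<beta> = vector [m1, m2]"
  let ?g1 = "\<lambda>x. ?w 1 0 x - m1" and ?g2 = "\<lambda>x. ?w 0 1 x - m2"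
  have const: "(\<lambda>x. c) \<in> L2_space S" and affine: "(\<lambda>x. \<alpha> + \<beta> \<bullet> x) \<in> L2_space S" for c \<alpha>
    using assms by (auto intro!: L2_space_continuous continuous_intros)
  have g: "?g1 \<in> L2_space S" "?g2 \<in> L2_space S"
    by (intro L2_space_diff assms L const)+
  have w1: "is_weak_partial S (mi 1 0) (\<lambda>x. u x - (\<alpha> + \<beta> \<bullet> x)) ?g1" for \<alpha>
    using is_weak_partial_diff[OF assms(1) u affine L(1) const w(1) affine_weak_gradient(1)[OF assms(1,3)], where i = 1]
    by (simp add: multi_partial_mi \<beta>_def)
  have w2: "is_weak_partial S (mi 0 1) (\<lambda>x. u x - (\<alpha> + \<beta> \<bullet> x)) ?g2" for \<alpha>
    using is_weak_partial_diff[OF assms(1) u affine L(2) const w(2) affine_weak_gradient(2)[OF assms(1,3)], where i = 2]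
    by (simp add: multi_partial_mi \<beta>_def)
  have "(L2_norm S ?g1)\<^sup>2 + (L2_norm S ?g2)\<^sup>2 \<le> 4 * h\<^sup>2 * X\<^sup>2 + 4 * h\<^sup>2 * X\<^sup>2"
    by (intro add_mono order_trans[OF m1] order_trans[OF m2] mult_left_mono) (auto simp: X)
  then have gb: "(L2_norm S ?g1)\<^sup>2 + (L2_norm S ?g2)\<^sup>2 \<le> 8 * (h * X)\<^sup>2"
    by (simp add: power_mult_distrib algebra_simps)
  obtain m where m: "(L2_norm S (\<lambda>x. (u x - (0 + \<beta> \<bullet> x)) - m))\<^sup>2 \<le> 4 * h\<^sup>2 * ((L2_norm S ?g1)\<^sup>2 + (L2_norm S ?g2)\<^sup>2)"
    by (rule poincare_L2[OF assms(1-5) L2_space_diff[OF assms(1) u affine[of 0]] g w1[of 0] w2[of 0]])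
  have eq: "(\<lambda>x. (u x - (0 + \<beta> \<bullet> x)) - m) = (\<lambda>x. u x - (m + \<beta> \<bullet> x))"
    by (rule ext) linarith
  have "0 \<le> 4 * h\<^sup>2" by simp
  from order_trans[OF m mult_left_mono[OF gb this]]
  have "(L2_norm S (\<lambda>x. u x - (m + \<beta> \<bullet> x)))\<^sup>2 \<le> 4 * h\<^sup>2 * (8 * (h * X)\<^sup>2)"
    unfolding eq .
  also have "\<dots> = 32 * h\<^sup>2 * (h * X)\<^sup>2"
    by simp
  finally have error: "(L2_norm S (\<lambda>x. u x - (m + \<beta> \<bullet> x)))\<^sup>2 \<le> 32 * h\<^sup>2 * (h * X)\<^sup>2" .
  have "8 * (h * X)\<^sup>2 \<le> 32 * (h * X)\<^sup>2"
    by simp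
  from affine_closeI[OF g w1 w2 error order_trans[OF gb this]]
  have "affine_close S h u m \<beta> (h * X)" .
  then show ?thesis unfolding X_def by (rule that)
qed

section \<open>Shape regular triangles\<close>

lemma cross_square_plus_inner_square: "(cross p q)\<^sup>2 + (p \<bullet> q)\<^sup>2 = (norm p)\<^sup>2 * (norm q)\<^sup>2"
  unfolding power2_norm_eq_inner cross_def
  by (simp add: inner_vec_def sum_2 power2_eq_square algebra_simps)

lemma cross_scaleR: "cross (s *\<^sub>R p) (t *\<^sub>R q) = s * t * cross p q"
  by (simp add: cross_def algebra_simps)

lemma cross_eq_0_imp_collinear: "cross (b - a) (c - a) = 0 \<Longrightarrow> collinear {a, b, c}"
proof -
  assume "cross (b - a) (c - a) = 0"
  then have "((b - a) \<bullet> (c - a))\<^sup>2 = (norm (b - a) * norm (c - a))\<^sup>2"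
    using cross_square_plus_inner_square[of "b - a" "c - a"] by (simp add: power_mult_distrib)
  then have "\<bar>(b - a) \<bullet> (c - a)\<bar> = norm (b - a) * norm (c - a)"
    using power2_eq_imp_eq[of "\<bar>(b - a) \<bullet> (c - a)\<bar>" "norm (b - a) * norm (c - a)"] by simp
  then have "collinear {0, b - a, c - a}"
    by (simp add: norm_cauchy_schwarz_equal)
  then have "collinear {b, a, c}"
    by (simp add: collinear_3[of b a c])
  then show ?thesis by (simp add: insert_commute)
qed

lemma inner_le_of_angle:
  assumes "0 \<le> \<theta>" "\<theta> \<le> angle_at a b c" "b \<noteq> a" "c \<noteq> a"
  shows "(b - a) \<bullet> (c - a) \<le> cos \<theta> * (norm (b - a) * norm (c - a))"
proof -
  define t where "t = ((b - a) \<bullet> (c - a)) / (norm (b - a) * norm (c - a))"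
  have pos: "norm (b - a) * norm (c - a) > 0" using assms by simp
  have "\<bar>t\<bar> \<le> 1"
    using Cauchy_Schwarz_ineq2[of "b - a" "c - a"] pos by (simp add: t_def abs_div)
  then have "cos (arccos t) = t" "arccos t \<le> pi"
    by (auto simp: arccos_ubound abs_le_iff)
  moreover have "\<theta> \<le> arccos t" using assms(2) by (simp add: angle_at_def t_def)
  ultimately have "t \<le> cos \<theta>"
    using cos_monotone_0_pi_le[of \<theta> "arccos t"] assms(1) by simp
  then show ?thesis using pos by (simp add: t_def divide_le_eq)
qed

text \<open>The angles at the end points of the longest side are acute, so there the bound on the cosine is a bound
  on its modulus, and one of the other two sides has at least half the length.\<close>

lemma cross_lower_bound_longest_side:
  assumes k: "0 \<le> k" "k \<le> 1"
    and "p \<bullet> q \<le> k * (norm p * norm q)" "(- p) \<bullet> (q - p) \<le> k * (norm p * norm (q - p))"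
    and "norm q \<le> norm p" "norm (q - p) \<le> norm p"
  shows "(1 - k\<^sup>2) * (norm p)^4 \<le> 4 * (cross p q)\<^sup>2"
proof -
  have "(norm (q - p))\<^sup>2 = (norm q)\<^sup>2 + (norm p)\<^sup>2 - 2 * (p \<bullet> q)"
    by (simp add: power2_norm_eq_inner inner_diff inner_commute algebra_simps)
  moreover have "(norm (q - p))\<^sup>2 \<le> (norm p)\<^sup>2" using assms(6) by (intro power_mono) auto
  ultimately have acute1: "0 \<le> p \<bullet> q" using zero_le_power2[of "norm q"] by linarith
  have "p \<bullet> q \<le> norm p * norm q" by (rule norm_cauchy_schwarz)
  also have "\<dots> \<le> norm p * norm p" using assms(5) by (intro mult_left_mono) auto
  finally have acute2: "0 \<le> (- p) \<bullet> (q - p)"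
    by (simp add: inner_diff_right power2_norm_eq_inner[symmetric] power2_eq_square)
  have step: "(1 - k\<^sup>2) * (norm p)\<^sup>2 * (norm r)\<^sup>2 \<le> (cross e r)\<^sup>2"
    if "norm e = norm p" "0 \<le> e \<bullet> r" "e \<bullet> r \<le> k * (norm p * norm r)" for e r :: R2
  proof -
    have "(e \<bullet> r)\<^sup>2 \<le> (k * (norm p * norm r))\<^sup>2" using that by (intro power_mono) auto
    then show ?thesis
      using cross_square_plus_inner_square[of e r] that(1) by (simp add: power_mult_distrib algebra_simps)
  qed
  have 1: "(1 - k\<^sup>2) * (norm p)\<^sup>2 * (norm q)\<^sup>2 \<le> (cross p q)\<^sup>2"
    by (rule step) (use acute1 assms in auto)
  have "(1 - k\<^sup>2) * (norm p)\<^sup>2 * (norm (q - p))\<^sup>2 \<le> (cross (- p) (q - p))\<^sup>2"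
    by (rule step) (use acute2 assms in auto)
  also have "cross (- p) (q - p) = - cross p q" by (simp add: cross_def algebra_simps)
  finally have 2: "(1 - k\<^sup>2) * (norm p)\<^sup>2 * (norm (q - p))\<^sup>2 \<le> (cross p q)\<^sup>2" by simp
  have "k\<^sup>2 \<le> 1" using k by (simp add: power_le_one)
  have "norm p \<le> norm q + norm (q - p)"
    using norm_triangle_ineq4[of q "q - p"] by simp
  then have "norm p / 2 \<le> norm q \<or> norm p / 2 \<le> norm (q - p)" by linarith
  then obtain r :: R2 where r: "norm p / 2 \<le> norm r" "(1 - k\<^sup>2) * (norm p)\<^sup>2 * (norm r)\<^sup>2 \<le> (cross p q)\<^sup>2"
    using 1 2 by blast
  have "(norm p / 2)\<^sup>2 \<le> (norm r)\<^sup>2" using r(1) by (intro power_mono) auto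
  then have "(1 - k\<^sup>2) * (norm p)\<^sup>2 * (norm p / 2)\<^sup>2 \<le> (1 - k\<^sup>2) * (norm p)\<^sup>2 * (norm r)\<^sup>2"
    using \<open>k\<^sup>2 \<le> 1\<close> by (intro mult_left_mono mult_nonneg_nonneg) auto
  then have "(1 - k\<^sup>2) * (norm p)\<^sup>2 * (norm p / 2)\<^sup>2 \<le> (cross p q)\<^sup>2"
    using r(2) by linarith
  then show ?thesis
    by (simp add: power_divide power2_eq_square power4_eq_xxxx algebra_simps)
qed

lemma diameter_convex_hull_attained:
  fixes a b c :: R2
  shows "\<exists>x\<in>{a, b, c}. \<exists>y\<in>{a, b, c}. norm (x - y) = diameter (convex hull {a, b, c})"
    and "x \<in> {a, b, c} \<Longrightarrow> y \<in> {a, b, c} \<Longrightarrow> norm (x - y) \<le> diameter (convex hull {a, b, c})"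
proof -
  have comp: "compact (convex hull {a, b, c})" by (simp add: finite_imp_compact_convex_hull)
  show le: "norm (x - y) \<le> diameter (convex hull {a, b, c})" if "x \<in> {a, b, c}" "y \<in> {a, b, c}" for x y
    using diameter_bounded_bound[OF compact_imp_bounded[OF comp], of x y] hull_subset[of "{a, b, c}" convex] that
    by (auto simp: dist_norm)
  obtain u v where uv: "u \<in> convex hull {a, b, c}" "v \<in> convex hull {a, b, c}"
      "dist u v = diameter (convex hull {a, b, c})"
    using diameter_compact_attained[OF comp] by auto
  have "\<exists>x\<in>{a, b, c}. \<exists>y\<in>{a, b, c}. norm (u - v) \<le> norm (x - y)"
    by (rule simplex_extremal_le_exists[OF _ uv(1,2)]) simp
  then obtain x y where "x \<in> {a, b, c}" "y \<in> {a, b, c}" "norm (u - v) \<le> norm (x - y)"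
    by blast
  moreover from this have "norm (x - y) = diameter (convex hull {a, b, c})"
    using le[of x y] uv(3) by (simp add: dist_norm)
  ultimately show "\<exists>x\<in>{a, b, c}. \<exists>y\<in>{a, b, c}. norm (x - y) = diameter (convex hull {a, b, c})"
    by blast
qed

text \<open>The diameter of a triangle is the length of its longest side, and the determinant is the same at each vertex. A
  bound \<open>\<theta> \<le> 1\<close> ensures that \<open>cos \<theta>\<close> is nonnegative.\<close>

lemma cross_lower_bound:
  assumes "card {a, b, c} = 3" and \<theta>: "0 < \<theta>" "\<theta> \<le> 1"
    and angles: "\<And>x y z. {a, b, c} = {x, y, z} \<Longrightarrow> \<theta> \<le> angle_at x y z"
  shows "sin \<theta> / 2 * (diameter (convex hull {a, b, c}))\<^sup>2 \<le> \<bar>cross (b - a) (c - a)\<bar>"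
proof -
  let ?L = "diameter (convex hull {a, b, c})"
  have distinct: "a \<noteq> b" "a \<noteq> c" "b \<noteq> c" using assms(1) by (auto simp: card_insert_if split: if_splits)
  have pi: "\<theta> < pi / 2" using \<theta>(2) pi_gt3 by linarith
  have k: "0 \<le> cos \<theta>" "cos \<theta> \<le> 1" using \<theta> pi by (auto intro: cos_ge_zero)
  have longest: "sin \<theta> / 2 * (norm (y - x))\<^sup>2 \<le> \<bar>cross (y - x) (z - x)\<bar>"
    if xyz: "{a, b, c} = {x, y, z}" "x \<noteq> y" "x \<noteq> z" "y \<noteq> z"
      and long: "norm (z - x) \<le> norm (y - x)" "norm (z - y) \<le> norm (y - x)" for x y z
  proof -
    have eq: "(z - x) - (y - x) = z - y" "- (y - x) = x - y" by simp_all
    have "(1 - (cos \<theta>)\<^sup>2) * (norm (y - x))^4 \<le> 4 * (cross (y - x) (z - x))\<^sup>2"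
    proof (rule cross_lower_bound_longest_side[OF k])
      show "(y - x) \<bullet> (z - x) \<le> cos \<theta> * (norm (y - x) * norm (z - x))"
        using xyz \<theta> by (intro inner_le_of_angle angles) auto
      have "(x - y) \<bullet> (z - y) \<le> cos \<theta> * (norm (x - y) * norm (z - y))"
        using xyz \<theta> by (intro inner_le_of_angle angles) auto
      then show "- (y - x) \<bullet> (z - x - (y - x)) \<le> cos \<theta> * (norm (y - x) * norm (z - x - (y - x)))"
        by (simp only: eq norm_minus_commute[of y x])
    qed (use long in \<open>auto simp: eq\<close>)
    then have "(sin \<theta> / 2 * (norm (y - x))\<^sup>2)\<^sup>2 \<le> \<bar>cross (y - x) (z - x)\<bar>\<^sup>2"
      by (simp add: sin_squared_eq power_mult_distrib power_divide)
    then show ?thesis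
      by (rule power2_le_imp_le) simp
  qed
  obtain x y where xy: "x \<in> {a, b, c}" "y \<in> {a, b, c}" "norm (x - y) = ?L"
    using diameter_convex_hull_attained(1)[of a b c] by blast
  have "norm (a - b) \<le> ?L" using diameter_convex_hull_attained(2)[of a a b c b] by simp
  then have "x \<noteq> y" using xy(3) distinct by auto
  have all: "norm (s - t) \<le> norm (x - y)" if "s \<in> {a, b, c}" "t \<in> {a, b, c}" for s t
    using diameter_convex_hull_attained(2)[OF that] xy(3) by simp
  have c1: "cross (c - b) (a - b) = cross (b - a) (c - a)" "cross (a - c) (b - c) = cross (b - a) (c - a)"
    by (simp_all add: cross_def algebra_simps)
  have "norm (x - y) = norm (b - a) \<or> norm (x - y) = norm (c - b) \<or> norm (x - y) = norm (a - c)"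
    using xy(1,2) \<open>x \<noteq> y\<close> by (auto simp: norm_minus_commute)
  then show ?thesis
  proof (elim disjE)
    assume e: "norm (x - y) = norm (b - a)"
    have "sin \<theta> / 2 * (norm (b - a))\<^sup>2 \<le> \<bar>cross (b - a) (c - a)\<bar>"
      by (rule longest) (use distinct all[of c a] all[of c b] e in auto)
    then show ?thesis using e xy(3) by simp
  next
    assume e: "norm (x - y) = norm (c - b)"
    have "sin \<theta> / 2 * (norm (c - b))\<^sup>2 \<le> \<bar>cross (c - b) (a - b)\<bar>"
      by (rule longest) (use distinct all[of a b] all[of a c] e in auto)
    then show ?thesis using e xy(3) by (simp add: c1)
  next
    assume e: "norm (x - y) = norm (a - c)"
    have "sin \<theta> / 2 * (norm (a - c))\<^sup>2 \<le> \<bar>cross (a - c) (b - c)\<bar>"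
      by (rule longest) (use distinct all[of b c] all[of b a] e in auto)
    then show ?thesis using e xy(3) by (simp add: c1)
  qed
qed

lemma parallelogram_in_triangle:
  fixes a b c :: R2
  assumes "\<not> collinear {a, b, c}" "0 < y" "y < 1 / 2" "0 < s" "s < 1 / 2"
  shows "a + y *\<^sub>R (b - a) + s *\<^sub>R (c - a) \<in> interior (convex hull {a, b, c})"
proof -
  have dim: "DIM(R2) = 2" by simp
  have "a + y *\<^sub>R (b - a) + s *\<^sub>R (c - a) = (1 - y - s) *\<^sub>R a + y *\<^sub>R b + s *\<^sub>R c"
    by (simp add: algebra_simps)
  moreover have "0 < 1 - y - s" "(1 - y - s) + y + s = 1" using assms by auto
  ultimately show ?thesis
    unfolding interior_convex_hull_3_minimal[OF assms(1) dim] mem_Collect_eq using assms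
    by (intro exI[of _ "1 - y - s"] exI[of _ y] exI[of _ s] conjI) auto
qed

text \<open>The parallelogram with the directions of two sides and the length \<open>r / 2\<close> fills a fixed portion of the disk.\<close>

lemma sector_area:
  fixes a b c :: R2
  assumes nc: "\<not> collinear {a, b, c}" and K: "convex hull {a, b, c} \<subseteq> K"
    and r: "0 < r" "r \<le> norm (b - a)" "r \<le> norm (c - a)"
    and \<mu>: "0 \<le> \<mu>" "\<mu> * (norm (b - a) * norm (c - a)) \<le> \<bar>cross (b - a) (c - a)\<bar>"
  shows "ennreal (\<mu> * r\<^sup>2 / 4) \<le> emeasure lborel (interior K \<inter> ball a r)"
proof -
  define s where "s = r / norm (b - a)"
  define t where "t = r / norm (c - a)"
  have pos: "norm (b - a) > 0" "norm (c - a) > 0" using r by linarith+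
  have st: "0 < s" "s \<le> 1" "0 < t" "t \<le> 1" using r pos by (auto simp: s_def t_def)
  let ?p = "s *\<^sub>R (b - a)" and ?q = "t *\<^sub>R (c - a)"
  let ?A = "interior K \<inter> ball a r"
  have A: "?A \<in> sets borel" by (intro borel_open open_Int open_interior open_ball)
  have cr: "cross ?p ?q = s * t * cross (b - a) (c - a)" by (rule cross_scaleR)
  have "cross (b - a) (c - a) \<noteq> 0" using nc cross_eq_0_imp_collinear by blast
  then have D: "cross ?p ?q \<noteq> 0" using st by (simp add: cr)
  have "\<mu> * r\<^sup>2 = s * t * (\<mu> * (norm (b - a) * norm (c - a)))"
    using pos by (simp add: s_def t_def power2_eq_square)
  also have "\<dots> \<le> s * t * \<bar>cross (b - a) (c - a)\<bar>" using \<mu> st by (intro mult_left_mono) auto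
  finally have area: "\<mu> * r\<^sup>2 \<le> \<bar>cross ?p ?q\<bar>" using st by (simp add: cr abs_mult)
  have inside: "a + y *\<^sub>R ?p + z *\<^sub>R ?q \<in> ?A" if "0 < y" "y < 1/2" "0 < z" "z < 1/2" for y z
  proof
    have "y * s \<le> y" "z * t \<le> z" using that st by (intro mult_left_le; simp)+
    then have "y * s < 1/2" "z * t < 1/2" using that by linarith+
    moreover have "0 < y * s" "0 < z * t" using that st by simp_all
    ultimately have "a + (y * s) *\<^sub>R (b - a) + (z * t) *\<^sub>R (c - a) \<in> interior (convex hull {a, b, c})"
      by (intro parallelogram_in_triangle nc)
    then show "a + y *\<^sub>R ?p + z *\<^sub>R ?q \<in> interior K"
      using interior_mono[OF K] by auto
    have "norm (y *\<^sub>R ?p + z *\<^sub>R ?q) \<le> y * r + z * r"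
      using that st pos r by (intro order_trans[OF norm_triangle_ineq]) (simp add: s_def t_def abs_mult)
    also have "\<dots> = (y + z) * r" by (simp add: algebra_simps)
    also have "\<dots> < 1 * r" using that r by (intro mult_strict_right_mono) auto
    finally show "a + y *\<^sub>R ?p + z *\<^sub>R ?q \<in> ball a r"
      by (simp only: mem_ball dist_norm norm_minus_commute[of a] add.assoc add_diff_cancel_left' mult_1)
  qed
  have "ennreal (\<mu> * r\<^sup>2 / 4) = ennreal (\<mu> * r\<^sup>2 * (1/2 * (1/2)))"
    by simp
  also have "\<dots> = ennreal (\<mu> * r\<^sup>2) * ennreal (1/2 * (1/2))"
    using \<mu>(1) by (intro ennreal_mult) auto
  also have "ennreal (1/2 * (1/2)) = ennreal (1/2) * ennreal (1/2)"
    by (intro ennreal_mult) auto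
  also have "ennreal (\<mu> * r\<^sup>2) * (ennreal (1/2) * ennreal (1/2))
      \<le> ennreal \<bar>cross ?p ?q\<bar> * (ennreal (1/2) * ennreal (1/2))"
    using area by (intro mult_right_mono ennreal_leI) auto
  also have "ennreal (1/2) * ennreal (1/2) = (\<integral>\<^sup>+y. (\<integral>\<^sup>+z. indicator {0<..<1/2::real} y * indicator {0<..<1/2::real} z \<partial>lborel) \<partial>lborel)"
  proof -
    have "emeasure lborel {0<..<1/2::real} = ennreal (1/2)" by simp
    moreover have "(\<integral>\<^sup>+y. (\<integral>\<^sup>+z. indicator {0<..<1/2::real} y * indicator {0<..<1/2::real} z \<partial>lborel) \<partial>lborel)
        = emeasure lborel {0<..<1/2::real} * emeasure lborel {0<..<1/2::real}"
      by (simp add: nn_integral_cmult nn_integral_multc)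
    ultimately show ?thesis by (simp only:)
  qed
  also have "ennreal \<bar>cross ?p ?q\<bar> * \<dots>
      \<le> ennreal \<bar>cross ?p ?q\<bar> * (\<integral>\<^sup>+y. (\<integral>\<^sup>+z. indicator ?A (a + y *\<^sub>R ?p + z *\<^sub>R ?q) \<partial>lborel) \<partial>lborel)"
    using inside by (intro mult_left_mono nn_integral_mono) (auto simp: indicator_def)
  also have "\<dots> = (\<integral>\<^sup>+x. indicator ?A x \<partial>lborel)"
    by (rule nn_integral_parallelogram[OF borel_measurable_indicator[OF A] D])
  finally show ?thesis using A by simp
qed

text \<open>The disk lies in a square with sides of length \<open>2 * r\<close>.\<close>

lemma measure_subset_cball_le:
  fixes S :: "R2 set"
  assumes "S \<subseteq> cball a r" "0 \<le> r"
  shows "emeasure lborel S \<le> ennreal (4 * r\<^sup>2)" and "measure lborel S \<le> 4 * r\<^sup>2"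
proof -
  define l u :: R2 where "l = (\<chi> i. a $ i - r)" and "u = (\<chi> i. a $ i + r)"
  have sub: "S \<subseteq> cbox l u"
  proof
    fix x assume "x \<in> S"
    then have "norm (x - a) \<le> r" using assms(1) by (auto simp: dist_norm norm_minus_commute)
    then have "\<bar>x $ i - a $ i\<bar> \<le> r" for i
      using component_le_norm_cart[of "x - a" i] by simp
    then have "a $ i - r \<le> x $ i \<and> x $ i \<le> a $ i + r" for i
      by (smt (verit))
    then show "x \<in> cbox l u" by (simp add: mem_box_cart l_def u_def)
  qed
  have "measure lborel (cbox l u) = 4 * r\<^sup>2"
    using assms(2) by (subst content_cbox_cart) (auto simp: interval_eq_empty_cart l_def u_def UNIV_2 power2_eq_square not_less)
  then have box: "emeasure lborel (cbox l u) = ennreal (4 * r\<^sup>2)"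
    using emeasure_lborel_cbox_finite[of l u] by (simp add: emeasure_eq_ennreal_measure)
  have "emeasure lborel S \<le> emeasure lborel (cbox l u)"
    by (rule emeasure_mono[OF sub]) simp
  then show e: "emeasure lborel S \<le> ennreal (4 * r\<^sup>2)" by (simp add: box)
  show "measure lborel S \<le> 4 * r\<^sup>2"
    unfolding measure_def using enn2real_mono[OF e] by simp
qed

section \<open>Affine functions on shape regular triangles\<close>

lemma inner_R2: "b \<bullet> x = b $ 1 * x $ 1 + b $ 2 * x $ 2" for b x :: R2
  by (simp add: inner_vec_def sum_2)

lemma affine_interpolation:
  fixes a b c :: R2 and x y z :: real
  assumes "cross (b - a) (c - a) \<noteq> 0"
  obtains \<alpha> \<beta> where "\<alpha> + \<beta> \<bullet> a = x" "\<alpha> + \<beta> \<bullet> b = y" "\<alpha> + \<beta> \<bullet> c = z"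
proof -
  let ?D = "cross (b - a) (c - a)"
  define \<beta> :: R2 where "\<beta> = vector [((y - x) * (c - a) $ 2 - (z - x) * (b - a) $ 2) / ?D,
      ((z - x) * (b - a) $ 1 - (y - x) * (c - a) $ 1) / ?D]"
  have "\<beta> \<bullet> (b - a) = ((y - x) * ?D) / ?D" "\<beta> \<bullet> (c - a) = ((z - x) * ?D) / ?D"
    by (simp_all add: \<beta>_def inner_R2 add_divide_distrib[symmetric] cross_def algebra_simps)
  then have "\<beta> \<bullet> (b - a) = y - x" "\<beta> \<bullet> (c - a) = z - x" using assms by simp_all
  then show ?thesis
    by (intro that[of "x - \<beta> \<bullet> a" \<beta>]) (simp_all add: inner_diff_right)
qed

text \<open>Cramer's rule for the two equations that the differences of the nodal values give for \<open>\<beta>\<close>.\<close>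

lemma affine_gradient_bound:
  fixes a b c \<beta> :: R2
  assumes D: "0 < \<mu>" "0 < L" "\<mu> * L\<^sup>2 \<le> \<bar>cross (b - a) (c - a)\<bar>"
    and L: "norm (b - a) \<le> L" "norm (c - a) \<le> L"
    and nodes: "\<bar>\<alpha> + \<beta> \<bullet> a\<bar> \<le> e" "\<bar>\<alpha> + \<beta> \<bullet> b\<bar> \<le> e" "\<bar>\<alpha> + \<beta> \<bullet> c\<bar> \<le> e"
  shows "norm \<beta> \<le> 8 * e / (\<mu> * L)"
proof -
  let ?D = "cross (b - a) (c - a)"
  have d: "\<bar>\<beta> \<bullet> (b - a)\<bar> \<le> 2 * e" "\<bar>\<beta> \<bullet> (c - a)\<bar> \<le> 2 * e"
    using nodes by (simp_all add: inner_diff_right abs_le_iff)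
  have "e \<ge> 0" using nodes(1) by linarith
  have comp: "\<bar>(b - a) $ i\<bar> \<le> L" "\<bar>(c - a) $ i\<bar> \<le> L" for i
    using component_le_norm_cart[of "b - a" i] component_le_norm_cart[of "c - a" i] L by linarith+
  have id: "\<beta> $ 1 * ?D = (\<beta> \<bullet> (b - a)) * (c - a) $ 2 - (\<beta> \<bullet> (c - a)) * (b - a) $ 2"
    "\<beta> $ 2 * ?D = (\<beta> \<bullet> (c - a)) * (b - a) $ 1 - (\<beta> \<bullet> (b - a)) * (c - a) $ 1"
    by (simp_all add: inner_R2 cross_def algebra_simps)
  have bound: "\<bar>s * t - s' * t'\<bar> \<le> 4 * e * L" if "\<bar>s\<bar> \<le> 2 * e" "\<bar>t\<bar> \<le> L" "\<bar>s'\<bar> \<le> 2 * e" "\<bar>t'\<bar> \<le> L" for s t s' t'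
  proof -
    have "\<bar>s * t - s' * t'\<bar> \<le> \<bar>s\<bar> * \<bar>t\<bar> + \<bar>s'\<bar> * \<bar>t'\<bar>"
      using abs_triangle_ineq4[of "s * t" "s' * t'"] by (simp add: abs_mult)
    also have "\<dots> \<le> 2 * e * L + 2 * e * L" using that \<open>e \<ge> 0\<close> by (intro add_mono mult_mono) auto
    finally show ?thesis by (simp add: mult_ac)
  qed
  have "\<bar>\<beta> $ 1\<bar> * \<bar>?D\<bar> \<le> 4 * e * L" "\<bar>\<beta> $ 2\<bar> * \<bar>?D\<bar> \<le> 4 * e * L"
    unfolding abs_mult[symmetric] id by (intro bound d comp)+
  then have "(\<bar>\<beta> $ 1\<bar> + \<bar>\<beta> $ 2\<bar>) * \<bar>?D\<bar> \<le> 8 * e * L" by (simp add: distrib_right)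
  moreover have "norm \<beta> \<le> \<bar>\<beta> $ 1\<bar> + \<bar>\<beta> $ 2\<bar>"
    using norm_le_l1_cart[of \<beta>] by (simp add: UNIV_2)
  ultimately have "norm \<beta> * (\<mu> * L\<^sup>2) \<le> 8 * e * L"
    using mult_mono[OF \<open>norm \<beta> \<le> _\<close> D(3)] D by (smt (verit) abs_ge_zero mult_nonneg_nonneg norm_ge_zero zero_le_power2)
  then have "(norm \<beta> * (\<mu> * L)) * L \<le> (8 * e) * L" by (simp add: power2_eq_square mult_ac)
  then have "norm \<beta> * (\<mu> * L) \<le> 8 * e" using D(2) by simp
  then show ?thesis using D by (simp add: le_divide_eq)
qed

text \<open>The integral is \<open>A\<^sup>2 / 8 + (3 * A + B)\<^sup>2 / 24\<close>.\<close>

lemma affine_value_le_integral: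
  fixes A B :: real
  shows "ennreal (A\<^sup>2 / 8) \<le> (\<integral>\<^sup>+y. ennreal ((A + B * y)\<^sup>2) * indicator {0<..<1/2} y \<partial>lborel)"
proof -
  let ?F = "\<lambda>y. A\<^sup>2 * y + A * B * y\<^sup>2 + B\<^sup>2 * y ^ 3 / 3"
  have "(\<integral>\<^sup>+y. ennreal ((A + B * y)\<^sup>2) * indicator {0..1/2} y \<partial>lborel) = ennreal (?F (1/2) - ?F 0)"
  proof (rule nn_integral_FTC_Icc)
    show "(?F has_real_derivative (A + B * y)\<^sup>2) (at y)" for y
      by (auto intro!: derivative_eq_intros simp: power2_eq_square algebra_simps)
  qed auto
  also have "?F (1/2) - ?F 0 = A\<^sup>2 / 8 + (3 * A + B)\<^sup>2 / 24"
    by (simp add: power2_eq_square power3_eq_cube algebra_simps add_divide_distrib)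
  finally have "ennreal (A\<^sup>2 / 8) \<le> (\<integral>\<^sup>+y. ennreal ((A + B * y)\<^sup>2) * indicator {0..1/2} y \<partial>lborel)"
    by (simp add: ennreal_leI)
  also have "\<dots> = (\<integral>\<^sup>+y. ennreal ((A + B * y)\<^sup>2) * indicator {0<..<1/2} y \<partial>lborel)"
  proof (rule nn_integral_cong_AE)
    have "AE y in lborel. y \<noteq> 0 \<and> y \<noteq> (1/2::real)"
      using AE_lborel_singleton[of 0] AE_lborel_singleton[of "1/2::real"] by eventually_elim auto
    then show "AE y in lborel. ennreal ((A + B * y)\<^sup>2) * indicator {0..1/2} y = ennreal ((A + B * y)\<^sup>2) * indicator {0<..<1/2} y"
      by eventually_elim (auto simp: indicator_def)
  qed
  finally show ?thesis .
qed

section \<open>Fans of cells around a vertex\<close>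

text \<open>The quantitative content of mesh regularity: \<open>\<mu>\<close> measures the shape of the straight triangles, and \<open>\<kappa>\<close> compares a
  curved cell with the triangle inside it.\<close>

locale shape_regular_mesh =
  fixes \<Omega> :: "R2 set" and T :: "R2 set set" and N :: "R2 set \<Rightarrow> R2 set" and \<kappa> \<mu> :: real
  assumes open_domain: "open \<Omega>" and conforming: "conforming_mesh \<Omega> T N"
    and \<kappa>_pos: "\<kappa> > 0" and \<mu>_pos: "\<mu> > 0"
    and size: "\<And>K. K \<in> T \<Longrightarrow> diameter K \<le> \<kappa> * diameter (convex hull (N K))"
    and shape: "\<And>K a b c. K \<in> T \<Longrightarrow> N K = {a, b, c} \<Longrightarrow>
      \<mu> * (diameter (convex hull (N K)))\<^sup>2 \<le> \<bar>cross (b - a) (c - a)\<bar>"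
begin

lemma finite_T: "finite T" and Union_T: "\<Union>T = closure \<Omega>"
  using conforming by (simp_all add: conforming_mesh_def)

lemma interior_cell_subset: "K \<in> T \<Longrightarrow> interior K \<subseteq> \<Omega>"
  using conforming by (simp add: conforming_mesh_def)

lemma cell:
  assumes "K \<in> T"
  shows "compact K" "convex K" "card (N K) = 3" "\<not> collinear (N K)" "convex hull (N K) \<subseteq> K" "N K \<subseteq> K"
proof -
  have "straight_cell K (N K) \<or> curved_cell \<Omega> K (N K)"
    using assms conforming by (simp add: conforming_mesh_def)
  then have "compact K \<and> convex K \<and> card (N K) = 3 \<and> \<not> collinear (N K) \<and> convex hull (N K) \<subseteq> K"
  proof
    assume s: "straight_cell K (N K)"
    then have K: "K = convex hull (N K)" and c: "card (N K) = 3" and nc: "\<not> collinear (N K)"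
      by (auto simp: straight_cell_def)
    have "finite (N K)" using c by (metis card.infinite zero_neq_numeral)
    then have "compact (convex hull (N K))" by (rule finite_imp_compact_convex_hull)
    then show ?thesis using c nc convex_convex_hull[of "N K"] K by (metis order_refl)
  next
    assume s: "curved_cell \<Omega> K (N K)"
    then show ?thesis by (auto simp: curved_cell_def intro: hull_minimal[THEN subsetD])
  qed
  then show "compact K" "convex K" "card (N K) = 3" "\<not> collinear (N K)" "convex hull (N K) \<subseteq> K" "N K \<subseteq> K"
    using hull_subset[of "N K" convex] by auto
qed

lemma finite_nodes: "K \<in> T \<Longrightarrow> finite (N K)"
  using cell(3)[of K] card_ge_0_finite[of "N K"] by simp

lemma bounded_interior: "K \<in> T \<Longrightarrow> bounded (interior K)"
  using cell(1) bounded_interior compact_imp_bounded by blast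

lemma cell_norm_le: "K \<in> T \<Longrightarrow> x \<in> K \<Longrightarrow> y \<in> K \<Longrightarrow> norm (x - y) \<le> diameter K"
  using diameter_bounded_bound[of K x y] cell(1)[of K] by (simp add: compact_imp_bounded dist_norm)

lemma vertices:
  assumes "K \<in> T" "a \<in> N K"
  obtains b c where "N K = {a, b, c}" "a \<noteq> b" "a \<noteq> c" "b \<noteq> c"
proof -
  have "card (N K - {a}) = 2" using cell(3)[OF assms(1)] assms(2) by (simp add: card_Diff_singleton)
  then obtain b c where bc: "N K - {a} = {b, c}" "b \<noteq> c" by (auto simp: card_2_iff)
  then have "N K = {a, b, c}" "a \<noteq> b" "a \<noteq> c" using assms(2) by auto
  then show ?thesis using that bc(2) by blast
qed

lemma third_node:
  assumes "K \<in> T" "a \<in> N K" "b \<in> N K" "a \<noteq> b"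
  obtains c where "N K = {a, b, c}" "c \<noteq> a" "c \<noteq> b"
proof -
  obtain x y where "N K = {a, x, y}" "a \<noteq> x" "a \<noteq> y" "x \<noteq> y" using vertices[OF assms(1,2)] .
  then show ?thesis using that assms(3,4) by (cases "b = x") auto
qed

lemma side_le:
  assumes "K \<in> T" "a \<in> N K" "b \<in> N K"
  shows "norm (a - b) \<le> diameter (convex hull (N K))"
proof -
  obtain c d where "N K = {a, c, d}" using vertices[OF assms(1,2)] .
  then show ?thesis using diameter_convex_hull_attained(2)[of a a c d b] assms(3) by simp
qed

lemma triangle_diameter_pos: "K \<in> T \<Longrightarrow> 0 < diameter (convex hull (N K))"
proof -
  assume K: "K \<in> T"
  then obtain a where "a \<in> N K" using cell(3)[OF K] by fastforce
  then obtain b c where "N K = {a, b, c}" "a \<noteq> b" using vertices[OF K] by metis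
  then have "0 < norm (a - b)" "norm (a - b) \<le> diameter (convex hull (N K))"
    using side_le[OF K, of a b] by auto
  then show ?thesis by linarith
qed

lemma triangle_diameter_le: "K \<in> T \<Longrightarrow> diameter (convex hull (N K)) \<le> diameter K"
  using cell(5)[of K] cell(1)[of K] by (intro diameter_subset compact_imp_bounded)

lemma diameter_pos: "K \<in> T \<Longrightarrow> 0 < diameter K"
  using triangle_diameter_pos[of K] triangle_diameter_le[of K] by linarith

lemma interior_triangle:
  assumes "K \<in> T"
  shows "interior (convex hull (N K)) \<noteq> {}" "interior (convex hull (N K)) \<subseteq> interior K"
proof -
  obtain a where a: "a \<in> N K" using cell(3)[OF assms] by fastforce
  then obtain b c where N: "N K = {a, b, c}" using vertices[OF assms a] by metis
  then have "a + (1/4) *\<^sub>R (b - a) + (1/4) *\<^sub>R (c - a) \<in> interior (convex hull (N K))"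
    using cell(4)[OF assms] by (simp only:) (rule parallelogram_in_triangle; simp)
  then show "interior (convex hull (N K)) \<noteq> {}" by blast
  show "interior (convex hull (N K)) \<subseteq> interior K"
    by (intro interior_mono cell assms)
qed

lemma cell_intersection:
  assumes "K \<in> T" "K' \<in> T" "K \<noteq> K'"
  shows "interior K \<inter> interior K' = {}" "K \<inter> K' = convex hull (N K \<inter> N K')"
  using assms conforming by (simp_all add: conforming_mesh_def)

text \<open>Otherwise \<open>a\<close> would lie in the convex hull of the other two vertices of its triangle.\<close>

lemma vertex_of_every_cell_containing_it:
  assumes "K \<in> T" "K' \<in> T" "a \<in> N K" "a \<in> K'"
  shows "a \<in> N K'"
proof (rule ccontr)
  assume a: "a \<notin> N K'"
  then have "K \<noteq> K'" using assms by auto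
  then have "a \<in> convex hull (N K \<inter> N K')"
    using cell_intersection(2)[OF assms(1,2)] assms(3,4) cell(6)[OF assms(1)] by blast
  also have "\<dots> \<subseteq> convex hull (N K - {a})" using a by (intro hull_mono) auto
  also have "\<dots> \<subseteq> affine hull (N K - {a})" by (rule convex_hull_subset_affine_hull)
  finally have "affine_dependent (N K)" using assms(3) by (auto simp: affine_dependent_def)
  moreover obtain b c where "N K = {a, b, c}" using vertices[OF assms(1,3)] by metis
  ultimately show False using cell(4)[OF assms(1)] by (simp add: collinear_3_eq_affine_dependent)
qed

text \<open>The intersection of two cells is the convex hull of their common nodes. There cannot be three of them, as then
  the interiors would overlap; with \<open>x\<close> besides \<open>a\<close> there are two, so the cells share a side. This side runs through the
  domain because it contains the point \<open>x\<close> of the domain.\<close>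

lemma shared_side:
  assumes K: "K \<in> T" "K' \<in> T" "K \<noteq> K'" and a: "a \<in> N K" "a \<in> N K'"
    and x: "x \<in> K" "x \<in> K'" "x \<in> \<Omega>" "x \<noteq> a"
  obtains b where "b \<noteq> a" "b \<in> N K" "b \<in> N K'" "open_segment a b \<subseteq> \<Omega>" "x \<in> closed_segment a b"
proof -
  let ?S = "N K \<inter> N K'"
  have int: "K \<inter> K' = convex hull ?S" and disj: "interior K \<inter> interior K' = {}"
    using cell_intersection[OF K] by auto
  have hull: "x \<in> convex hull ?S" using x int by blast
  obtain p q where pq: "N K = {a, p, q}" "a \<noteq> p" "a \<noteq> q" "p \<noteq> q" using vertices[OF K(1) a(1)] .
  have "N K \<noteq> N K'"
  proof
    assume "N K = N K'"
    then have "interior (convex hull (N K)) \<subseteq> interior K \<inter> interior K'"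
      using interior_triangle(2)[OF K(1)] interior_triangle(2)[OF K(2)] by auto
    then show False using disj interior_triangle(1)[OF K(1)] by blast
  qed
  moreover have "N K \<subseteq> N K' \<Longrightarrow> N K = N K'"
    using card_subset_eq[OF finite_nodes[OF K(2)]] cell(3)[OF K(1)] cell(3)[OF K(2)] by simp
  ultimately have "\<not> N K \<subseteq> N K'" by blast
  then have one: "\<not> (p \<in> N K' \<and> q \<in> N K')" using a(2) unfolding pq(1) by simp
  have "?S \<noteq> {a}"
  proof
    assume "?S = {a}"
    then show False using hull x(4) by simp
  qed
  then have "?S = {a, p} \<or> ?S = {a, q}" using one pq(1) a(2) by blast
  then obtain b where b: "?S = {a, b}" "b \<noteq> a" using pq(2,3) by metis
  have seg: "K \<inter> K' = closed_segment a b"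
    using int b by (simp add: segment_convex_hull)
  have "y \<notin> interior K" if "y \<in> K \<inter> K'" for y
  proof
    assume y: "y \<in> interior K"
    have "interior K' \<noteq> {}" using interior_triangle[OF K(2)] by blast
    then have "closure (interior K') = K'"
      using convex_closure_interior[OF cell(2)[OF K(2)]] cell(1)[OF K(2)] by (simp add: compact_imp_closed)
    then have "y \<in> closure (interior K')" using that by blast
    then have "interior K \<inter> interior K' \<noteq> {}"
      using y open_Int_closure_eq_empty[of "interior K" "interior K'"] by blast
    then show False using disj by blast
  qed
  then have "closed_segment a b \<subseteq> frontier K"
    using seg closure_subset[of K] unfolding frontier_def by blast
  moreover have "b \<in> N K" "b \<in> N K'" using b by blast+
  moreover have "open_segment a b \<subseteq> \<Omega> \<or> closed_segment a b \<subseteq> frontier \<Omega>"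
    using conforming K(1) a(1) calculation b(2) unfolding conforming_mesh_def by metis
  moreover have "\<not> closed_segment a b \<subseteq> frontier \<Omega>"
    using x seg open_domain by (auto simp: frontier_def interior_open)
  ultimately show ?thesis using that b(2) x seg by blast
qed

text \<open>A side on the boundary of the domain, as on a slit, must not link the cells on its two sides: \<open>u\<close> may jump
  there.\<close>

definition linked :: "R2 \<Rightarrow> (R2 set \<times> R2 set) set" where
  "linked a = {(K, K'). K \<in> T \<and> K' \<in> T \<and>
     (\<exists>b. b \<noteq> a \<and> {a, b} \<subseteq> N K \<inter> N K' \<and> open_segment a b \<subseteq> \<Omega>)}"

lemma sym_linked: "sym (linked a)"
  unfolding linked_def sym_def by blast

lemma near_vertex:
  assumes "K \<in> T" "a \<in> N K" "0 < r"
  obtains x where "x \<in> K" "x \<in> ball a r" "x \<noteq> a"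
proof -
  obtain b c where N: "N K = {a, b, c}" "a \<noteq> b" using vertices[OF assms(1,2)] by metis
  define t where "t = min 1 (r / (2 * norm (b - a)))"
  have pos: "norm (b - a) > 0" using N by simp
  have t: "0 < t" "t \<le> 1" using pos assms(3) by (simp_all add: t_def)
  have "t * norm (b - a) \<le> r / (2 * norm (b - a)) * norm (b - a)"
    using pos by (intro mult_right_mono) (auto simp: t_def)
  also have "\<dots> < r" using pos assms(3) by simp
  finally have near: "t * norm (b - a) < r" .
  have "a \<in> K" "b \<in> K" using cell(6)[OF assms(1)] N by auto
  then have "(1 - t) *\<^sub>R a + t *\<^sub>R b \<in> K" using t by (intro convexD[OF cell(2)[OF assms(1)]]) auto
  moreover have "(1 - t) *\<^sub>R a + t *\<^sub>R b = a + t *\<^sub>R (b - a)" by (simp add: algebra_simps)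
  ultimately have "a + t *\<^sub>R (b - a) \<in> K" by simp
  then show ?thesis using near t N by (intro that[of "a + t *\<^sub>R (b - a)"]) (auto simp: dist_norm)
qed

text \<open>Otherwise the cells that chains of links connect to \<open>K\<close>, and the other cells at \<open>a\<close>, would disconnect a punctured
  disk.\<close>

lemma interior_fan_connected:
  assumes a: "a \<in> \<Omega>" and K: "K \<in> T" "a \<in> N K" and K': "K' \<in> T" "a \<in> N K'"
  shows "(K, K') \<in> (linked a)\<^sup>*"
proof (rule ccontr)
  assume not: "(K, K') \<notin> (linked a)\<^sup>*"
  let ?C = "{L \<in> T. a \<in> N L \<and> (K, L) \<in> (linked a)\<^sup>*}"
  let ?D = "{L \<in> T. a \<in> N L \<and> (K, L) \<notin> (linked a)\<^sup>*}"
  have closed: "closed (\<Union>F)" if "F \<subseteq> T" for F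
    using that finite_subset[OF that finite_T] cell(1) by (intro closed_Union) (auto simp: compact_imp_closed)
  have "open (\<Omega> - \<Union>{L \<in> T. a \<notin> L})" by (intro open_Diff open_domain closed) auto
  moreover have "a \<in> \<Omega> - \<Union>{L \<in> T. a \<notin> L}" using a by auto
  ultimately obtain r where r: "0 < r" "ball a r \<subseteq> \<Omega> - \<Union>{L \<in> T. a \<notin> L}"
    by (meson open_contains_ball)
  let ?P = "ball a r - {a}"
  have "connected ?P" by (intro connected_open_delete open_ball connected_ball) simp
  moreover have "\<Union>?C \<inter> \<Union>?D \<inter> ?P = {}"
  proof (rule ccontr)
    assume "\<Union>?C \<inter> \<Union>?D \<inter> ?P \<noteq> {}"
    then obtain x L M where x: "x \<in> ?P" and L: "L \<in> ?C" "x \<in> L" and M: "M \<in> ?D" "x \<in> M" by blast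
    have "L \<noteq> M" using L M by blast
    have "x \<in> \<Omega>" "x \<noteq> a" using x r(2) by auto
    obtain b where "b \<noteq> a" "b \<in> N L" "b \<in> N M" "open_segment a b \<subseteq> \<Omega>"
      by (rule shared_side[of L M a x]) (use L M \<open>L \<noteq> M\<close> \<open>x \<in> \<Omega>\<close> \<open>x \<noteq> a\<close> in auto)
    then have "(L, M) \<in> linked a" using L M by (auto simp: linked_def)
    then have "(K, M) \<in> (linked a)\<^sup>*" using L by (auto intro: rtrancl_into_rtrancl)
    then show False using M by blast
  qed
  moreover have "?P \<subseteq> \<Union>?C \<union> \<Union>?D"
  proof
    fix x assume x: "x \<in> ?P"
    then have "x \<in> closure \<Omega>" using r(2) closure_subset by blast
    then obtain L where L: "L \<in> T" "x \<in> L" using Union_T by blast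
    then have "a \<in> L" using x r(2) by blast
    then have "a \<in> N L" using vertex_of_every_cell_containing_it[OF K(1) L(1) K(2)] by blast
    then show "x \<in> \<Union>?C \<union> \<Union>?D" using L by blast
  qed
  moreover have "closed (\<Union>?C)" "closed (\<Union>?D)" by (intro closed; blast)+
  ultimately have "\<Union>?C \<inter> ?P = {} \<or> \<Union>?D \<inter> ?P = {}" by (rule connected_closedD)
  moreover obtain x where "x \<in> K" "x \<in> ball a r" "x \<noteq> a" using near_vertex[OF K r(1)] .
  then have "\<Union>?C \<inter> ?P \<noteq> {}" using K by blast
  moreover obtain x where "x \<in> K'" "x \<in> ball a r" "x \<noteq> a" using near_vertex[OF K' r(1)] .
  then have "\<Union>?D \<inter> ?P \<noteq> {}" using K' not by blast
  ultimately show False by blast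
qed

text \<open>The interiors of the cells at a vertex are disjoint, and each fills a fixed portion of a small disk.\<close>

lemma card_cells_at_vertex: "real (card {K \<in> T. a \<in> N K}) \<le> 16 / \<mu>"
proof -
  let ?C = "{K \<in> T. a \<in> N K}"
  have fin: "finite ?C" using finite_T by simp
  define D where "D = (\<Union>K\<in>?C. (\<lambda>b. norm (b - a)) ` (N K - {a}))"
  have "finite D" using fin finite_nodes unfolding D_def by blast
  define r where "r = Min (insert 1 D)"
  have r_pos: "0 < r" unfolding r_def using \<open>finite D\<close> by (subst Min_gr_iff) (auto simp: D_def)
  have r_le: "r \<le> norm (b - a)" if "K \<in> ?C" "b \<in> N K" "b \<noteq> a" for K b
    unfolding r_def using \<open>finite D\<close> that by (intro Min_le) (auto simp: D_def)
  have sector: "ennreal (\<mu> * r\<^sup>2 / 4) \<le> emeasure lborel (interior K \<inter> ball a r)" if K: "K \<in> ?C" for K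
  proof -
    have KT: "K \<in> T" and aK: "a \<in> N K" using K by auto
    obtain b c where N: "N K = {a, b, c}" "a \<noteq> b" "a \<noteq> c" "b \<noteq> c" using vertices[OF KT aK] .
    have "norm (b - a) * norm (c - a) \<le> diameter (convex hull (N K)) * diameter (convex hull (N K))"
      using side_le[OF KT] N triangle_diameter_pos[OF KT] by (intro mult_mono) auto
    then have "\<mu> * (norm (b - a) * norm (c - a)) \<le> \<mu> * (diameter (convex hull (N K)))\<^sup>2"
      using \<mu>_pos by (simp add: power2_eq_square)
    also have "\<dots> \<le> \<bar>cross (b - a) (c - a)\<bar>" by (rule shape[OF KT N(1)])
    finally show ?thesis
      using cell(4,5)[OF KT] r_le[OF K, of b] r_le[OF K, of c] N r_pos \<mu>_pos
      by (intro sector_area[of a b c]) auto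
  qed
  have disj: "disjoint_family_on (\<lambda>K. interior K \<inter> ball a r) ?C"
    unfolding disjoint_family_on_def using cell_intersection(1) by blast
  have "(\<Sum>K\<in>?C. ennreal (\<mu> * r\<^sup>2 / 4)) \<le> (\<Sum>K\<in>?C. emeasure lborel (interior K \<inter> ball a r))"
    by (intro sum_mono sector)
  also have "\<dots> = emeasure lborel (\<Union>K\<in>?C. interior K \<inter> ball a r)"
    by (rule sum_emeasure[OF _ disj fin]) auto
  also have "\<dots> \<le> ennreal (4 * r\<^sup>2)"
    by (rule measure_subset_cball_le(1)[of _ a]) (use r_pos in auto)
  also have "(\<Sum>K\<in>?C. ennreal (\<mu> * r\<^sup>2 / 4)) = ennreal (real (card ?C) * (\<mu> * r\<^sup>2 / 4))"
  proof -
    have "(\<Sum>K\<in>?C. ennreal x) = ennreal (real (card ?C) * x)" if "x \<ge> 0" for x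
      using that by (simp add: ennreal_mult ennreal_of_nat_eq_real_of_nat)
    then show ?thesis using \<mu>_pos by simp
  qed
  finally have "real (card ?C) * (\<mu> * r\<^sup>2 / 4) \<le> 4 * r\<^sup>2"
    using r_pos by (subst (asm) ennreal_le_iff) auto
  then have "real (card ?C) * \<mu> * r\<^sup>2 \<le> 16 * r\<^sup>2" by (simp add: algebra_simps)
  then have "real (card ?C) * \<mu> \<le> 16" using r_pos by simp
  then show ?thesis using \<mu>_pos by (simp add: le_divide_eq)
qed

lemma card_linked: "finite (linked a)" "real (card (linked a)) \<le> (16 / \<mu>)\<^sup>2"
proof -
  let ?C = "{K \<in> T. a \<in> N K}"
  have fin: "finite ?C" using finite_T by simp
  have sub: "linked a \<subseteq> ?C \<times> ?C" by (auto simp: linked_def)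
  show "finite (linked a)" using finite_subset[OF sub] fin by blast
  have "card (linked a) \<le> card (?C \<times> ?C)" using sub fin by (intro card_mono) auto
  also have "\<dots> = card ?C * card ?C" by (rule card_cartesian_product)
  finally have "real (card (linked a)) \<le> real (card ?C) * real (card ?C)"
    by (simp only: of_nat_mult[symmetric] of_nat_le_iff)
  also have "\<dots> \<le> (16 / \<mu>) * (16 / \<mu>)"
    using card_cells_at_vertex[of a] \<mu>_pos by (intro mult_mono) auto
  finally show "real (card (linked a)) \<le> (16 / \<mu>)\<^sup>2" by (simp add: power2_eq_square)
qed

end

section \<open>The quasi-interpolant\<close>

lemma L2_norm_cong: "(\<And>x. x \<in> S \<Longrightarrow> f x = g x) \<Longrightarrow> L2_norm S f = L2_norm S g"
  unfolding L2_norm_def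
  by (intro arg_cong[where f = sqrt] Bochner_Integration.integral_cong) (auto simp: space_restrict_space)

lemma L2_space_cong:
  assumes "\<And>x. x \<in> S \<Longrightarrow> f x = g x"
  shows "f \<in> L2_space S \<longleftrightarrow> g \<in> L2_space S"
proof -
  have "f \<in> borel_measurable (lebesgue_on S) \<longleftrightarrow> g \<in> borel_measurable (lebesgue_on S)"
    by (rule measurable_cong) (use assms in \<open>auto simp: space_restrict_space\<close>)
  moreover have "integrable (lebesgue_on S) (\<lambda>x. (f x)\<^sup>2) \<longleftrightarrow> integrable (lebesgue_on S) (\<lambda>x. (g x)\<^sup>2)"
    by (rule Bochner_Integration.integrable_cong) (use assms in \<open>auto simp: space_restrict_space\<close>)
  ultimately show ?thesis by (simp add: L2_space_def)
qed

lemma is_weak_partial_cong: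
  assumes "\<And>x. x \<in> S \<Longrightarrow> v x = w x"
  shows "is_weak_partial S \<alpha> v g \<longleftrightarrow> is_weak_partial S \<alpha> w g"
proof -
  have "(LINT x|lebesgue_on S. v x * f x) = (LINT x|lebesgue_on S. w x * f x)" for f
    by (intro Bochner_Integration.integral_cong) (use assms in \<open>auto simp: space_restrict_space\<close>)
  then show ?thesis by (simp add: is_weak_partial_def)
qed

context shape_regular_mesh
begin

text \<open>Both local approximations differ little from \<open>u\<close> in the mean on the half of the common side next to \<open>a\<close>, hence
  little from each other; and an affine function that is small in the mean on this half is small at its end point. In the
  constant, \<open>256 = 4 * 32 + 4 * 32\<close> comes from the two terms of the trace inequality, and \<open>8192 = 8 * 4 * 256\<close> from
  adding the two cells and from the passage to the end point.\<close>

lemma jump_at_vertex: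
  assumes u: "continuous_on \<Omega> u" and uL2: "\<And>K. K \<in> T \<Longrightarrow> u \<in> L2_space (interior K)"
    and link: "(K, K') \<in> linked a"
    and close: "affine_close (interior K) (diameter K) u \<alpha> \<beta> X" "affine_close (interior K') (diameter K') u \<alpha>' \<beta>' X'"
    and X: "0 \<le> X" "X \<le> Y" "0 \<le> X'" "X' \<le> Y"
  shows "\<bar>(\<alpha> + \<beta> \<bullet> a) - (\<alpha>' + \<beta>' \<bullet> a)\<bar> \<le> sqrt (8192 * \<kappa>\<^sup>2 / \<mu>) * Y"
proof -
  obtain b where b: "K \<in> T" "K' \<in> T" "b \<noteq> a" "a \<in> N K" "b \<in> N K" "a \<in> N K'" "b \<in> N K'" "open_segment a b \<subseteq> \<Omega>"
    using link by (auto simp: linked_def)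
  define I where "I f = (\<integral>\<^sup>+y. ennreal ((f (a + y *\<^sub>R (b - a)))\<^sup>2) * indicator {0<..<1/2} y \<partial>lborel)" for f :: "R2 \<Rightarrow> real"
  have trace: "I (\<lambda>x. u x - (\<alpha> + \<beta> \<bullet> x)) \<le> ennreal (256 * \<kappa>\<^sup>2 / \<mu> * Y\<^sup>2)"
    if L: "L \<in> T" "a \<in> N L" "b \<in> N L" and close: "affine_close (interior L) (diameter L) u \<alpha> \<beta> X"
      and X: "0 \<le> X" "X \<le> Y" for L \<alpha> \<beta> X
  proof -
    let ?h = "diameter L" and ?v = "\<lambda>x. u x - (\<alpha> + \<beta> \<bullet> x)"
    obtain c where c: "N L = {a, b, c}" "c \<noteq> a" "c \<noteq> b" using third_node[OF L b(3)[symmetric]] .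
    let ?D = "cross (b - a) (c - a)"
    obtain g1 g2 where g: "g1 \<in> L2_space (interior L)" "g2 \<in> L2_space (interior L)"
        "is_weak_partial (interior L) (mi 1 0) ?v g1" "is_weak_partial (interior L) (mi 0 1) ?v g2"
      and error: "(L2_norm (interior L) ?v)\<^sup>2 \<le> 32 * ?h\<^sup>2 * X\<^sup>2"
        "(L2_norm (interior L) g1)\<^sup>2 + (L2_norm (interior L) g2)\<^sup>2 \<le> 32 * X\<^sup>2"
      using close unfolding affine_close_def by (elim bexE conjE) (rule that)
    have v: "?v \<in> L2_space (interior L)"
      by (intro L2_space_diff L2_space_continuous uL2 L open_interior bounded_interior continuous_intros)
    have h: "0 < ?h" "?h \<le> \<kappa> * diameter (convex hull (N L))" using diameter_pos size L(1) by auto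
    have "?h\<^sup>2 \<le> (\<kappa> * diameter (convex hull (N L)))\<^sup>2" using h by (intro power_mono) auto
    then have "\<mu> * ?h\<^sup>2 \<le> \<kappa>\<^sup>2 * (\<mu> * (diameter (convex hull (N L)))\<^sup>2)"
      using \<mu>_pos by (simp add: power_mult_distrib mult.left_commute)
    also have "\<dots> \<le> \<kappa>\<^sup>2 * \<bar>?D\<bar>" using shape[OF L(1) c(1)] by (intro mult_left_mono) auto
    finally have D: "\<mu> * ?h\<^sup>2 \<le> \<kappa>\<^sup>2 * \<bar>?D\<bar>" .
    have "0 < \<mu> * ?h\<^sup>2" using \<mu>_pos h by simp
    then have "?D \<noteq> 0" using D by auto
    have "norm (c - a) \<le> ?h" using cell_norm_le[OF L(1), of c a] cell(6)[OF L(1)] c(1) by auto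
    then have nc: "(norm (c - a))\<^sup>2 \<le> ?h\<^sup>2" by (intro power_mono) auto
    have X2: "X\<^sup>2 \<le> Y\<^sup>2" using X by (intro power_mono)
    have segment: "{a + y *\<^sub>R (b - a) | y. 0 < y \<and> y < 1/2} \<subseteq> open_segment a b"
    proof clarify
      fix y :: real assume y: "0 < y" "y < 1/2"
      have "a + y *\<^sub>R (b - a) = (1 - y) *\<^sub>R a + y *\<^sub>R b" by (simp add: algebra_simps)
      then show "a + y *\<^sub>R (b - a) \<in> open_segment a b"
        using y b(3) unfolding in_segment by (intro conjI exI[of _ y]) auto
    qed
    have "continuous_on \<Omega> ?v" using u by (intro continuous_intros)
    then have cont: "continuous_on (interior L \<union> {a + y *\<^sub>R (b - a) | y. 0 < y \<and> y < 1/2}) ?v"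
      by (rule continuous_on_subset) (use interior_cell_subset[OF L(1)] segment b(8) in blast)
    have inside: "a + y *\<^sub>R (b - a) + s *\<^sub>R (c - a) \<in> interior L" if "0 < y" "y < 1/2" "0 < s" "s < 1/2" for y s
    proof -
      have "a + y *\<^sub>R (b - a) + s *\<^sub>R (c - a) \<in> interior (convex hull (N L))"
        using cell(4)[OF L(1)] that unfolding c(1) by (rule parallelogram_in_triangle)
      then show ?thesis using interior_triangle(2)[OF L(1)] by blast
    qed
    have "ennreal \<bar>?D\<bar> * I ?v
        \<le> ennreal (4 * (L2_norm (interior L) ?v)\<^sup>2 + 4 * (norm (c - a))\<^sup>2 * ((L2_norm (interior L) g1)\<^sup>2 + (L2_norm (interior L) g2)\<^sup>2))"
      unfolding I_def
      by (rule trace_L2[OF open_interior bounded_interior[OF L(1)] v g cont \<open>?D \<noteq> 0\<close> inside])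
    also have "\<dots> \<le> ennreal (256 * ?h\<^sup>2 * Y\<^sup>2)"
    proof (rule ennreal_leI)
      have "(L2_norm (interior L) ?v)\<^sup>2 \<le> 32 * ?h\<^sup>2 * Y\<^sup>2"
        by (rule order_trans[OF error(1) mult_left_mono[OF X2]]) simp
      then have "4 * (L2_norm (interior L) ?v)\<^sup>2 \<le> 4 * (32 * ?h\<^sup>2 * Y\<^sup>2)"
        by (rule mult_left_mono) simp
      moreover have "(norm (c - a))\<^sup>2 * ((L2_norm (interior L) g1)\<^sup>2 + (L2_norm (interior L) g2)\<^sup>2) \<le> ?h\<^sup>2 * (32 * Y\<^sup>2)"
        using nc error(2) X2 by (intro mult_mono) auto
      ultimately have "4 * (L2_norm (interior L) ?v)\<^sup>2 + 4 * ((norm (c - a))\<^sup>2 * ((L2_norm (interior L) g1)\<^sup>2 + (L2_norm (interior L) g2)\<^sup>2))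
          \<le> 4 * (32 * ?h\<^sup>2 * Y\<^sup>2) + 4 * (?h\<^sup>2 * (32 * Y\<^sup>2))"
        by (rule add_mono[OF _ mult_left_mono]) simp
      also have "\<dots> = 256 * ?h\<^sup>2 * Y\<^sup>2" by simp
      finally show "4 * (L2_norm (interior L) ?v)\<^sup>2 + 4 * (norm (c - a))\<^sup>2 * ((L2_norm (interior L) g1)\<^sup>2 + (L2_norm (interior L) g2)\<^sup>2)
          \<le> 256 * ?h\<^sup>2 * Y\<^sup>2"
        by (simp only: mult.assoc)
    qed
    finally have main: "ennreal \<bar>?D\<bar> * I ?v \<le> ennreal (256 * ?h\<^sup>2 * Y\<^sup>2)" .
    have "ennreal (\<mu> * ?h\<^sup>2) * I ?v \<le> ennreal (\<kappa>\<^sup>2 * \<bar>?D\<bar>) * I ?v"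
      using D by (intro mult_right_mono ennreal_leI) auto
    also have "\<dots> = ennreal (\<kappa>\<^sup>2) * (ennreal \<bar>?D\<bar> * I ?v)"
      by (simp add: ennreal_mult mult.assoc)
    also have "\<dots> \<le> ennreal (\<kappa>\<^sup>2) * ennreal (256 * ?h\<^sup>2 * Y\<^sup>2)"
      by (intro mult_left_mono main) simp
    finally have "ennreal (1 / (\<mu> * ?h\<^sup>2)) * (ennreal (\<mu> * ?h\<^sup>2) * I ?v)
        \<le> ennreal (1 / (\<mu> * ?h\<^sup>2)) * (ennreal (\<kappa>\<^sup>2) * ennreal (256 * ?h\<^sup>2 * Y\<^sup>2))"
      by (intro mult_left_mono) auto
    moreover have "ennreal (1 / (\<mu> * ?h\<^sup>2)) * (ennreal (\<mu> * ?h\<^sup>2) * Z) = Z" for Z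
    proof -
      have "ennreal (1 / (\<mu> * ?h\<^sup>2)) * ennreal (\<mu> * ?h\<^sup>2) = ennreal (1 / (\<mu> * ?h\<^sup>2) * (\<mu> * ?h\<^sup>2))"
        using \<open>0 < \<mu> * ?h\<^sup>2\<close> by (intro ennreal_mult[symmetric]) auto
      also have "1 / (\<mu> * ?h\<^sup>2) * (\<mu> * ?h\<^sup>2) = 1" using \<open>0 < \<mu> * ?h\<^sup>2\<close> by (metis less_irrefl nonzero_eq_divide_eq)
      finally show ?thesis by (simp only: mult.assoc[symmetric] ennreal_1 mult_1_left)
    qed
    moreover have "ennreal (1 / (\<mu> * ?h\<^sup>2)) * (ennreal (\<kappa>\<^sup>2) * ennreal (256 * ?h\<^sup>2 * Y\<^sup>2)) = ennreal (256 * \<kappa>\<^sup>2 / \<mu> * Y\<^sup>2)"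
    proof -
      have "ennreal (1 / (\<mu> * ?h\<^sup>2)) * (ennreal (\<kappa>\<^sup>2) * ennreal (256 * ?h\<^sup>2 * Y\<^sup>2))
          = ennreal (1 / (\<mu> * ?h\<^sup>2) * (\<kappa>\<^sup>2 * (256 * ?h\<^sup>2 * Y\<^sup>2)))"
        using \<open>0 < \<mu> * ?h\<^sup>2\<close> by (subst (1 2) ennreal_mult) auto
      also have "1 / (\<mu> * ?h\<^sup>2) * (\<kappa>\<^sup>2 * (256 * ?h\<^sup>2 * Y\<^sup>2)) = 256 * \<kappa>\<^sup>2 / \<mu> * Y\<^sup>2"
        using \<mu>_pos h by (simp add: field_simps)
      finally show ?thesis .
    qed
    ultimately show ?thesis by simp
  qed
  let ?v = "\<lambda>x. u x - (\<alpha> + \<beta> \<bullet> x)" and ?v' = "\<lambda>x. u x - (\<alpha>' + \<beta>' \<bullet> x)"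
  define A where "A = (\<alpha>' + \<beta>' \<bullet> a) - (\<alpha> + \<beta> \<bullet> a)"
  define B where "B = (\<beta>' - \<beta>) \<bullet> (b - a)"
  let ?C = "256 * \<kappa>\<^sup>2 / \<mu> * Y\<^sup>2"
  have C: "?C \<ge> 0" using \<mu>_pos by simp
  have "ennreal (A\<^sup>2 / 8) \<le> (\<integral>\<^sup>+y. ennreal ((A + B * y)\<^sup>2) * indicator {0<..<1/2} y \<partial>lborel)"
    by (rule affine_value_le_integral)
  also have "\<dots> \<le> (\<integral>\<^sup>+y. 2 * (ennreal ((?v (a + y *\<^sub>R (b - a)))\<^sup>2) * indicator {0<..<1/2} y)
      + 2 * (ennreal ((?v' (a + y *\<^sub>R (b - a)))\<^sup>2) * indicator {0<..<1/2} y) \<partial>lborel)"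
  proof (intro nn_integral_mono)
    fix y :: real
    let ?x = "a + y *\<^sub>R (b - a)"
    have "A + B * y = ?v ?x - ?v' ?x"
      by (simp add: A_def B_def inner_add_right inner_diff_left inner_diff_right algebra_simps)
    moreover have "(p - q)\<^sup>2 \<le> 2 * p\<^sup>2 + 2 * q\<^sup>2" for p q :: real
      using zero_le_power2[of "p + q"] unfolding power2_sum power2_diff by linarith
    ultimately have "ennreal ((A + B * y)\<^sup>2) \<le> ennreal (2 * (?v ?x)\<^sup>2 + 2 * (?v' ?x)\<^sup>2)"
      by (simp only: ennreal_leI)
    also have "\<dots> = 2 * ennreal ((?v ?x)\<^sup>2) + 2 * ennreal ((?v' ?x)\<^sup>2)"
      by (simp add: ennreal_mult)
    finally show "ennreal ((A + B * y)\<^sup>2) * indicator {0<..<1/2} y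
        \<le> 2 * (ennreal ((?v ?x)\<^sup>2) * indicator {0<..<1/2} y) + 2 * (ennreal ((?v' ?x)\<^sup>2) * indicator {0<..<1/2} y)"
      by (auto simp: indicator_def)
  qed
  also have "\<dots> = 2 * I ?v + 2 * I ?v'"
  proof -
    have "continuous_on {0<..<1/2::real} (\<lambda>y. u (a + y *\<^sub>R (b - a)))"
    proof (rule continuous_on_compose2[OF u])
      show "(\<lambda>y. a + y *\<^sub>R (b - a)) ` {0<..<1/2} \<subseteq> \<Omega>"
      proof clarify
        fix y :: real assume y: "y \<in> {0<..<1/2}"
        have "a + y *\<^sub>R (b - a) = (1 - y) *\<^sub>R a + y *\<^sub>R b" by (simp add: algebra_simps)
        then have "a + y *\<^sub>R (b - a) \<in> open_segment a b"
          using y b(3) unfolding in_segment by (intro conjI exI[of _ y]) auto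
        then show "a + y *\<^sub>R (b - a) \<in> \<Omega>" using b(8) by blast
      qed
    qed (intro continuous_intros)
    then have "continuous_on {0<..<1/2::real} (\<lambda>y. (u (a + y *\<^sub>R (b - a)) - (s + t \<bullet> (a + y *\<^sub>R (b - a))))\<^sup>2)" for s t
      by (intro continuous_intros)
    then have "(\<lambda>y. indicator {0<..<1/2::real} y *\<^sub>R (u (a + y *\<^sub>R (b - a)) - (s + t \<bullet> (a + y *\<^sub>R (b - a))))\<^sup>2) \<in> borel_measurable borel" for s t
      by (intro borel_measurable_continuous_on_indicator) auto
    then have "(\<lambda>y. ennreal (indicator {0<..<1/2::real} y *\<^sub>R (u (a + y *\<^sub>R (b - a)) - (s + t \<bullet> (a + y *\<^sub>R (b - a))))\<^sup>2)) \<in> borel_measurable borel" for s t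
      by (rule measurable_compose[OF _ measurable_ennreal])
    moreover have "ennreal (indicator {0<..<1/2::real} y *\<^sub>R r) = ennreal r * indicator {0<..<1/2} y" for y r
      by (auto simp: indicator_def)
    ultimately have "(\<lambda>y. ennreal ((u (a + y *\<^sub>R (b - a)) - (s + t \<bullet> (a + y *\<^sub>R (b - a))))\<^sup>2) * indicator {0<..<1/2} y) \<in> borel_measurable lborel" for s t
      unfolding measurable_lborel1 measurable_lborel2 by (simp only:)
    then show ?thesis unfolding I_def by (simp add: nn_integral_add nn_integral_cmult)
  qed
  also have "\<dots> \<le> 2 * ennreal ?C + 2 * ennreal ?C"
    using trace[OF b(1,4,5) close(1) X(1,2)] trace[OF b(2,6,7) close(2) X(3,4)]
    by (intro add_mono mult_left_mono) auto
  also have "\<dots> = ennreal (4 * ?C)"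
  proof -
    have "2 * ennreal ?C = ennreal (2 * ?C)" using C by (subst ennreal_mult) auto
    then have "2 * ennreal ?C + 2 * ennreal ?C = ennreal (2 * ?C + 2 * ?C)" using C by (simp only: ennreal_plus)
    also have "2 * ?C + 2 * ?C = 4 * ?C" by linarith
    finally show ?thesis .
  qed
  finally have "A\<^sup>2 / 8 \<le> 4 * ?C" using C by (subst (asm) ennreal_le_iff) auto
  then have "A\<^sup>2 \<le> (8192 * \<kappa>\<^sup>2 / \<mu>) * Y\<^sup>2" by (simp add: field_simps)
  then have "sqrt (A\<^sup>2) \<le> sqrt ((8192 * \<kappa>\<^sup>2 / \<mu>) * Y\<^sup>2)" by (rule real_sqrt_le_mono)
  also have "\<dots> = sqrt (8192 * \<kappa>\<^sup>2 / \<mu>) * Y" using X unfolding real_sqrt_mult real_sqrt_abs by simp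
  finally show ?thesis unfolding real_sqrt_abs A_def by (simp only: abs_minus_commute)
qed

text \<open>Any two connected cells are connected by a chain that is not longer than the number of links.\<close>

lemma jump_along_chain:
  assumes u: "continuous_on \<Omega> u" and uL2: "\<And>K. K \<in> T \<Longrightarrow> u \<in> L2_space (interior K)"
    and close: "\<And>K. K \<in> T \<Longrightarrow> affine_close (interior K) (diameter K) u (\<alpha> K) (\<beta> K) (X K)" "\<And>K. K \<in> T \<Longrightarrow> 0 \<le> X K"
    and X: "\<And>K. K \<in> T \<Longrightarrow> a \<in> N K \<Longrightarrow> X K \<le> Y" and "0 \<le> Y"
    and chain: "(K, K') \<in> (linked a)\<^sup>*"
  shows "\<bar>(\<alpha> K + \<beta> K \<bullet> a) - (\<alpha> K' + \<beta> K' \<bullet> a)\<bar> \<le> (16 / \<mu>)\<^sup>2 * sqrt (8192 * \<kappa>\<^sup>2 / \<mu>) * Y"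
proof -
  let ?c = "sqrt (8192 * \<kappa>\<^sup>2 / \<mu>) * Y"
  have c: "0 \<le> ?c" using \<mu>_pos \<open>0 \<le> Y\<close> by simp
  obtain n where n: "n \<le> card (linked a)" "(K, K') \<in> linked a ^^ n"
    using chain rtrancl_finite_eq_relpow[OF card_linked(1)] by auto
  have "\<bar>(\<alpha> K + \<beta> K \<bullet> a) - (\<alpha> K' + \<beta> K' \<bullet> a)\<bar> \<le> real n * ?c"
    using n(2)
  proof (induction n arbitrary: K')
    case (Suc n)
    then obtain L where L: "(K, L) \<in> linked a ^^ n" "(L, K') \<in> linked a" by auto
    have mem: "L \<in> T" "K' \<in> T" "a \<in> N L" "a \<in> N K'" using L(2) by (auto simp: linked_def)
    have "\<bar>(\<alpha> L + \<beta> L \<bullet> a) - (\<alpha> K' + \<beta> K' \<bullet> a)\<bar> \<le> ?c"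
      by (rule jump_at_vertex[OF u uL2 L(2)]) (use close X mem in auto)
    with Suc.IH[OF L(1)] show ?case by (simp add: distrib_right)
  qed simp
  also have "\<dots> \<le> (16 / \<mu>)\<^sup>2 * ?c"
  proof (rule mult_right_mono[OF _ c])
    show "real n \<le> (16 / \<mu>)\<^sup>2" using n(1) card_linked(2)[of a] by linarith
  qed
  finally show ?thesis by (simp add: mult.assoc)
qed

text \<open>The value at the vertex \<open>a\<close> is taken from one cell of the fan of \<open>K\<close>; as this cell depends on the fan only,
  the cells of a fan get the same value.\<close>

definition fan_representative :: "R2 \<Rightarrow> R2 set \<Rightarrow> R2 set" where
  "fan_representative a K = (SOME L. (K, L) \<in> (linked a)\<^sup>*)"

lemma fan_representative: "(K, fan_representative a K) \<in> (linked a)\<^sup>*"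
  unfolding fan_representative_def by (rule someI[of _ K]) simp

lemma fan_representative_eq:
  assumes "(K, K') \<in> (linked a)\<^sup>*"
  shows "fan_representative a K = fan_representative a K'"
proof -
  have "(K', K) \<in> (linked a)\<^sup>*" using assms sym_rtrancl[OF sym_linked] by (rule symD[rotated])
  then have "(K, L) \<in> (linked a)\<^sup>* \<longleftrightarrow> (K', L) \<in> (linked a)\<^sup>*" for L
    using assms by (meson rtrancl_trans)
  then show ?thesis by (simp add: fan_representative_def)
qed

text \<open>Fan-wise vertex values fit together to a continuous function: on a common side both affine functions
  interpolate the same two values, and at an isolated common vertex of the domain there is only one fan.\<close>

lemma glued_continuous:
  assumes p: "\<And>K K' a. K \<in> T \<Longrightarrow> K' \<in> T \<Longrightarrow> a \<in> N K \<Longrightarrow> a \<in> N K' \<Longrightarrow> (K, K') \<in> (linked a)\<^sup>* \<Longrightarrow>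
      s K + t K \<bullet> a = s K' + t K' \<bullet> a"
  obtains w where "continuous_on \<Omega> w" "\<And>K x. K \<in> T \<Longrightarrow> x \<in> K \<Longrightarrow> x \<in> \<Omega> \<Longrightarrow> w x = s K + t K \<bullet> x"
proof -
  have agree: "s K + t K \<bullet> x = s K' + t K' \<bullet> x"
    if K: "K \<in> T" "K' \<in> T" and x: "x \<in> K" "x \<in> K'" "x \<in> \<Omega>" for K K' x
  proof (cases "K = K'")
    case False
    have hull: "x \<in> convex hull (N K \<inter> N K')" using cell_intersection(2)[OF K False] x by blast
    then have "N K \<inter> N K' \<noteq> {}" by auto
    then obtain a where a: "a \<in> N K" "a \<in> N K'" by blast
    show ?thesis
    proof (cases "x = a")
      case True
      then show ?thesis
        using p[OF K a interior_fan_connected[OF _ K(1) a(1) K(2) a(2)]] x(3) by simp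
    next
      case x_ne: False
      obtain b where b: "b \<noteq> a" "b \<in> N K" "b \<in> N K'" "open_segment a b \<subseteq> \<Omega>" "x \<in> closed_segment a b"
        using shared_side[OF K False a x x_ne] .
      have "open_segment b a \<subseteq> \<Omega>" using b(4) by (simp add: open_segment_commute)
      then have "(K, K') \<in> linked b"
        using K a b(1,2,3) by (auto simp: linked_def intro!: exI[of _ a])
      moreover have "(K, K') \<in> linked a"
        using K a b by (auto simp: linked_def intro!: exI[of _ b])
      ultimately have eq: "s K + t K \<bullet> a = s K' + t K' \<bullet> a" "s K + t K \<bullet> b = s K' + t K' \<bullet> b"
        using p[OF K a] p[OF K b(2,3)] by auto
      obtain y where y: "x = (1 - y) *\<^sub>R a + y *\<^sub>R b" using b(5) by (auto simp: in_segment)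
      have convex_split: "p + ((1 - y) * q + y * r) = (1 - y) * (p + q) + y * (p + r)" for p q r :: real
        by (simp add: algebra_simps)
      have "s L + t L \<bullet> x = (1 - y) * (s L + t L \<bullet> a) + y * (s L + t L \<bullet> b)" for L
        unfolding y inner_add_right inner_scaleR_right by (rule convex_split)
      then show ?thesis by (simp add: eq)
    qed
  qed simp
  define w where "w x = (let K = SOME K. K \<in> T \<and> x \<in> K in s K + t K \<bullet> x)" for x
  have w: "w x = s K + t K \<bullet> x" if "K \<in> T" "x \<in> K" "x \<in> \<Omega>" for K x
  proof -
    have "(SOME K. K \<in> T \<and> x \<in> K) \<in> T \<and> x \<in> (SOME K. K \<in> T \<and> x \<in> K)"
      using someI[of "\<lambda>K. K \<in> T \<and> x \<in> K" K] that by blast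
    then show ?thesis unfolding w_def Let_def using agree that by blast
  qed
  have "continuous_map (top_of_set \<Omega>) euclidean w"
  proof (rule pasting_lemma_closed[OF finite_T, where T = "\<lambda>K. \<Omega> \<inter> K" and f = "\<lambda>K x. s K + t K \<bullet> x"])
    show "closedin (top_of_set \<Omega>) (\<Omega> \<inter> K)" if "K \<in> T" for K
      using cell(1)[OF that] by (simp add: closedin_closed_Int compact_imp_closed)
    show "continuous_map (subtopology (top_of_set \<Omega>) (\<Omega> \<inter> K)) euclidean (\<lambda>x. s K + t K \<bullet> x)" if "K \<in> T" for K
      by (simp add: subtopology_subtopology) (intro continuous_intros)
    show "s K + t K \<bullet> x = s K' + t K' \<bullet> x"
      if "K \<in> T" "K' \<in> T" "x \<in> topspace (top_of_set \<Omega>) \<inter> (\<Omega> \<inter> K) \<inter> (\<Omega> \<inter> K')" for K K' x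
      by (rule agree[OF that(1,2)]) (use that(3) in blast)+
    fix x assume "x \<in> topspace (top_of_set \<Omega>)"
    then have x: "x \<in> \<Omega>" by simp
    then have "x \<in> \<Union>T" using closure_subset[of \<Omega>] unfolding Union_T by blast
    then obtain K where "K \<in> T" "x \<in> K" by blast
    then show "\<exists>K. K \<in> T \<and> x \<in> \<Omega> \<inter> K \<and> w x = s K + t K \<bullet> x" using w x by blast
  qed
  then have "continuous_on \<Omega> w" by simp
  then show ?thesis using that w by blast
qed

text \<open>The nodes control an affine function on the triangle; the curved cell is at most \<open>\<kappa>\<close> times as large.\<close>

lemma affine_small_on_cell:
  assumes K: "K \<in> T" and nodes: "\<And>v. v \<in> N K \<Longrightarrow> \<bar>\<alpha> + \<beta> \<bullet> v\<bar> \<le> e"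
  shows "norm \<beta> * diameter K \<le> 8 * \<kappa> / \<mu> * e"
    and "x \<in> K \<Longrightarrow> \<bar>\<alpha> + \<beta> \<bullet> x\<bar> \<le> (1 + 8 * \<kappa> / \<mu>) * e"
proof -
  let ?L = "diameter (convex hull (N K))"
  obtain a where a: "a \<in> N K" using cell(3)[OF K] by fastforce
  obtain b c where N: "N K = {a, b, c}" using vertices[OF K a] by metis
  have e: "0 \<le> e" using assms(2)[OF a] by linarith
  have L: "0 < ?L" by (rule triangle_diameter_pos[OF K])
  have "norm \<beta> \<le> 8 * e / (\<mu> * ?L)"
  proof (rule affine_gradient_bound[OF \<mu>_pos L shape[OF K N]])
    show "norm (b - a) \<le> ?L" "norm (c - a) \<le> ?L" using side_le[OF K] N by auto
    show "\<bar>\<alpha> + \<beta> \<bullet> a\<bar> \<le> e" "\<bar>\<alpha> + \<beta> \<bullet> b\<bar> \<le> e" "\<bar>\<alpha> + \<beta> \<bullet> c\<bar> \<le> e" using assms(2) N by auto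
  qed
  then have "norm \<beta> * diameter K \<le> 8 * e / (\<mu> * ?L) * (\<kappa> * ?L)"
    using size[OF K] diameter_pos[OF K] e \<mu>_pos L by (intro mult_mono) auto
  also have "\<dots> = 8 * \<kappa> / \<mu> * e" using L \<mu>_pos by (simp add: field_simps)
  finally show gradient: "norm \<beta> * diameter K \<le> 8 * \<kappa> / \<mu> * e" .
  assume x: "x \<in> K"
  have "\<bar>\<beta> \<bullet> (x - a)\<bar> \<le> norm \<beta> * norm (x - a)" by (rule Cauchy_Schwarz_ineq2)
  also have "\<dots> \<le> norm \<beta> * diameter K"
    using cell_norm_le[OF K x] a cell(6)[OF K] by (intro mult_left_mono) auto
  finally have "\<bar>\<beta> \<bullet> (x - a)\<bar> \<le> 8 * \<kappa> / \<mu> * e" using gradient by linarith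
  moreover have "\<alpha> + \<beta> \<bullet> x = (\<alpha> + \<beta> \<bullet> a) + \<beta> \<bullet> (x - a)" by (simp add: inner_diff_right)
  moreover have "\<bar>\<alpha> + \<beta> \<bullet> a\<bar> \<le> e" using assms(2)[OF a] .
  ultimately show "\<bar>\<alpha> + \<beta> \<bullet> x\<bar> \<le> (1 + 8 * \<kappa> / \<mu>) * e" by (simp add: distrib_right)
qed

text \<open>The first term is the error of the local approximation. The second one comes from the square of the
  jumps at the nodes times the factor \<open>1 + 8 * \<kappa> / \<mu>\<close> that extends them from the nodes to the cell.\<close>

definition interpolation_constant :: real where
  "interpolation_constant = 64 + 8 * ((1 + 8 * \<kappa> / \<mu>) * ((16 / \<mu>)\<^sup>2 * sqrt (8192 * \<kappa>\<^sup>2 / \<mu>)))\<^sup>2"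

text \<open>With the value of the local approximation of the representative at each vertex, the interpolant differs at the
  nodes of \<open>K\<close> from the local approximation on \<open>K\<close> by jumps along chains in the patch of \<open>K\<close>.\<close>

lemma quasi_interpolant:
  assumes u: "continuous_on \<Omega> u" and uL2: "\<And>K. K \<in> T \<Longrightarrow> u \<in> L2_space (interior K)"
    and close: "\<And>K. K \<in> T \<Longrightarrow> affine_close (interior K) (diameter K) u (\<alpha> K) (\<beta> K) (X K)" "\<And>K. K \<in> T \<Longrightarrow> 0 \<le> X K"
  obtains w where "w \<in> courant_space \<Omega> T"
    "\<And>K Y. K \<in> T \<Longrightarrow> 0 \<le> Y \<Longrightarrow> (\<And>L. L \<in> patch T N K \<Longrightarrow> X L \<le> Y) \<Longrightarrow>
       (\<lambda>x. u x - w x) \<in> L2_space (interior K) \<and>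
       (L2_norm (interior K) (\<lambda>x. u x - w x))\<^sup>2 \<le> interpolation_constant * (diameter K)\<^sup>2 * Y\<^sup>2 \<and>
       (sobolev_seminorm 1 (interior K) (\<lambda>x. u x - w x))\<^sup>2 \<le> interpolation_constant * Y\<^sup>2"
proof -
  define val where "val a K = \<alpha> (fan_representative a K) + \<beta> (fan_representative a K) \<bullet> a" for a K
  have "\<exists>st. \<forall>v\<in>N K. fst st + snd st \<bullet> v = val v K" if K: "K \<in> T" for K
  proof -
    obtain a where a: "a \<in> N K" using cell(3)[OF K] by fastforce
    obtain b c where N: "N K = {a, b, c}" using vertices[OF K a] by metis
    have "cross (b - a) (c - a) \<noteq> 0" using cell(4)[OF K] cross_eq_0_imp_collinear[of b a c] N by auto
    then obtain s t where "s + t \<bullet> a = val a K" "s + t \<bullet> b = val b K" "s + t \<bullet> c = val c K"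
      by (rule affine_interpolation)
    then show ?thesis using N by (intro exI[of _ "(s, t)"]) auto
  qed
  then obtain st where st: "\<And>K v. K \<in> T \<Longrightarrow> v \<in> N K \<Longrightarrow> fst (st K) + snd (st K) \<bullet> v = val v K"
    by metis
  define s t where "s K = fst (st K)" and "t K = snd (st K)" for K
  have nodal: "s K + t K \<bullet> v = val v K" if "K \<in> T" "v \<in> N K" for K v
    using st[OF that] by (simp add: s_def t_def)
  have same: "s K + t K \<bullet> a = s K' + t K' \<bullet> a"
    if "K \<in> T" "K' \<in> T" "a \<in> N K" "a \<in> N K'" "(K, K') \<in> (linked a)\<^sup>*" for K K' a
    using nodal that fan_representative_eq[OF that(5)] by (simp add: val_def)
  obtain w where w: "continuous_on \<Omega> w" "\<And>K x. K \<in> T \<Longrightarrow> x \<in> K \<Longrightarrow> x \<in> \<Omega> \<Longrightarrow> w x = s K + t K \<bullet> x"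
    using glued_continuous[of s t, OF same] by blast
  have w_interior: "w x = s K + t K \<bullet> x" if "K \<in> T" "x \<in> interior K" for K x
    using w(2)[OF that(1)] that interior_subset[of K] interior_cell_subset[OF that(1)] by blast
  have "w \<in> courant_space \<Omega> T"
    using w(1) w_interior unfolding courant_space_def C0_space_def broken_P1_def by blast
  moreover have "(\<lambda>x. u x - w x) \<in> L2_space (interior K) \<and>
       (L2_norm (interior K) (\<lambda>x. u x - w x))\<^sup>2 \<le> interpolation_constant * (diameter K)\<^sup>2 * Y\<^sup>2 \<and>
       (sobolev_seminorm 1 (interior K) (\<lambda>x. u x - w x))\<^sup>2 \<le> interpolation_constant * Y\<^sup>2"
    if K: "K \<in> T" and Y: "0 \<le> Y" and X: "\<And>L. L \<in> patch T N K \<Longrightarrow> X L \<le> Y" for K Y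
  proof -
    let ?S = "interior K" and ?h = "diameter K"
    let ?v = "\<lambda>x. u x - (\<alpha> K + \<beta> K \<bullet> x)"
    define s0 t0 where "s0 = s K - \<alpha> K" and "t0 = t K - \<beta> K"
    define c2 where "c2 = (16 / \<mu>)\<^sup>2 * sqrt (8192 * \<kappa>\<^sup>2 / \<mu>)"
    define c3 where "c3 = 1 + 8 * \<kappa> / \<mu>"
    have c: "0 \<le> c2" "0 \<le> 8 * \<kappa> / \<mu>" "8 * \<kappa> / \<mu> \<le> c3" "0 \<le> c3"
      using \<mu>_pos \<kappa>_pos by (simp_all add: c2_def c3_def)
    have const: "interpolation_constant = 64 + 8 * (c3 * c2)\<^sup>2"
      by (simp add: interpolation_constant_def c2_def c3_def)
    have jump: "\<bar>s0 + t0 \<bullet> a\<bar> \<le> c2 * Y" if a: "a \<in> N K" for a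
    proof -
      have "X L \<le> Y" if "L \<in> T" "a \<in> N L" for L
        using X[of L] that a by (auto simp: patch_def)
      from jump_along_chain[OF u uL2 close this Y fan_representative]
      have "\<bar>(\<alpha> K + \<beta> K \<bullet> a) - val a K\<bar> \<le> c2 * Y" by (simp add: val_def c2_def)
      moreover have "s0 + t0 \<bullet> a = val a K - (\<alpha> K + \<beta> K \<bullet> a)"
        using nodal[OF K a] by (simp add: s0_def t0_def inner_diff_left)
      ultimately show ?thesis by (simp add: abs_minus_commute)
    qed
    note small = affine_small_on_cell[OF K jump]
    have diff: "u x - w x = ?v x - (s0 + t0 \<bullet> x)" if "x \<in> ?S" for x
      using w_interior[OF K that] by (simp add: s0_def t0_def inner_diff_left)
    have bounded: "bounded ?S" by (rule bounded_interior[OF K])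
    have vL2: "?v \<in> L2_space ?S"
      by (intro L2_space_diff L2_space_continuous uL2 K open_interior bounded continuous_intros)
    have cont0: "continuous_on UNIV (\<lambda>x. s0 + t0 \<bullet> x)" by (intro continuous_intros)
    have affine: "(\<lambda>x. s0 + t0 \<bullet> x) \<in> L2_space ?S" "(\<lambda>x. z) \<in> L2_space ?S" for z
      by (intro L2_space_continuous open_interior bounded continuous_intros)+
    obtain g1 g2 where g: "g1 \<in> L2_space ?S" "g2 \<in> L2_space ?S"
        "is_weak_partial ?S (mi 1 0) ?v g1" "is_weak_partial ?S (mi 0 1) ?v g2"
      and error: "(L2_norm ?S ?v)\<^sup>2 \<le> 32 * ?h\<^sup>2 * (X K)\<^sup>2"
        "(L2_norm ?S g1)\<^sup>2 + (L2_norm ?S g2)\<^sup>2 \<le> 32 * (X K)\<^sup>2"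
      using close(1)[OF K] unfolding affine_close_def by (elim bexE conjE) (rule that)
    have "K \<in> patch T N K" using K cell(3)[OF K] by (auto simp: patch_def)
    then have X2: "(X K)\<^sup>2 \<le> Y\<^sup>2" using X close(2)[OF K] by (intro power_mono) auto
    have area: "measure lborel ?S \<le> 4 * ?h\<^sup>2"
    proof -
      obtain a where a: "a \<in> K" using cell(3,6)[OF K] by fastforce
      have "?S \<subseteq> cball a ?h"
        using cell_norm_le[OF K a] interior_subset[of K] by (auto simp: dist_norm)
      then show ?thesis using diameter_pos[OF K] by (intro measure_subset_cball_le(2)) auto
    qed
    have constant_norm: "(L2_norm ?S f)\<^sup>2 \<le> B\<^sup>2 * (4 * ?h\<^sup>2)"
      if "continuous_on UNIV f" "\<And>x. x \<in> ?S \<Longrightarrow> \<bar>f x\<bar> \<le> B" for f B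
      using L2_norm_square_le_bound[OF open_interior bounded that] mult_left_mono[OF area, of "B\<^sup>2"] by simp
    have L2: "(\<lambda>x. u x - w x) \<in> L2_space ?S"
      using L2_space_diff[OF open_interior vL2 affine(1)] L2_space_cong[of ?S "\<lambda>x. u x - w x", OF diff] by blast
    have "(L2_norm ?S (\<lambda>x. u x - w x))\<^sup>2 = (L2_norm ?S (\<lambda>x. ?v x - (s0 + t0 \<bullet> x)))\<^sup>2"
      using L2_norm_cong[of ?S "\<lambda>x. u x - w x", OF diff] by simp
    also have "\<dots> \<le> 2 * (L2_norm ?S ?v)\<^sup>2 + 2 * (L2_norm ?S (\<lambda>x. s0 + t0 \<bullet> x))\<^sup>2"
      by (rule L2_norm_square_diff_le[OF open_interior vL2 affine(1)])
    also have "\<dots> \<le> 2 * (32 * ?h\<^sup>2 * Y\<^sup>2) + 2 * ((c3 * (c2 * Y))\<^sup>2 * (4 * ?h\<^sup>2))"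
    proof (intro add_mono mult_left_mono)
      show "(L2_norm ?S ?v)\<^sup>2 \<le> 32 * ?h\<^sup>2 * Y\<^sup>2"
        using error(1) mult_left_mono[OF X2, of "32 * ?h\<^sup>2"] by simp
      show "(L2_norm ?S (\<lambda>x. s0 + t0 \<bullet> x))\<^sup>2 \<le> (c3 * (c2 * Y))\<^sup>2 * (4 * ?h\<^sup>2)"
        using small(2) interior_subset[of K] by (intro constant_norm cont0) (auto simp: c3_def)
    qed auto
    also have "\<dots> = interpolation_constant * ?h\<^sup>2 * Y\<^sup>2"
      by (simp add: const power_mult_distrib algebra_simps)
    finally have bound0: "(L2_norm ?S (\<lambda>x. u x - w x))\<^sup>2 \<le> interpolation_constant * ?h\<^sup>2 * Y\<^sup>2" .
    have wp: "is_weak_partial ?S (mi 1 0) (\<lambda>x. u x - w x) (\<lambda>x. g1 x - t0 $ 1)"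
        "is_weak_partial ?S (mi 0 1) (\<lambda>x. u x - w x) (\<lambda>x. g2 x - t0 $ 2)"
      using is_weak_partial_diff[OF open_interior vL2 affine(1) g(1) affine(2) g(3) affine_weak_gradient(1)[OF open_interior bounded], where i = 1]
        is_weak_partial_diff[OF open_interior vL2 affine(1) g(2) affine(2) g(4) affine_weak_gradient(2)[OF open_interior bounded], where i = 2]
        is_weak_partial_cong[of ?S "\<lambda>x. u x - w x", OF diff]
      by (simp_all add: multi_partial_mi)
    have gL2: "(\<lambda>x. g1 x - t0 $ 1) \<in> L2_space ?S" "(\<lambda>x. g2 x - t0 $ 2) \<in> L2_space ?S"
      by (intro L2_space_diff open_interior g affine)+
    have "(sobolev_seminorm 1 ?S (\<lambda>x. u x - w x))\<^sup>2
        = (L2_norm ?S (\<lambda>x. g1 x - t0 $ 1))\<^sup>2 + (L2_norm ?S (\<lambda>x. g2 x - t0 $ 2))\<^sup>2"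
      by (rule sobolev_seminorm_1[OF open_interior gL2 wp])
    also have "\<dots> \<le> (2 * (L2_norm ?S g1)\<^sup>2 + 2 * (\<bar>t0 $ 1\<bar>\<^sup>2 * (4 * ?h\<^sup>2))) + (2 * (L2_norm ?S g2)\<^sup>2 + 2 * (\<bar>t0 $ 2\<bar>\<^sup>2 * (4 * ?h\<^sup>2)))"
    proof -
      have "(L2_norm ?S (\<lambda>x. g x - z))\<^sup>2 \<le> 2 * (L2_norm ?S g)\<^sup>2 + 2 * (\<bar>z\<bar>\<^sup>2 * (4 * ?h\<^sup>2))"
        if "g \<in> L2_space ?S" for g z
        using L2_norm_square_diff_le[OF open_interior that affine(2)[of z]] constant_norm[of "\<lambda>x. z" "\<bar>z\<bar>"] by simp
      then show ?thesis using g(1,2) by (intro add_mono)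
    qed
    also have "\<dots> = 2 * ((L2_norm ?S g1)\<^sup>2 + (L2_norm ?S g2)\<^sup>2) + 8 * (norm t0 * ?h)\<^sup>2"
    proof -
      have "(norm t0)\<^sup>2 = (t0 $ 1)\<^sup>2 + (t0 $ 2)\<^sup>2"
        unfolding power2_norm_eq_inner by (simp add: inner_vec_def sum_2 power2_eq_square)
      then show ?thesis by (simp add: power_mult_distrib algebra_simps)
    qed
    also have "\<dots> \<le> 2 * (32 * Y\<^sup>2) + 8 * (c3 * (c2 * Y))\<^sup>2"
    proof (intro add_mono mult_left_mono power_mono)
      show "(L2_norm ?S g1)\<^sup>2 + (L2_norm ?S g2)\<^sup>2 \<le> 32 * Y\<^sup>2" using error(2) X2 by linarith
      have "8 * \<kappa> / \<mu> * (c2 * Y) \<le> c3 * (c2 * Y)" using c Y by (intro mult_right_mono) auto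
      then show "norm t0 * ?h \<le> c3 * (c2 * Y)" using small(1) by linarith
    qed (use diameter_pos[OF K] in auto)
    also have "\<dots> = interpolation_constant * Y\<^sup>2"
      by (simp add: const power_mult_distrib algebra_simps)
    finally show ?thesis using L2 bound0 by blast
  qed
  ultimately show ?thesis by (rule that)
qed

end

section \<open>The interpolation theorem\<close>

text \<open>The case \<open>K = K'\<close> of local quasi-uniformity compares a cell with its own triangle.\<close>

lemma regular_mesh_shape_regular:
  assumes "open \<Omega>" "0 < \<theta>" "0 < \<kappa>" "regular_mesh \<Omega> \<theta> \<kappa> c\<^sub>0 T N"
  shows "shape_regular_mesh \<Omega> T N \<kappa> (sin (min \<theta> 1) / 2)"
proof
  have reg: "conforming_mesh \<Omega> T N" "min_angle_condition \<theta> T N" "locally_quasi_uniform \<kappa> T N"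
    using assms(4) by (simp_all add: regular_mesh_def)
  show "open \<Omega>" "0 < \<kappa>" "conforming_mesh \<Omega> T N" using assms reg by auto
  have \<theta>: "0 < min \<theta> 1" "min \<theta> 1 \<le> 1" using assms(2) by auto
  show "0 < sin (min \<theta> 1) / 2" using sin_gt_zero[of "min \<theta> 1"] \<theta> pi_gt3 by simp
  have card: "card (N K) = 3" if "K \<in> T" for K
  proof -
    have "straight_cell K (N K) \<or> curved_cell \<Omega> K (N K)" using reg(1) that by (simp add: conforming_mesh_def)
    then show ?thesis by (auto simp: straight_cell_def curved_cell_def)
  qed
  show "diameter K \<le> \<kappa> * diameter (convex hull (N K))" if "K \<in> T" for K
    using reg(3) that card[OF that] by (simp add: locally_quasi_uniform_def)
  show "sin (min \<theta> 1) / 2 * (diameter (convex hull (N K)))\<^sup>2 \<le> \<bar>cross (b - a) (c - a)\<bar>"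
    if K: "K \<in> T" "N K = {a, b, c}" for K a b c
    unfolding K(2)
  proof (rule cross_lower_bound[OF _ \<theta>])
    show "card {a, b, c} = 3" using card[OF K(1)] K(2) by simp
    show "min \<theta> 1 \<le> angle_at x y z" if "{a, b, c} = {x, y, z}" for x y z
      using reg(2) K that by (fastforce simp: min_angle_condition_def intro: min.coboundedI1)
  qed
qed

lemma patch_bounds:
  assumes "finite T" "K \<in> T" "L \<in> patch T N K"
  shows "diameter L \<le> patch_size T N K" and "sobolev_seminorm l (interior L) u \<le> patch_seminorm l T N K u"
proof -
  have fin: "finite (patch T N K)" using assms(1) by (simp add: patch_def)
  show "diameter L \<le> patch_size T N K"
    unfolding patch_size_def using fin assms(3) by (intro Max_ge) auto
  have "(sobolev_seminorm l (interior L) u)\<^sup>2 \<le> (\<Sum>K'\<in>patch T N K. (sobolev_seminorm l (interior K') u)\<^sup>2)"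
    using fin assms(3) by (intro member_le_sum) auto
  then show "sobolev_seminorm l (interior L) u \<le> patch_seminorm l T N K u"
    unfolding patch_seminorm_def by (rule real_le_rsqrt)
qed

lemma sobolev_seminorm_nonneg: "0 \<le> sobolev_seminorm l S u"
  unfolding sobolev_seminorm_def by (intro real_sqrt_ge_zero sum_nonneg) simp

lemma patch_seminorm_nonneg: "0 \<le> patch_seminorm l T N K u"
  unfolding patch_seminorm_def by (intro real_sqrt_ge_zero sum_nonneg) simp

theorem theorem3:
  fixes \<Omega> :: "(real^2) set" and \<theta> \<kappa> c\<^sub>0 :: real
  assumes "open \<Omega>" and "connected \<Omega>" and "\<Omega> \<noteq> {}"
    and "\<theta> > 0" and "\<kappa> > 0" and "c\<^sub>0 > 0"
  shows
    "(\<exists>c>0. \<forall>T N. regular_mesh \<Omega> \<theta> \<kappa> c\<^sub>0 T N \<longrightarrow>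
        (\<forall>u \<in> C0_space \<Omega> \<inter> broken_sobolev 1 T.
           \<exists>w \<in> courant_space \<Omega> T. \<forall>K\<in>T.
             L2_norm (interior K) (\<lambda>x. u x - w x)
               \<le> c * patch_size T N K * patch_seminorm 1 T N K u))
     \<and>
     (\<exists>c>0. \<forall>T N. regular_mesh \<Omega> \<theta> \<kappa> c\<^sub>0 T N \<longrightarrow>
        (\<forall>u \<in> C0_space \<Omega> \<inter> broken_sobolev 2 T.
           \<exists>w \<in> courant_space \<Omega> T. \<forall>K\<in>T. \<forall>l\<in>{0, 1}.
             sobolev_seminorm l (interior K) (\<lambda>x. u x - w x)
               \<le> c * patch_size T N K ^ (2 - l) * patch_seminorm 2 T N K u))"
proof -
  define \<mu> where "\<mu> = sin (min \<theta> 1) / 2"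
  define C where "C = sqrt (shape_regular_mesh.interpolation_constant \<kappa> \<mu>)"
  have mesh: "shape_regular_mesh \<Omega> T N \<kappa> \<mu>" if "regular_mesh \<Omega> \<theta> \<kappa> c\<^sub>0 T N" for T N
    unfolding \<mu>_def using assms that by (intro regular_mesh_shape_regular)
  have const_pos: "0 < 64 + 8 * z\<^sup>2" for z :: real
    using zero_le_power2[of z] by linarith
  show ?thesis
  proof (cases "\<exists>T N. regular_mesh \<Omega> \<theta> \<kappa> c\<^sub>0 T N")
    \<comment> \<open>the positivity of \<open>C\<close> is a consequence of the facts about a mesh, so the case without any mesh is separated\<close>
    case False
    then show ?thesis by (intro conjI exI[of _ "1::real"]) auto
  next
    case True
    then have C: "0 < C"
      unfolding C_def using const_pos
      by (auto simp: shape_regular_mesh.interpolation_constant_def[OF mesh] simp del: real_sqrt_gt_0_iff intro!: real_sqrt_gt_zero)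
    have root: "x \<le> C * y" if "x\<^sup>2 \<le> shape_regular_mesh.interpolation_constant \<kappa> \<mu> * y\<^sup>2" "0 \<le> y" for x y
    proof -
      have "x \<le> sqrt (shape_regular_mesh.interpolation_constant \<kappa> \<mu> * y\<^sup>2)" using that(1) by (rule real_le_rsqrt)
      then show ?thesis using that(2) by (simp add: C_def real_sqrt_mult)
    qed
    have "\<exists>w\<in>courant_space \<Omega> T. \<forall>K\<in>T.
        L2_norm (interior K) (\<lambda>x. u x - w x) \<le> C * patch_size T N K * patch_seminorm 1 T N K u"
      if reg: "regular_mesh \<Omega> \<theta> \<kappa> c\<^sub>0 T N" and u: "u \<in> C0_space \<Omega> \<inter> broken_sobolev 1 T" for T N u
    proof -
      interpret shape_regular_mesh \<Omega> T N \<kappa> \<mu> using mesh[OF reg] .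
      have cont: "continuous_on \<Omega> u" and H1: "\<And>K. K \<in> T \<Longrightarrow> u \<in> sobolev_space 1 (interior K)"
        using u by (auto simp: C0_space_def broken_sobolev_def)
      have L2: "u \<in> L2_space (interior K)" if "K \<in> T" for K
        using H1[OF that] by (simp add: sobolev_space_def)
      have "\<exists>\<alpha> \<beta>. affine_close (interior K) (diameter K) u \<alpha> \<beta> (sobolev_seminorm 1 (interior K) u)" if K: "K \<in> T" for K
        by (rule constant_approximation[OF open_interior convex_interior[OF cell(2)[OF K]] bounded_interior[OF K]
              less_imp_le[OF diameter_pos[OF K]] cell_norm_le[OF K] H1[OF K]])
           (use interior_subset[of K] in blast)+
      then obtain \<alpha> \<beta> where close: "\<And>K. K \<in> T \<Longrightarrow>
          affine_close (interior K) (diameter K) u (\<alpha> K) (\<beta> K) (sobolev_seminorm 1 (interior K) u)"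
        by metis
      obtain w where w: "w \<in> courant_space \<Omega> T" and bound: "\<And>K Y. K \<in> T \<Longrightarrow> 0 \<le> Y \<Longrightarrow>
          (\<And>L. L \<in> patch T N K \<Longrightarrow> sobolev_seminorm 1 (interior L) u \<le> Y) \<Longrightarrow>
          (\<lambda>x. u x - w x) \<in> L2_space (interior K) \<and>
          (L2_norm (interior K) (\<lambda>x. u x - w x))\<^sup>2 \<le> interpolation_constant * (diameter K)\<^sup>2 * Y\<^sup>2 \<and>
          (sobolev_seminorm 1 (interior K) (\<lambda>x. u x - w x))\<^sup>2 \<le> interpolation_constant * Y\<^sup>2"
        using quasi_interpolant[OF cont L2 close sobolev_seminorm_nonneg] by blast
      have "L2_norm (interior K) (\<lambda>x. u x - w x) \<le> C * patch_size T N K * patch_seminorm 1 T N K u" if K: "K \<in> T" for K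
      proof -
        let ?Y = "patch_seminorm 1 T N K u"
        have "(L2_norm (interior K) (\<lambda>x. u x - w x))\<^sup>2 \<le> interpolation_constant * (diameter K * ?Y)\<^sup>2"
          using bound[OF K patch_seminorm_nonneg patch_bounds(2)[OF finite_T K]] by (simp add: power_mult_distrib mult.assoc)
        then have "L2_norm (interior K) (\<lambda>x. u x - w x) \<le> C * (diameter K * ?Y)"
          using diameter_pos[OF K] patch_seminorm_nonneg by (intro root) auto
        also have "\<dots> \<le> C * (patch_size T N K * ?Y)"
        proof (intro mult_left_mono mult_right_mono)
          have "K \<in> patch T N K" using K cell(3)[OF K] by (auto simp: patch_def)
          then show "diameter K \<le> patch_size T N K" by (rule patch_bounds(1)[OF finite_T K])
        qed (use C patch_seminorm_nonneg in auto)
        finally show ?thesis by (simp add: mult.assoc)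
      qed
      then show ?thesis using w by blast
    qed
    moreover have "\<exists>w\<in>courant_space \<Omega> T. \<forall>K\<in>T. \<forall>l\<in>{0, 1}.
        sobolev_seminorm l (interior K) (\<lambda>x. u x - w x) \<le> C * patch_size T N K ^ (2 - l) * patch_seminorm 2 T N K u"
      if reg: "regular_mesh \<Omega> \<theta> \<kappa> c\<^sub>0 T N" and u: "u \<in> C0_space \<Omega> \<inter> broken_sobolev 2 T" for T N u
    proof -
      interpret shape_regular_mesh \<Omega> T N \<kappa> \<mu> using mesh[OF reg] .
      \<comment> \<open>the local error in the affine case carries one power of the diameter, which \<open>patch_size\<close> bounds on the whole patch\<close>
      let ?X = "\<lambda>K. diameter K * sobolev_seminorm 2 (interior K) u"
      have cont: "continuous_on \<Omega> u" and H2: "\<And>K. K \<in> T \<Longrightarrow> u \<in> sobolev_space 2 (interior K)"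
        using u by (auto simp: C0_space_def broken_sobolev_def)
      have L2: "u \<in> L2_space (interior K)" if "K \<in> T" for K
        using H2[OF that] by (simp add: sobolev_space_def)
      have "\<exists>\<alpha> \<beta>. affine_close (interior K) (diameter K) u \<alpha> \<beta> (?X K)" if K: "K \<in> T" for K
        by (rule affine_approximation[OF open_interior convex_interior[OF cell(2)[OF K]] bounded_interior[OF K]
              less_imp_le[OF diameter_pos[OF K]] cell_norm_le[OF K] H2[OF K]])
           (use interior_subset[of K] in blast)+
      then obtain \<alpha> \<beta> where close: "\<And>K. K \<in> T \<Longrightarrow> affine_close (interior K) (diameter K) u (\<alpha> K) (\<beta> K) (?X K)"
        by metis
      have X_nonneg: "0 \<le> ?X K" if "K \<in> T" for K
        using diameter_pos[OF that] sobolev_seminorm_nonneg by simp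
      obtain w where w: "w \<in> courant_space \<Omega> T" and bound: "\<And>K Y. K \<in> T \<Longrightarrow> 0 \<le> Y \<Longrightarrow>
          (\<And>L. L \<in> patch T N K \<Longrightarrow> ?X L \<le> Y) \<Longrightarrow>
          (\<lambda>x. u x - w x) \<in> L2_space (interior K) \<and>
          (L2_norm (interior K) (\<lambda>x. u x - w x))\<^sup>2 \<le> interpolation_constant * (diameter K)\<^sup>2 * Y\<^sup>2 \<and>
          (sobolev_seminorm 1 (interior K) (\<lambda>x. u x - w x))\<^sup>2 \<le> interpolation_constant * Y\<^sup>2"
        using quasi_interpolant[OF cont L2 close X_nonneg] by blast
      have "sobolev_seminorm l (interior K) (\<lambda>x. u x - w x) \<le> C * patch_size T N K ^ (2 - l) * patch_seminorm 2 T N K u"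
        if K: "K \<in> T" and l: "l \<in> {0, 1}" for K l
      proof -
        let ?h = "patch_size T N K" and ?S = "patch_seminorm 2 T N K u"
        have "K \<in> patch T N K" using K cell(3)[OF K] by (auto simp: patch_def)
        then have h: "diameter K \<le> ?h" by (rule patch_bounds(1)[OF finite_T K])
        then have h0: "0 \<le> ?h" using diameter_pos[OF K] by linarith
        have Y: "0 \<le> ?h * ?S" using h0 patch_seminorm_nonneg by simp
        have "?X L \<le> ?h * ?S" if "L \<in> patch T N K" for L
          using patch_bounds[OF finite_T K that] h0 sobolev_seminorm_nonneg by (intro mult_mono) auto
        from bound[OF K Y this]
        have L2: "(\<lambda>x. u x - w x) \<in> L2_space (interior K)"
          and b0: "(L2_norm (interior K) (\<lambda>x. u x - w x))\<^sup>2 \<le> interpolation_constant * (diameter K * (?h * ?S))\<^sup>2"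
          and b1: "(sobolev_seminorm 1 (interior K) (\<lambda>x. u x - w x))\<^sup>2 \<le> interpolation_constant * (?h * ?S)\<^sup>2"
          by (simp_all add: power_mult_distrib mult.assoc)
        have "L2_norm (interior K) (\<lambda>x. u x - w x) \<le> C * (diameter K * (?h * ?S))"
          using b0 diameter_pos[OF K] Y by (intro root) auto
        also have "\<dots> \<le> C * (?h * (?h * ?S))"
          using C Y h by (intro mult_left_mono mult_right_mono) auto
        finally have "sobolev_seminorm 0 (interior K) (\<lambda>x. u x - w x) \<le> C * ?h ^ 2 * ?S"
          using sobolev_seminorm_0[OF open_interior L2] by (simp add: power2_eq_square mult.assoc)
        moreover have "sobolev_seminorm 1 (interior K) (\<lambda>x. u x - w x) \<le> C * (?h * ?S)"
          using b1 Y by (rule root)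
        ultimately show ?thesis using l by (auto simp: mult.assoc)
      qed
      then show ?thesis using w by blast
    qed
    ultimately show ?thesis using C by blast
  qed
qed

end
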